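(* Let $r,n \in \mathbb{N}$ and let $j\ge 1$ be an integer, with $n\ge 2rj$. For $\sigma\in S_n$ let $(a_j)^r(\sigma)=(\text{number of } j\text{-cycles of }\sigma)^r$. Then, as class functions on $S_n$, $$(a_j)^r=\frac{1}{j^r}\left(\sum_{\lambda\vdash n} m^j_{\lambda,r}\,\chi^\lambda\right),$$ where the (signed) integers $m^j_{\lambda,r}$ are as follows: $m^j_{\lambda,r}=0$ unless $\lambda=(n-tj,\bar\lambda)$ for some integer $0\le t\le r$ (with $\bar\lambda\vdash tj$), and for $\lambda=(n-tj,\bar\lambda)$ with $0\le t\le r$, $$m^j_{\lambda,r}=\chi^{\bar\lambda}_{(j^t)}\sum_{a=t}^{r}S(r,a)\binom{a}{t}j^{\,r-a}.$$
   Context: $\mathbb{N}$ includes $0$. For a partition $\lambda=(\lambda_1,\lambda_2,\dots)\vdash n$, $\chi^\lambda$ is the irreducible (complex) character of $S_n$ indexed by $\lambda$, and $\bar\lambda=(\lambda_2,\lambda_3,\dots)$, so that $\lambda=(\lambda_1,\bar\lambda)$. $\chi^{\bar\lambda}_{(j^t)}$ denotes the irreducible character of $S_{tj}$ indexed by $\bar\lambda\vdash tj$ evaluated at the conjugacy class of permutations with exactly $t$ cycles, all of length $j$ (equal to $1$ when $t=0$). $S(r,a)$ is the Stirling number of the second kind, the number of set partitions of $\{1,\dots,r\}$ into $a$ blocks (with $S(0,0)=1$). *)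

theory Defs
  imports
    Complex_Main
    "HOL-Combinatorics.Combinatorics"
    "HOL-Library.Function_Algebras"
begin

text \<open>
  The symmetric group \<open>S\<^sub>n\<close> is the set of all \<open>\<sigma>\<close> with \<open>\<sigma> permutes {..<n}\<close>.  A partition is the
  weakly decreasing list of its positive parts, so trailing zeros are dropped and the only
  partition of \<open>0\<close> is \<open>[]\<close>.
\<close>

definition partitions :: "nat \<Rightarrow> nat list set" where
  "partitions n = {\<mu>. sorted_wrt (\<ge>) \<mu> \<and> 0 \<notin> set \<mu> \<and> sum_list \<mu> = n}"

lemma finite_partitions: "finite (partitions n)"
proof -
  have len: "length \<mu> \<le> sum_list \<mu>" if "0 \<notin> set \<mu>" for \<mu> :: "nat list"
    using that by (induction \<mu>) (auto simp: Suc_le_eq)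
  have "partitions n \<subseteq> {\<mu>. set \<mu> \<subseteq> {..n} \<and> length \<mu> \<le> n}"
    using len by (auto simp: partitions_def dest: member_le_sum_list)
  then show ?thesis
    using finite_lists_length_le[of "{..n}" n] finite_subset by blast
qed

definition num_cycles :: "nat \<Rightarrow> nat \<Rightarrow> (nat \<Rightarrow> nat) \<Rightarrow> nat" where
  "num_cycles j n \<sigma> = card {C \<in> orbit \<sigma> ` {..<n}. card C = j}"


subsection \<open>Traces on subspaces of complex function spaces\<close>

global_interpretation cfun: vector_space "\<lambda>(c::complex) (f::'a \<Rightarrow> complex) x. c * f x"
  by unfold_locales (auto simp: fun_eq_iff algebra_simps)

text \<open>
  Meant for a finite-dimensional subspace \<open>V\<close> that is invariant under the linear map \<open>T\<close>; the
  value is then independent of the chosen basis.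
\<close>

definition trace_on :: "('a \<Rightarrow> complex) set \<Rightarrow> (('a \<Rightarrow> complex) \<Rightarrow> ('a \<Rightarrow> complex)) \<Rightarrow> complex" where
  "trace_on V T =
     (let B = (SOME B. cfun.independent B \<and> cfun.span B = V)
      in \<Sum>b\<in>B. cfun.representation B (T b) b)"


subsection \<open>Irreducible characters of the symmetric groups\<close>

text \<open>
  \<open>tableau_cell \<mu> k\<close> is the (row, column) position of the entry \<open>k\<close>, for \<open>k < sum_list \<mu>\<close>, in the
  tableau of shape \<open>\<mu>\<close> whose rows, read from top to bottom, contain \<open>0, 1, 2, \<dots>\<close> in order.
\<close>

definition tableau_cell :: "nat list \<Rightarrow> nat \<Rightarrow> nat \<times> nat" where
  "tableau_cell \<mu> k = concat (map (\<lambda>i. map (Pair i) [0..<\<mu> ! i]) [0..<length \<mu>]) ! k"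

definition row_stabilizer :: "nat list \<Rightarrow> (nat \<Rightarrow> nat) set" where
  "row_stabilizer \<mu> = {p. p permutes {..<sum_list \<mu>} \<and>
     (\<forall>k<sum_list \<mu>. fst (tableau_cell \<mu> (p k)) = fst (tableau_cell \<mu> k))}"

definition column_stabilizer :: "nat list \<Rightarrow> (nat \<Rightarrow> nat) set" where
  "column_stabilizer \<mu> = {q. q permutes {..<sum_list \<mu>} \<and>
     (\<forall>k<sum_list \<mu>. snd (tableau_cell \<mu> (q k)) = snd (tableau_cell \<mu> k))}"

text \<open>
  An element \<open>\<Sum>\<^sub>g f(g) g\<close> of the complex group algebra of \<open>S\<^sub>n\<close> is represented by its coefficient
  function \<open>f\<close>, which vanishes outside \<open>S\<^sub>n\<close>.  The Young symmetrizer is the product of the row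
  sum \<open>\<Sum>\<^sub>p p\<close> and the signed column sum \<open>\<Sum>\<^sub>q sign(q) q\<close>.
\<close>

definition young_symmetrizer :: "nat list \<Rightarrow> (nat \<Rightarrow> nat) \<Rightarrow> complex" where
  "young_symmetrizer \<mu> g =
     (\<Sum>p\<in>row_stabilizer \<mu>. \<Sum>q\<in>column_stabilizer \<mu>. if p \<circ> q = g then of_int (sign q) else 0)"

text \<open>Left multiplication by \<open>g\<close> on the group algebra, in terms of coefficient functions.\<close>

definition left_mult :: "(nat \<Rightarrow> nat) \<Rightarrow> ((nat \<Rightarrow> nat) \<Rightarrow> complex) \<Rightarrow> ((nat \<Rightarrow> nat) \<Rightarrow> complex)" where
  "left_mult g f = (\<lambda>h. f (inv g \<circ> h))"

text \<open>
  The Specht module of \<open>\<mu>\<close>, realized as the left ideal of the group algebra generated by the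
  Young symmetrizer.  In this convention \<open>[n]\<close> gives the trivial representation.
\<close>

definition specht_module :: "nat list \<Rightarrow> ((nat \<Rightarrow> nat) \<Rightarrow> complex) set" where
  "specht_module \<mu> =
     cfun.span ((\<lambda>g. left_mult g (young_symmetrizer \<mu>)) ` {g. g permutes {..<sum_list \<mu>}})"

text \<open>The irreducible character \<open>\<chi>\<^sup>\<mu>\<close>, evaluated at \<open>\<sigma> \<in> S\<^sub>n\<close> for \<open>\<mu>\<close> a partition of \<open>n\<close>.\<close>

definition irr_char :: "nat list \<Rightarrow> (nat \<Rightarrow> nat) \<Rightarrow> complex" where
  "irr_char \<mu> \<sigma> = trace_on (specht_module \<mu>) (left_mult \<sigma>)"

text \<open>
  The value of \<open>\<chi>\<^sup>\<mu>\<close>, for \<open>\<mu>\<close> a partition of \<open>t * j\<close>, at the conjugacy class of permutations with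
  exactly \<open>t\<close> cycles, all of length \<open>j\<close>.
\<close>

definition irr_char_rect :: "nat list \<Rightarrow> nat \<Rightarrow> nat \<Rightarrow> complex" where
  "irr_char_rect \<mu> j t =
     irr_char \<mu> (SOME \<tau>. \<tau> permutes {..<t * j} \<and> num_cycles j (t * j) \<tau> = t)"


subsection \<open>The multiplicities\<close>

text \<open>
  For \<open>\<mu>\<close> a partition of \<open>n\<close>, the list \<open>tl \<mu>\<close> is \<open>\<mu>\<close> without its first part, and \<open>\<mu>\<close> has the form
  \<open>(n - t j, \<dots>)\<close> exactly if \<open>tl \<mu>\<close> is a partition of \<open>t * j\<close>.  As \<open>j > 0\<close>, such a \<open>t\<close> is unique.
\<close>

definition cycle_mult :: "nat \<Rightarrow> nat \<Rightarrow> nat list \<Rightarrow> complex" where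
  "cycle_mult j r \<mu> =
     (if \<exists>t\<le>r. tl \<mu> \<in> partitions (t * j)
      then let t = (THE t. tl \<mu> \<in> partitions (t * j))
           in irr_char_rect (tl \<mu>) j t *
              (\<Sum>a=t..r. of_nat (Stirling r a * (a choose t) * j ^ (r - a)))
      else 0)"

end

theory Submission
  imports
    Defs
    "HOL-Library.Poly_Mapping"
    "HOL-Computational_Algebra.Polynomial"
    "Jordan_Normal_Form.Determinant"
begin

text \<open>
  Let \<open>p\<^sub>j, h\<^sub>m, e\<^sub>k\<close> be the power sum, complete and elementary symmetric functions, and let \<open>\<theta>\<close> be the
  ring homomorphism \<open>p\<^sub>j \<mapsto> p\<^sub>j - u\<^sup>j\<close>.  Bernstein's formula says that the Schur function of \<open>(N, \<nu>)\<close> arises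
  from \<open>\<theta>(s\<^sub>\<nu>)\<close> by the linear substitution \<open>u\<^sup>k \<mapsto> h\<^bsub>N+k\<^esub>\<close>; it is used here as the definition of \<open>s\<close>.
  Since the \<open>s\<^sub>\<nu>\<close> form an orthonormal basis, \<open>\<Sum>\<^sub>\<nu> \<chi>\<^sup>\<nu>(j\<^sup>t) s\<^sub>\<nu> = p\<^sub>j\<^sup>t\<close>, so \<open>\<Sum>\<^sub>\<nu> \<chi>\<^sup>\<nu>(j\<^sup>t) s\<^bsub>(n-tj,\<nu>)\<^esub>\<close>
  is the image of \<open>(p\<^sub>j - u\<^sup>j)\<^sup>t\<close>, namely \<open>\<Sum>\<^sub>s (t choose s) (-1)\<^bsup>t-s\<^esup> p\<^sub>j\<^sup>s h\<^bsub>n-sj\<^esub>\<close>.  The class function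
  of \<open>p\<^sub>j\<^sup>s h\<^bsub>n-sj\<^esub>\<close> is \<open>j\<^sup>s\<close> times the falling factorial \<open>a\<^sub>j (a\<^sub>j - 1) \<dots> (a\<^sub>j - s + 1)\<close>, and binomial
  inversion followed by the Stirling expansion of \<open>a\<^sub>j\<^sup>r\<close> gives the theorem.

  That \<open>s\<^sub>\<mu>\<close> corresponds to the character of the Specht module of \<open>\<mu>\<close> needs no completeness result:
  both are real class functions of norm 1, and their inner product is 1 because \<open>s\<^sub>\<mu>\<close> is \<open>h\<^sub>\<mu>\<close> plus an
  integer combination of products \<open>h\<^sub>\<kappa>\<close> with \<open>\<Sum>\<^sub>i i \<kappa>\<^sub>i < \<Sum>\<^sub>i i \<mu>\<^sub>i\<close>, to which the Specht character is
  orthogonal.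
\<close>

(* Jordan_Normal_Form brings in HOL-Algebra, whose inv would hide the inverse of functions. *)
no_notation m_inv (\<open>(\<open>open_block notation=\<open>prefix inv\<close>\<close>inv\<index> _)\<close> [81] 80)

section \<open>Symmetric functions in the power sum basis\<close>

text \<open>The bound n >= 2rj makes (n - tj, \<nu>) a partition for every \<nu> of size tj with t
  <= r: its first row is at least tj, hence at least every part of \<nu>. So each Schur function
  produced from \<open>p_j ^ t\<close> belongs to an irreducible character, and none has to be
  straightened. The obstacle on the module side is that the trace refers to an unspecified basis. If
  c is the Young symmetrizer and c c = \<kappa> c, every f in the module satisfies \<kappa> f =
  sum_u f(u) u c. This splits an operator into maps of rank one whose traces are point evaluations,
  and the character becomes a sum of values of c divided by \<kappa>. Its norm and its pairing with
  \<open>h_\<mu>\<close> then rest on one uniqueness statement: a function that is invariant under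
  row permutations on the left and transforms by the sign under column permutations on the right is
  a multiple of c. On the side of symmetric functions, orthonormality gives a basis by counting:
  partitions and cycle types of n are equally many, so the matrix of coefficients is square and a
  one-sided inverse is two-sided.\<close>

text \<open>
  The multiset of cycle lengths of a permutation is encoded by subtracting 1 from each length, so
  that every multiset of natural numbers is a cycle type.
\<close>

definition type_size :: "nat multiset \<Rightarrow> nat" where
  "type_size M = (\<Sum>i\<in>#M. Suc i)"

lemma type_size_simps [simp]:
  "type_size {#} = 0" "type_size (add_mset i M) = Suc i + type_size M" "type_size (M + N) = type_size M + type_size N"
  by (simp_all add: type_size_def)

lemma finite_type_size: "finite {M. type_size M = n}"
proof -
  have size: "size M \<le> type_size M" for M by (induction M) auto
  have "{M. type_size M = n} \<subseteq> mset ` {xs. set xs \<subseteq> {..n} \<and> length xs \<le> n}"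
  proof
    fix M assume "M \<in> {M. type_size M = n}"
    then have M: "type_size M = n" by simp
    obtain xs where xs: "mset xs = M" by (metis ex_mset)
    have "i \<le> type_size N" if "i \<in># N" for i N
      using multi_member_split[OF that] by auto
    then have "set xs \<subseteq> {..n}" using xs M by auto
    moreover have "length xs \<le> n" using size[of M] xs M by auto
    ultimately show "M \<in> mset ` {xs. set xs \<subseteq> {..n} \<and> length xs \<le> n}" using xs by blast
  qed
  then show ?thesis
    using finite_lists_length_le[of "{..n}" n] finite_subset by blast
qed

text \<open>The order z_M of the centralizer of a permutation of cycle type M. An entry i stands for
  a cycle of length i + 1, hence the base \<open>Suc i\<close>.\<close>

definition cent_order :: "nat multiset \<Rightarrow> nat" where
  "cent_order M = (\<Prod>i\<in>set_mset M. Suc i ^ count M i * fact (count M i))"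

lemma cent_order_empty [simp]: "cent_order {#} = 1"
  by (simp add: cent_order_def)

lemma cent_order_add_mset: "cent_order (add_mset i M) = Suc i * Suc (count M i) * cent_order M"
proof -
  define f where "f N k = Suc k ^ count N k * fact (count N k)" for N and k :: nat
  have alt: "cent_order N = prod (f N) S" if "finite S" "set_mset N \<subseteq> S" for N S
    unfolding cent_order_def f_def using that
    by (intro prod.mono_neutral_left) (auto simp: not_in_iff)
  let ?S = "insert i (set_mset M)"
  have "cent_order (add_mset i M) = prod (f (add_mset i M)) ?S"
    by (intro alt) auto
  also have "\<dots> = f (add_mset i M) i * prod (f (add_mset i M)) (?S - {i})"
    by (intro prod.remove) auto
  also have "prod (f (add_mset i M)) (?S - {i}) = prod (f M) (?S - {i})"
    by (intro prod.cong) (auto simp: f_def)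
  also have "f (add_mset i M) i = Suc i * Suc (count M i) * f M i"
    by (simp add: f_def algebra_simps)
  also have "f M i * prod (f M) (?S - {i}) = prod (f M) ?S"
    by (intro prod.remove[symmetric]) auto
  then have "Suc i * Suc (count M i) * f M i * prod (f M) (?S - {i}) = Suc i * Suc (count M i) * cent_order M"
    using alt[of ?S M, OF _ subset_insertI] by (simp add: mult.assoc del: mult_Suc mult_Suc_right)
  finally show ?thesis .
qed

lemma cent_order_pos [simp]: "cent_order M > 0"
  by (induction M) (auto simp: cent_order_add_mset)

lemma cent_order_neq_0 [simp]: "cent_order M \<noteq> 0"
  using cent_order_pos[of M] by linarith

text \<open>Over the complex numbers the symmetric functions form the polynomial ring in the power
  sums, that is, the monoid algebra of the multisets of cycle lengths. \<open>power_sum i\<close> is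
  the power sum of degree i + 1.\<close>

type_synonym symfun = "nat multiset \<Rightarrow>\<^sub>0 complex"

lemma poly_mapping_sum_single:
  fixes F :: "'a \<Rightarrow>\<^sub>0 'b::comm_monoid_add"
  shows "(\<Sum>k\<in>Poly_Mapping.keys F. Poly_Mapping.single k (Poly_Mapping.lookup F k)) = F"
proof (rule poly_mapping_eqI)
  fix k
  have "Poly_Mapping.lookup (\<Sum>j\<in>Poly_Mapping.keys F. Poly_Mapping.single j (Poly_Mapping.lookup F j)) k = (\<Sum>j\<in>Poly_Mapping.keys F. if j = k then Poly_Mapping.lookup F j else 0)"
    by (simp add: Poly_Mapping.lookup_sum Poly_Mapping.lookup_single when_def)
  also have "\<dots> = Poly_Mapping.lookup F k"
    by (auto simp: Poly_Mapping.in_keys_iff Poly_Mapping.finite_keys)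
  finally show "Poly_Mapping.lookup (\<Sum>j\<in>Poly_Mapping.keys F. Poly_Mapping.single j (Poly_Mapping.lookup F j)) k = Poly_Mapping.lookup F k" .
qed

lemma poly_mapping_add_induct [case_names single add]:
  fixes F :: "'a \<Rightarrow>\<^sub>0 'b::comm_monoid_add"
  assumes "\<And>k c. P (Poly_Mapping.single k c)" and "\<And>F G. P F \<Longrightarrow> P G \<Longrightarrow> P (F + G)"
  shows "P F"
proof -
  have "P (\<Sum>k\<in>K. Poly_Mapping.single k (Poly_Mapping.lookup F k))" if "finite K" for K
    using that
  proof (induction K)
    case empty
    show ?case using assms(1)[of undefined 0] by simp
  qed (auto intro: assms)
  from this[of "Poly_Mapping.keys F"] show ?thesis by (simp add: poly_mapping_sum_single Poly_Mapping.finite_keys)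
qed

definition power_sum :: "nat \<Rightarrow> symfun" where "power_sum i = Poly_Mapping.single {#i#} 1"

definition power_sums :: "nat multiset \<Rightarrow> symfun" where "power_sums M = Poly_Mapping.single M 1"

abbreviation const :: "complex \<Rightarrow> symfun" where "const c \<equiv> Poly_Mapping.single {#} c"

lemma power_sums_empty [simp]: "power_sums {#} = 1"
  by (simp add: power_sums_def)

lemma power_sums_add: "power_sums (M + N) = power_sums M * power_sums N"
  by (simp add: power_sums_def mult_single)

lemma power_sums_add_mset: "power_sums (add_mset i M) = power_sum i * power_sums M"
  by (simp add: power_sums_def power_sum_def mult_single)

lemma single_conv_power_sums: "Poly_Mapping.single M c = const c * power_sums M"
  by (simp add: power_sums_def mult_single)

lemma const_add: "const (c + d) = const c + const d"
  by (simp add: single_add)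

lemma const_mult: "const (c * d) = const c * const d"
  by (simp add: mult_single)

lemma lookup_const_mult: "Poly_Mapping.lookup (const c * F) M = c * Poly_Mapping.lookup F M"
proof (induction F rule: poly_mapping_add_induct)
  case (single k d)
  then show ?case by (simp add: mult_single Poly_Mapping.lookup_single when_def)
next
  case (add F G)
  then show ?case by (simp add: algebra_simps Poly_Mapping.lookup_add)
qed

lemma lookup_power_sum_mult: "Poly_Mapping.lookup (power_sum i * F) M = (if i \<in># M then Poly_Mapping.lookup F (M - {#i#}) else 0)"
proof (induction F rule: poly_mapping_add_induct)
  case (single N d)
  have "add_mset i N = M \<longleftrightarrow> i \<in># M \<and> N = M - {#i#}" by auto
  then show ?case by (auto simp: mult_single Poly_Mapping.lookup_single when_def power_sum_def)
next
  case (add F G)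
  then show ?case by (simp add: algebra_simps Poly_Mapping.lookup_add)
qed

lemma lookup_power_sums_mult: "Poly_Mapping.lookup (power_sums N * F) M = (if N \<subseteq># M then Poly_Mapping.lookup F (M - N) else 0)"
proof (induction F rule: poly_mapping_add_induct)
  case (single K d)
  have "N + K = M \<longleftrightarrow> N \<subseteq># M \<and> K = M - N" by auto
  then show ?case by (auto simp: mult_single Poly_Mapping.lookup_single when_def power_sums_def)
next
  case (add F G)
  then show ?case by (simp add: algebra_simps Poly_Mapping.lookup_add)
qed

text \<open>The classical expansion of h_m as the sum of all p_M / z_M, taken as the definition. Its
  class function is therefore the constant 1 in degree m.\<close>

definition complete :: "nat \<Rightarrow> symfun" where
  "complete m = (\<Sum>M\<in>{M. type_size M = m}. Poly_Mapping.single M (1 / of_nat (cent_order M)))"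

lemma lookup_complete: "Poly_Mapping.lookup (complete m) M = (if type_size M = m then 1 / of_nat (cent_order M) else 0)"
proof -
  have "Poly_Mapping.lookup (complete m) M = (\<Sum>N\<in>{N. type_size N = m}. if N = M then 1 / of_nat (cent_order N) else 0)"
    by (simp add: complete_def Poly_Mapping.lookup_sum Poly_Mapping.lookup_single when_def)
  also have "\<dots> = (if type_size M = m then 1 / of_nat (cent_order M) else 0)"
    by (subst sum.delta) (simp_all add: finite_type_size)
  finally show ?thesis .
qed

lemma complete_0 [simp]: "complete 0 = 1"
proof (rule poly_mapping_eqI)
  fix M
  have "type_size M = 0 \<longleftrightarrow> M = {#}" by (cases M) auto
  then show "Poly_Mapping.lookup (complete 0) M = Poly_Mapping.lookup 1 M"
    by (auto simp: lookup_complete Poly_Mapping.lookup_one when_def )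
qed

text \<open>
  \<open>e\<close> is \<open>1\<close> or \<open>-1\<close>.  The coefficients of \<open>u\<^sup>m\<close> are then the adjoint of multiplication by \<open>h\<^sub>m\<close> and
  \<open>(-1)\<^sup>m\<close> times the adjoint of multiplication by \<open>e\<^sub>m\<close>, respectively.
\<close>

definition shift :: "symfun \<Rightarrow> symfun \<Rightarrow> symfun poly" where
  "shift e F = (\<Sum>M\<in>Poly_Mapping.keys F. smult (const (Poly_Mapping.lookup F M)) (\<Prod>i\<in>#M. [:power_sum i:] + monom e (Suc i)))"

lemma shift_superset:
  assumes "finite S" "Poly_Mapping.keys F \<subseteq> S"
  shows "shift e F = (\<Sum>M\<in>S. smult (const (Poly_Mapping.lookup F M)) (\<Prod>i\<in>#M. [:power_sum i:] + monom e (Suc i)))"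
  unfolding shift_def using assms by (intro sum.mono_neutral_left) (auto simp: Poly_Mapping.in_keys_iff)

lemma shift_add [simp]: "shift e (F + G) = shift e F + shift e G"
proof -
  let ?S = "Poly_Mapping.keys F \<union> Poly_Mapping.keys G"
  have "shift e (F + G) = (\<Sum>M\<in>?S. smult (const (Poly_Mapping.lookup (F + G) M)) (\<Prod>i\<in>#M. [:power_sum i:] + monom e (Suc i)))"
    by (intro shift_superset) (use Poly_Mapping.keys_add[of F G] in auto)
  also have "\<dots> = shift e F + shift e G"
    by (simp add: shift_superset[of ?S F] shift_superset[of ?S G] Poly_Mapping.lookup_add const_add
        smult_add_left sum.distrib)
  finally show ?thesis .
qed

lemma shift_0 [simp]: "shift e 0 = 0"
  by (simp add: shift_def)

lemma shift_single:
  "shift e (Poly_Mapping.single M c) = smult (const c) (\<Prod>i\<in>#M. [:power_sum i:] + monom e (Suc i))"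
  by (cases "c = 0") (auto simp: shift_def)

lemma shift_const [simp]: "shift e (const c) = [:const c:]"
  by (simp add: shift_single)

lemma shift_1 [simp]: "shift e 1 = 1"
  using shift_const[of e 1] by (simp add: one_pCons)

lemma shift_mult [simp]: "shift e (F * G) = shift e F * shift e G"
proof (induction F rule: poly_mapping_add_induct)
  case (single M c)
  show ?case
  proof (induction G rule: poly_mapping_add_induct)
    case (single N d)
    show ?case
      by (subst mult_single) (simp add: shift_single const_mult ac_simps)
  qed (simp_all add: algebra_simps)
qed (simp_all add: algebra_simps)

lemma shift_power_sum: "shift e (power_sum i) = [:power_sum i:] + monom e (Suc i)"
  by (simp add: power_sum_def shift_single)

lemma shift_minus [simp]: "shift e (F - G) = shift e F - shift e G"
  by (metis shift_add add_diff_cancel_right' diff_add_cancel)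

lemma shift_power [simp]: "shift e (F ^ k) = shift e F ^ k"
  by (induction k) auto

lemma shift_sum: "shift e (sum f A) = (\<Sum>x\<in>A. shift e (f x))"
  by (induction A rule: infinite_finite_induct) auto

section \<open>Adjoints of multiplication by complete and elementary functions\<close>

definition skew_h :: "nat \<Rightarrow> symfun \<Rightarrow> symfun" where "skew_h m F = coeff (shift 1 F) m"
definition skew_e :: "nat \<Rightarrow> symfun \<Rightarrow> symfun" where "skew_e m F = coeff (shift (-1) F) m"

lemma skew_h_add [simp]: "skew_h m (F + G) = skew_h m F + skew_h m G"
  and skew_h_0 [simp]: "skew_h m 0 = 0"
  and skew_e_add [simp]: "skew_e m (F + G) = skew_e m F + skew_e m G"
  and skew_e_diff [simp]: "skew_e m (F - G) = skew_e m F - skew_e m G"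
  and skew_e_0 [simp]: "skew_e m 0 = 0"
  by (simp_all add: skew_h_def skew_e_def)

lemma skew_h_const_mult [simp]: "skew_h m (const c * F) = const c * skew_h m F"
  and skew_e_const_mult [simp]: "skew_e m (const c * F) = const c * skew_e m F"
  by (simp_all add: skew_h_def skew_e_def)

lemma skew_h_mult: "skew_h m (F * G) = (\<Sum>i\<le>m. skew_h i F * skew_h (m - i) G)"
  by (simp add: skew_h_def coeff_mult)

lemma coeff_shift_power_sum_mult:
  "coeff (shift e (power_sum i * F)) m =
     power_sum i * coeff (shift e F) m + (if Suc i \<le> m then e * coeff (shift e F) (m - Suc i) else 0)"
  by (auto simp: shift_power_sum ring_distribs coeff_monom_mult)

lemma skew_h_power_sum_mult: "skew_h m (power_sum i * F) = power_sum i * skew_h m F + (if Suc i \<le> m then skew_h (m - Suc i) F else 0)"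
  by (simp only: skew_h_def coeff_shift_power_sum_mult) simp

lemma skew_e_power_sum_mult: "skew_e m (power_sum i * F) = power_sum i * skew_e m F - (if Suc i \<le> m then skew_e (m - Suc i) F else 0)"
  by (simp only: skew_e_def coeff_shift_power_sum_mult) simp

lemma skew_h_1: "skew_h m 1 = (if m = 0 then 1 else 0)"
  and skew_e_1: "skew_e m 1 = (if m = 0 then 1 else 0)"
  by (simp_all add: skew_h_def skew_e_def coeff_1)

text \<open>Tailored to the skewing operators, which are linear and satisfy a recursion for one
  further factor \<open>power_sum i\<close>.\<close>

lemma power_sums_induct_linear [consumes 0, case_names one power_sum const add]:
  assumes "P 1" "\<And>i F. P F \<Longrightarrow> P (power_sum i * F)" "\<And>c F. P F \<Longrightarrow> P (const c * F)"
    and "\<And>F G. P F \<Longrightarrow> P G \<Longrightarrow> P (F + G)"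
  shows "P F"
proof (induction F rule: poly_mapping_add_induct)
  case (single M c)
  have "P (power_sums M)"
    by (induction M) (simp_all add: power_sums_add_mset assms(1,2))
  then show ?case by (subst single_conv_power_sums) (rule assms(3))
qed (rule assms)

text \<open>Both operators are coefficients of translations of the power sums, with opposite signs,
  and translations commute.\<close>

lemma skew_h_skew_e_commute: "skew_h m (skew_e k F) = skew_e k (skew_h m F)"
proof (induction F arbitrary: m k rule: power_sums_induct_linear)
  case one
  then show ?case by (simp add: skew_h_1 skew_e_1)
next
  case (power_sum i F)
  have HHd: "skew_h m (F - G) = skew_h m F - skew_h m G" for m F G by (simp add: skew_h_def)
  show ?case
    by (simp add: skew_h_power_sum_mult skew_e_power_sum_mult HHd power_sum)
next
  case (const c F)
  then show ?case by (simp only: skew_h_const_mult skew_e_const_mult)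
next
  case (add F G)
  then show ?case by (simp only: skew_h_add skew_e_add)
qed

text \<open>The translations p_j -> p_j + u^j and p_j -> p_j - u^j undo each other; this is the
  coefficient of u^d in their composite. It is the adjoint form of the vanishing of the alternating
  sum of the products e_k h_(d-k) for d > 0.\<close>

lemma skew_e_skew_h_sum: "(\<Sum>i\<le>d. skew_e (d - i) (skew_h i F)) = (if d = 0 then F else 0)"
proof (induction F arbitrary: d rule: power_sums_induct_linear)
  case one
  have "(\<Sum>i\<le>d. skew_e (d - i) (skew_h i 1)) = (\<Sum>i\<le>d. if i = 0 then skew_e (d - i) 1 else 0)"
    by (intro sum.cong) (auto simp: skew_h_1)
  then show ?case by (simp add: skew_e_1)
next
  case (power_sum j F)
  let ?a = "\<lambda>i. if Suc j \<le> d - i then skew_e (d - i - Suc j) (skew_h i F) else 0"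
  let ?b = "\<lambda>i. if Suc j \<le> i then skew_e (d - i) (skew_h (i - Suc j) F) else 0"
  have "(\<Sum>i\<le>d. skew_e (d - i) (skew_h i (power_sum j * F))) =
      (\<Sum>i\<le>d. power_sum j * skew_e (d - i) (skew_h i F) - ?a i + ?b i)"
    by (intro sum.cong) (simp_all add: skew_h_power_sum_mult skew_e_power_sum_mult)
  also have "\<dots> = power_sum j * (\<Sum>i\<le>d. skew_e (d - i) (skew_h i F)) - sum ?a {..d} + sum ?b {..d}"
    by (simp add: sum.distrib sum_subtractf sum_distrib_left)
  \<comment> \<open>The corrections caused by the two translations agree after shifting i by j + 1,
    so they cancel.\<close>
  also have "sum ?a {..d} = sum ?b {..d}"
  proof (cases "Suc j \<le> d")
    case True
    have "sum ?a {..d} = (\<Sum>i\<in>{..d - Suc j}. skew_e (d - i - Suc j) (skew_h i F))"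
      using True by (intro sum.mono_neutral_cong_right) auto
    also have "\<dots> = (\<Sum>i\<in>{Suc j..d}. skew_e (d - i) (skew_h (i - Suc j) F))"
      using True by (intro sum.reindex_bij_witness[of _ "\<lambda>i. i - Suc j" "\<lambda>i. i + Suc j"]) auto
    also have "\<dots> = sum ?b {..d}"
      by (intro sum.mono_neutral_cong_left) auto
    finally show ?thesis .
  next
    case False
    then have "sum ?a {..d} = 0" "sum ?b {..d} = 0" by (intro sum.neutral; force)+
    then show ?thesis by simp
  qed
  finally show ?case using power_sum by simp
next
  case (const c F)
  then show ?case by (simp flip: sum_distrib_left)
next
  case (add F G)
  then show ?case by (simp add: sum.distrib)
qed

text \<open>Expanding the product of the factors p_j + u^j over A, the monomial p_B arises once for
  each choice of the parts of A that are kept. The quotient of centralizer orders is the product of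
  binomial coefficients counting these choices, since the powers of the cycle lengths
  cancel.\<close>

lemma lookup_skew_h_power_sums:
  "Poly_Mapping.lookup (skew_h m (power_sums A)) B =
     (if B \<subseteq># A \<and> type_size A = type_size B + m then of_nat (cent_order A) / (of_nat (cent_order B) * of_nat (cent_order (A - B))) else 0)"
proof (induction A arbitrary: m B)
  case empty
  then show ?case
    by (auto simp: skew_h_1 Poly_Mapping.lookup_one when_def)
next
  case (add i A)
  have step: "Poly_Mapping.lookup (skew_h m (power_sums (add_mset i A))) B =
      (if i \<in># B then Poly_Mapping.lookup (skew_h m (power_sums A)) (B - {#i#}) else 0) +
      (if Suc i \<le> m then Poly_Mapping.lookup (skew_h (m - Suc i) (power_sums A)) B else 0)"
    by (simp add: power_sums_add_mset skew_h_power_sum_mult Poly_Mapping.lookup_add lookup_power_sum_mult)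
  show ?case
  proof (cases "B \<subseteq># add_mset i A \<and> type_size (add_mset i A) = type_size B + m")
    case True
    define C where "C = add_mset i A - B"
    have AC: "add_mset i A = B + C" using True by (simp add: C_def)
    then have m: "m = type_size C" using True by simp
    let ?r = "of_nat (cent_order A) / (of_nat (cent_order B) * of_nat (cent_order C)) :: complex"
    have 1: "(if i \<in># B then Poly_Mapping.lookup (skew_h m (power_sums A)) (B - {#i#}) else 0) =
        of_nat (Suc i * count B i) * ?r"
    proof (cases "i \<in># B")
      case iB: True
      then obtain B' where B: "B = add_mset i B'" by (metis insert_DiffM)
      then have A: "A = B' + C" using AC by simp
      then show ?thesis
        using m add.IH[of m B'] by (simp add: B cent_order_add_mset del: of_nat_Suc mult_Suc mult_Suc_right)
    next
      case False
      then have "count B i = 0" by (simp add: not_in_iff)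
      then show ?thesis using False by simp
    qed
    have 2: "(if Suc i \<le> m then Poly_Mapping.lookup (skew_h (m - Suc i) (power_sums A)) B else 0) =
        of_nat (Suc i * count C i) * ?r"
    proof (cases "i \<in># C")
      case iC: True
      then obtain C' where C: "C = add_mset i C'" by (metis insert_DiffM)
      then have A: "A = B + C'" using AC by simp
      then show ?thesis
        using m add.IH[of "type_size C'" B] by (simp add: C cent_order_add_mset del: of_nat_Suc mult_Suc mult_Suc_right)
    next
      case False
      have "\<not> B \<subseteq># A"
      proof
        assume "B \<subseteq># A"
        then obtain D where "A = B + D" by (metis subset_mset.add_diff_inverse)
        then show False using AC False by auto
      qed
      then show ?thesis using False by (auto simp: add.IH not_in_iff)
    qed
    \<comment> \<open>Pascal's rule: the kept and the dropped case contribute in the proportion of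
      \<open>count B i\<close> to \<open>count C i\<close>.\<close>
    have "count B i + count C i = Suc (count A i)"
      using AC by (metis count_add_mset count_union)
    then have cnt: "Suc i * count B i + Suc i * count C i = Suc i * Suc (count A i)"
      by (metis add_mult_distrib2)
    have "Poly_Mapping.lookup (skew_h m (power_sums (add_mset i A))) B = of_nat (Suc i * count B i + Suc i * count C i) * ?r"
      unfolding step 1 2 by (simp only: of_nat_add distrib_right)
    also have "\<dots> = of_nat (cent_order (add_mset i A)) / (of_nat (cent_order B) * of_nat (cent_order C))"
      unfolding cnt by (simp only: cent_order_add_mset of_nat_mult) simp
    finally show ?thesis using True by (simp add: C_def)
  next
    case False
    have 1: "\<not> (B - {#i#} \<subseteq># A \<and> type_size A = type_size (B - {#i#}) + m)" if "i \<in># B"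
    proof -
      obtain B' where "B = add_mset i B'" using \<open>i \<in># B\<close> by (metis insert_DiffM)
      then show ?thesis using False by auto
    qed
    have 2: "\<not> (B \<subseteq># A \<and> type_size A = type_size B + (m - Suc i))" if "Suc i \<le> m"
      using False that subset_mset.order_trans[of B A "add_mset i A"] by auto
    show ?thesis unfolding step using False 1 2 by (auto simp: add.IH)
  qed
qed

section \<open>Sums over cycle types and the Hall inner product\<close>

lemma type_size_diff: "B \<subseteq># A \<Longrightarrow> type_size (A - B) = type_size A - type_size B"
  by (metis add_diff_cancel_left' subset_mset.add_diff_inverse type_size_simps(3))

lemma type_size_conv_sum:
  assumes "finite S" "set_mset M \<subseteq> S"
  shows "type_size M = (\<Sum>i\<in>S. Suc i * count M i)"
  using assms(2)
proof (induction M)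
  case (add j M)
  have "(\<Sum>i\<in>S. Suc i * count (add_mset j M) i) = (\<Sum>i\<in>S. Suc i * count M i + (if i = j then Suc i else 0))"
    by (intro sum.cong) auto
  also have "\<dots> = type_size M + Suc j"
    using add assms(1) by (simp add: sum.distrib del: mult_Suc)
  finally show ?case by simp
qed simp

text \<open>A type M with a marked part i corresponds to the pair of i and K = M - {i}, and the
  weight (i + 1) m_i(M) / z_M equals 1 / z_K by \<open>cent_order_add_mset\<close>.\<close>

lemma sum_div_cent_order:
  fixes g :: "nat \<Rightarrow> nat multiset \<Rightarrow> complex"
  shows "(\<Sum>M | type_size M = n. \<Sum>i\<in>set_mset M. of_nat (Suc i * count M i) * g i (M - {#i#}) / of_nat (cent_order M)) =
    (\<Sum>i<n. \<Sum>K | type_size K = n - Suc i. g i K / of_nat (cent_order K))"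
proof -
  have "(\<Sum>M | type_size M = n. \<Sum>i\<in>set_mset M. of_nat (Suc i * count M i) * g i (M - {#i#}) / of_nat (cent_order M)) =
      (\<Sum>(M, i)\<in>(SIGMA M:{M. type_size M = n}. set_mset M). of_nat (Suc i * count M i) * g i (M - {#i#}) / of_nat (cent_order M))"
    by (intro sum.Sigma) (auto simp: finite_type_size)
  also have "\<dots> = (\<Sum>(i, K)\<in>(SIGMA i:{..<n}. {K. type_size K = n - Suc i}). g i K / of_nat (cent_order K))"
  proof (rule sum.reindex_bij_witness[of _ "\<lambda>(i, M). (add_mset i M, i)" "\<lambda>(M, i). (i, M - {#i#})"], goal_cases)
    case (5 a)
    then obtain M i where a: "a = (M, i)" "i \<in># M" by auto
    then obtain M' where M: "M = add_mset i M'" by (metis insert_DiffM)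
    show ?case by (simp add: a M cent_order_add_mset del: of_nat_Suc mult_Suc mult_Suc_right)
  next
    case (2 a)
    then obtain M i where a: "a = (M, i)" "i \<in># M" "type_size M = n" by auto
    then obtain M' where M: "M = add_mset i M'" by (metis insert_DiffM)
    then show ?case using a by auto
  qed auto
  also have "\<dots> = (\<Sum>i<n. \<Sum>K | type_size K = n - Suc i. g i K / of_nat (cent_order K))"
    by (intro sum.Sigma[symmetric]) (auto simp: finite_type_size)
  finally show ?thesis .
qed

lemma sum_count_weighted: "(\<Sum>i\<in>set_mset M. of_nat (Suc i * count M i) :: complex) = of_nat (type_size M)"
  unfolding type_size_conv_sum[OF finite_set_mset order.refl] by simp

text \<open>The class equation of the symmetric group divided by n!, proved without permutations.
  Writing n as the sum of (i + 1) m_i(M) and removing one part shows that n times the n-th sum is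
  the total of all earlier ones.\<close>

lemma sum_inverse_cent_order: "(\<Sum>M | type_size M = n. 1 / of_nat (cent_order M) :: complex) = 1"
proof (induction n rule: less_induct)
  case (less n)
  show ?case
  proof (cases "n = 0")
    case True
    have "{M. type_size M = 0} = {{#}}"
    proof -
      have "type_size M = 0 \<longleftrightarrow> M = {#}" for M by (cases M) auto
      then show ?thesis by auto
    qed
    then show ?thesis using True by simp
  next
    case False
    have "of_nat n * (\<Sum>M | type_size M = n. 1 / of_nat (cent_order M) :: complex) =
        (\<Sum>M | type_size M = n. \<Sum>i\<in>set_mset M. of_nat (Suc i * count M i) * 1 / of_nat (cent_order M))"
      unfolding sum_distrib_left mult_1_right sum_divide_distrib[symmetric] sum_count_weighted
      by (intro sum.cong) auto
    also have "\<dots> = (\<Sum>i<n. \<Sum>M | type_size M = n - Suc i. 1 / of_nat (cent_order M))"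
      by (rule sum_div_cent_order)
    also have "\<dots> = (\<Sum>i<n. 1)"
      by (intro sum.cong refl less) auto
    finally show ?thesis using False by simp
  qed
qed

text \<open>The degree \<open>n\<close> part of the Hall inner product.\<close>

definition hall :: "nat \<Rightarrow> symfun \<Rightarrow> symfun \<Rightarrow> complex" where
  "hall n F G = (\<Sum>M | type_size M = n. Poly_Mapping.lookup F M * Poly_Mapping.lookup G M * of_nat (cent_order M))"

lemma hall_commute: "hall n F G = hall n G F"
  by (simp add: hall_def mult.commute mult.left_commute)

lemma hall_add [simp]: "hall n (F + F') G = hall n F G + hall n F' G" "hall n G (F + F') = hall n G F + hall n G F'"
  by (simp_all add: hall_def Poly_Mapping.lookup_add algebra_simps sum.distrib)

lemma hall_diff [simp]: "hall n G (F - F') = hall n G F - hall n G F'"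
  by (simp add: hall_def Poly_Mapping.lookup_minus algebra_simps sum_subtractf)

lemma hall_0 [simp]: "hall n 0 G = 0" "hall n G 0 = 0"
  by (simp_all add: hall_def)

lemma hall_const [simp]: "hall n (const c * F) G = c * hall n F G" "hall n G (const c * F) = c * hall n G F"
  by (simp_all add: hall_def lookup_const_mult sum_distrib_left mult.assoc mult.left_commute[of _ c])

lemma hall_sum: "hall n G (sum f A) = (\<Sum>x\<in>A. hall n G (f x))"
  by (induction A rule: infinite_finite_induct) auto

lemma hall_power_sums: "hall n F (power_sums B) = (if type_size B = n then Poly_Mapping.lookup F B * of_nat (cent_order B) else 0)"
proof -
  have "hall n F (power_sums B) = (\<Sum>M | type_size M = n. if B = M then Poly_Mapping.lookup F M * of_nat (cent_order M) else 0)"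
    unfolding hall_def by (intro sum.cong) (auto simp: power_sums_def Poly_Mapping.lookup_single when_def)
  then show ?thesis by (simp add: finite_type_size)
qed

text \<open>The adjointness of \<open>skew_h m\<close> and multiplication by h_m. On power sums p_A
  and p_B of matching degrees both sides are z_A / z_(A-B) if B is contained in A, and 0
  otherwise.\<close>

lemma hall_complete_mult: "hall n F (complete m * G) = (if m \<le> n then hall (n - m) (skew_h m F) G else 0)"
proof (induction F rule: poly_mapping_add_induct)
  case (single A c)
  show ?case
  proof (induction G rule: poly_mapping_add_induct)
    case (single B d)
    have "hall n (power_sums A) (complete m * power_sums B) = (if m \<le> n then hall (n - m) (skew_h m (power_sums A)) (power_sums B) else 0)"
    proof (cases "type_size A = n \<and> B \<subseteq># A")
      case True
      then obtain C where C: "A = B + C" by (metis subset_mset.add_diff_inverse)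
      then show ?thesis using True
        by (auto simp: hall_commute[of _ "power_sums (B + C)"] hall_power_sums mult.commute[of "complete m"] lookup_power_sums_mult lookup_skew_h_power_sums lookup_complete)
    next
      case False
      then show ?thesis
        by (auto simp: hall_commute[of _ "power_sums A"] hall_power_sums mult.commute[of "complete m"] lookup_power_sums_mult lookup_skew_h_power_sums)
    qed
    then have "d * (c * hall n (power_sums A) (complete m * power_sums B)) = d * (c * (if m \<le> n then hall (n - m) (skew_h m (power_sums A)) (power_sums B) else 0))"
      by simp
    then show ?case
      by (subst (1 2 3 4) single_conv_power_sums) (simp add: mult.left_commute[of "complete m"] split: if_splits)
  qed (simp_all add: distrib_left)
qed simp_all

text \<open>Pairing with h_n adds up the coefficients in degree n. By adjointness the pairing of the
  left side with p_B is therefore the sum of the coefficients of h_m p_B, which is 1 by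
  \<open>sum_inverse_cent_order\<close>.\<close>

lemma skew_h_complete: "skew_h m (complete n) = (if m \<le> n then complete (n - m) else 0)"
proof (rule poly_mapping_eqI)
  fix B
  have "Poly_Mapping.lookup (skew_h m (complete n)) B * of_nat (cent_order B) = hall (type_size B) (skew_h m (complete n)) (power_sums B)"
    by (simp add: hall_power_sums)
  also have "\<dots> = hall (type_size B + m) (complete n) (complete m * power_sums B)"
    by (simp add: hall_complete_mult)
  also have "\<dots> = (\<Sum>M | type_size M = type_size B + m. if type_size M = n \<and> B \<subseteq># M then Poly_Mapping.lookup (complete m) (M - B) else 0)"
    unfolding hall_def by (intro sum.cong) (auto simp: lookup_complete mult.commute[of "complete m"] lookup_power_sums_mult)
  also have "\<dots> = (if type_size B + m = n then \<Sum>M | type_size M = n \<and> B \<subseteq># M. Poly_Mapping.lookup (complete m) (M - B) else 0)"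
    by (auto simp: sum.If_cases finite_type_size intro!: sum.cong)
  also have "\<dots> = (if type_size B + m = n then 1 else 0)"
  proof (cases "type_size B + m = n")
    case True
    have "(\<Sum>M | type_size M = n \<and> B \<subseteq># M. Poly_Mapping.lookup (complete m) (M - B)) = (\<Sum>C | type_size C = m. 1 / of_nat (cent_order C))"
      using True
      by (intro sum.reindex_bij_witness[of _ "\<lambda>C. B + C" "\<lambda>M. M - B"])
        (auto simp: lookup_complete subset_mset.add_diff_inverse type_size_diff)
    then show ?thesis using True sum_inverse_cent_order by simp
  qed simp
  finally show "Poly_Mapping.lookup (skew_h m (complete n)) B = Poly_Mapping.lookup (if m \<le> n then complete (n - m) else 0) B"
    by (auto simp: lookup_complete field_simps split: if_splits)
qed

text \<open>Applied after \<open>shift (-1)\<close>, this is Bernstein's operator: the alternating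
  sum over k of h_(N+k) times the adjoint of e_k.\<close>

definition bernstein :: "nat \<Rightarrow> symfun poly \<Rightarrow> symfun" where
  "bernstein N q = (\<Sum>k\<le>degree q. complete (N + k) * coeff q k)"

lemma bernstein_bound: "degree q \<le> d \<Longrightarrow> bernstein N q = (\<Sum>k\<le>d. complete (N + k) * coeff q k)"
  unfolding bernstein_def by (intro sum.mono_neutral_left) (auto simp: coeff_eq_0)

lemma bernstein_0 [simp]: "bernstein N 0 = 0"
  by (simp add: bernstein_def)

lemma bernstein_add [simp]: "bernstein N (p + q) = bernstein N p + bernstein N q"
proof -
  let ?d = "max (degree p) (degree q)"
  have "bernstein N (p + q) = (\<Sum>k\<le>?d. complete (N + k) * coeff (p + q) k)"
    by (intro bernstein_bound degree_add_le_max)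
  also have "\<dots> = bernstein N p + bernstein N q"
    by (simp add: bernstein_bound[of p ?d] bernstein_bound[of q ?d] algebra_simps sum.distrib)
  finally show ?thesis .
qed

lemma bernstein_smult [simp]: "bernstein N (smult c q) = c * bernstein N q"
  by (subst bernstein_bound[OF degree_smult_le]) (simp add: bernstein_def sum_distrib_left mult_ac)

lemma bernstein_diff [simp]: "bernstein N (p - q) = bernstein N p - bernstein N q"
  by (metis bernstein_add add_diff_cancel_right' diff_add_cancel)

lemma bernstein_sum: "bernstein N (sum f A) = (\<Sum>x\<in>A. bernstein N (f x))"
  by (induction A rule: infinite_finite_induct) auto

lemma bernstein_pCons [simp]: "bernstein N (pCons a q) = complete N * a + bernstein (Suc N) q"
proof -
  have "bernstein N (pCons a q) = (\<Sum>k\<le>Suc (degree q). complete (N + k) * coeff (pCons a q) k)"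
    by (intro bernstein_bound degree_pCons_le)
  then show ?thesis by (simp add: sum.atMost_Suc_shift bernstein_def del: sum.atMost_Suc)
qed

lemma bernstein_1 [simp]: "bernstein N 1 = complete N"
  by (simp add: one_pCons)

lemma bernstein_monom_mult: "bernstein N (monom c k * q) = c * bernstein (N + k) q"
  by (induction k arbitrary: N) (simp_all add: monom_0 monom_Suc)

section \<open>Schur functions\<close>

fun schur :: "nat list \<Rightarrow> symfun" where
  "schur [] = 1"
| "schur (N # \<nu>) = bernstein N (shift (-1) (schur \<nu>))"

lemma skew_h_sum: "skew_h m (sum f A) = (\<Sum>x\<in>A. skew_h m (f x))"
  by (induction A rule: infinite_finite_induct) auto

text \<open>
  Once \<open>m \<ge> N\<close>, no index restriction is left in the double sum over \<open>k\<close> and \<open>i\<close>, and \<open>skew_e_skew_h_sum\<close>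
  collapses it to the term \<open>k = i = 0\<close>.
\<close>

lemma skew_h_bernstein_shift:
  assumes f: "\<And>i. i > N \<Longrightarrow> skew_h i f = 0" and m: "m \<ge> N"
  shows "skew_h m (bernstein N (shift (-1) f)) = (if m = N then f else 0)"
proof -
  define d where "d = degree (shift (-1) f)"
  define T where "T e = (if m \<le> N + e then complete (N + e - m) else 0)" for e
  have EEd: "skew_e k f = 0" if "k > d" for k
    using that unfolding d_def skew_e_def by (rule coeff_eq_0[rotated]) 
  define g where "g i k = T (k + i) * skew_e k (skew_h i f)" for i k
  have g0: "g i k = 0" if "\<not> (i \<le> m \<and> k \<le> d)" for i k
  proof (cases "k \<le> d")
    case True
    then show ?thesis using that f[of i] m by (simp add: g_def)
  next
    case False
    then have "skew_h i (skew_e k f) = 0" using EEd[of k] by simp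
    then show ?thesis by (simp add: g_def skew_h_skew_e_commute)
  qed
  have "skew_h m (bernstein N (shift (-1) f)) = (\<Sum>k\<le>d. skew_h m (skew_e k f * complete (N + k)))"
    by (simp add: bernstein_def skew_h_sum d_def skew_e_def mult.commute)
  also have "\<dots> = (\<Sum>k\<le>d. \<Sum>i\<le>m. g i k)"
    unfolding skew_h_mult skew_h_complete skew_h_skew_e_commute g_def T_def using m
    by (intro sum.cong refl) (auto simp: mult.commute add_ac intro!: arg_cong2[of _ _ _ _ "(*)"] arg_cong[of _ _ complete])
  also have "\<dots> = (\<Sum>(i, k)\<in>{..m} \<times> {..d}. g i k)"
    by (subst sum.swap) (simp add: sum.cartesian_product)
  \<comment> \<open>The rectangle lies in the triangle and \<open>g\<close> vanishes on the
    difference, so the terms can be grouped by e = i + k, on which \<open>T\<close> depends.\<close>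
  also have "\<dots> = (\<Sum>(i, k)\<in>{(i, k). i + k \<le> m + d}. g i k)"
  proof (rule sum.mono_neutral_left)
    have "{(i, k). i + k \<le> m + d} \<subseteq> {..m + d} \<times> {..m + d}" by auto
    then show "finite {(i, k). i + k \<le> m + d}" by (rule finite_subset) auto
  qed (auto intro: g0)
  also have "\<dots> = (\<Sum>e\<le>m + d. \<Sum>i\<le>e. g i (e - i))"
    by (rule sum.triangle_reindex_eq)
  also have "\<dots> = (\<Sum>e\<le>m + d. T e * (\<Sum>i\<le>e. skew_e (e - i) (skew_h i f)))"
    unfolding g_def sum_distrib_left by (intro sum.cong refl) auto
  also have "\<dots> = (\<Sum>e\<le>m + d. if e = 0 then T 0 * f else 0)"
    unfolding skew_e_skew_h_sum by (intro sum.cong) auto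
  also have "\<dots> = (if m = N then f else 0)"
    using m by (auto simp: T_def)
  finally show ?thesis .
qed

text \<open>The extreme case of Pieri's rule: a horizontal strip in (N, \<nu>) has at most N boxes,
  and removing one with N boxes leaves \<nu>. The vanishing that
  \<open>skew_h_bernstein_shift\<close> requires of the Schur function of \<nu> comes from the
  induction, as the first part of \<nu> is at most N.\<close>

lemma skew_h_schur:
  assumes "sorted_wrt (\<ge>) (N # \<nu>)" "m \<ge> N"
  shows "skew_h m (schur (N # \<nu>)) = (if m = N then schur \<nu> else 0)"
  using assms
proof (induction \<nu> arbitrary: N m)
  case Nil
  then show ?case by (simp add: skew_h_complete)
next
  case (Cons a \<nu>)
  have "skew_h i (schur (a # \<nu>)) = 0" if "i > N" for i
    using Cons.IH[of a i] Cons.prems that by auto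
  then show ?case
    using skew_h_bernstein_shift[of N "schur (a # \<nu>)" m] Cons.prems by simp
qed

lemma skew_e_zero [simp]: "skew_e 0 F = F"
  by (induction F rule: power_sums_induct_linear) (simp_all add: skew_e_1 skew_e_power_sum_mult)

text \<open>The factors h_(N'+k) of the second Schur function are moved to the first one as skewing
  operators. Their degree is at least N, so only k = 0 with N' = N survives. The condition N <= N'
  is met by exchanging the arguments when the first rows are in the other order.\<close>

lemma hall_schur_Cons:
  assumes "sorted_wrt (\<ge>) (N # \<nu>)" "N \<le> N'" "N' \<le> n"
  shows "hall n (schur (N # \<nu>)) (schur (N' # \<nu>')) = (if N = N' then hall (n - N) (schur \<nu>) (schur \<nu>') else 0)"
proof -
  let ?F = "schur (N # \<nu>)" and ?q = "shift (-1) (schur \<nu>')"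
  have "hall n ?F (schur (N' # \<nu>')) = (\<Sum>k\<le>degree ?q. hall n ?F (complete (N' + k) * skew_e k (schur \<nu>')))"
    by (simp add: bernstein_def hall_sum skew_e_def del: hall_complete_mult)
  also have "\<dots> = (\<Sum>k\<le>degree ?q. if k = 0 then (if N = N' then hall (n - N) (schur \<nu>) (schur \<nu>') else 0) else 0)"
  proof (intro sum.cong refl)
    fix k
    have "skew_h (N' + k) ?F = (if k = 0 \<and> N = N' then schur \<nu> else 0)"
      using skew_h_schur[OF assms(1), of "N' + k"] assms(2) by auto
    then show "hall n ?F (complete (N' + k) * skew_e k (schur \<nu>')) =
        (if k = 0 then (if N = N' then hall (n - N) (schur \<nu>) (schur \<nu>') else 0) else 0)"
      using assms(3) by (auto simp: hall_complete_mult simp del: schur.simps)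
  qed
  finally show ?thesis by simp
qed

lemma hall_schur:
  assumes "\<kappa> \<in> partitions n" "\<mu> \<in> partitions n"
  shows "hall n (schur \<kappa>) (schur \<mu>) = (if \<kappa> = \<mu> then 1 else 0)"
  using assms
proof (induction \<kappa> arbitrary: \<mu> n)
  case Nil
  then have "n = 0" "\<mu> = []" by (auto simp: partitions_def) (metis list.set_intros(1) neq_Nil_conv)
  then show ?case using hall_power_sums[of 0 1 "{#}"] by (simp add: Poly_Mapping.lookup_one)
next
  case (Cons a \<kappa>)
  then obtain b \<mu>' where \<mu>: "\<mu> = b # \<mu>'"
    by (cases \<mu>) (auto simp: partitions_def)
  have ab: "a \<le> n" "b \<le> n" and srt: "sorted_wrt (\<ge>) (a # \<kappa>)" "sorted_wrt (\<ge>) (b # \<mu>')"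
    and p: "\<kappa> \<in> partitions (n - a)" "\<mu>' \<in> partitions (n - b)"
    using Cons.prems \<mu> by (auto simp: partitions_def)
  show ?case
  proof (cases "a \<le> b")
    case True
    then show ?thesis
      using hall_schur_Cons[OF srt(1) True ab(2), of \<mu>'] Cons.IH[OF p(1), of \<mu>'] p(2) \<mu> by auto
  next
    case False
    then show ?thesis
      using hall_schur_Cons[OF srt(2) _ ab(1), of \<kappa>] \<mu> by (auto simp: hall_commute[of n "schur (a # \<kappa>)"] simp del: schur.simps)
  qed
qed

section \<open>Triangular expansion of Schur functions in products of complete functions\<close>

definition complete_prod :: "nat list \<Rightarrow> symfun" where
  "complete_prod \<kappa> = prod_list (map complete \<kappa>)"

lemma complete_prod_simps [simp]: "complete_prod [] = 1" "complete_prod (a # \<kappa>) = complete a * complete_prod \<kappa>"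
  by (simp_all add: complete_prod_def)

definition additive_subgroup :: "'a::ab_group_add set \<Rightarrow> bool" where
  "additive_subgroup Q \<longleftrightarrow> 0 \<in> Q \<and> (\<forall>x\<in>Q. \<forall>y\<in>Q. x + y \<in> Q \<and> x - y \<in> Q)"

lemma additive_subgroup_add: "additive_subgroup Q \<Longrightarrow> x \<in> Q \<Longrightarrow> y \<in> Q \<Longrightarrow> x + y \<in> Q"
  by (simp add: additive_subgroup_def)

lemma additive_subgroup_vimage:
  assumes "additive_subgroup Q" "\<And>x y. f (x + y) = f x + f y" "\<And>x y. f (x - y) = f x - f y" "f 0 = 0"
  shows "additive_subgroup {x. f x \<in> Q}"
  using assms by (simp add: additive_subgroup_def)

text \<open>In the relation \<open>skew_e_skew_h_sum\<close> for h_(n+1), the terms with i > 0 form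
  the same relation for h_n. Hence the adjoint of e_1 lowers the index and the adjoints of the
  higher e_k give 0.\<close>

lemma shift_complete: "shift (-1) (complete (Suc n)) = [:complete (Suc n), - complete n:]"
proof (rule poly_eqI)
  fix d
  have S: "(\<Sum>i\<le>d. skew_e (d - i) (skew_h i (complete n))) = (if d = 0 then complete n else 0)" for d n
    by (rule skew_e_skew_h_sum)
  have "skew_e d (complete (Suc n)) = (if d = 0 then complete (Suc n) else if d = 1 then - complete n else 0)"
  proof (cases d)
    case (Suc e)
    have "(\<Sum>i\<le>Suc e. skew_e (Suc e - i) (skew_h i (complete (Suc n)))) =
        skew_e (Suc e) (complete (Suc n)) + (\<Sum>i\<le>e. skew_e (e - i) (skew_h i (complete n)))"
      unfolding sum.atMost_Suc_shift by (simp add: skew_h_complete cong: sum.cong if_cong)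
    then show ?thesis using Suc by (simp only: S) (auto simp: eq_neg_iff_add_eq_0)
  qed simp
  then show "coeff (shift (-1) (complete (Suc n))) d = coeff [:complete (Suc n), - complete n:] d"
    by (auto simp: skew_e_def coeff_pCons split: nat.split)
qed

text \<open>Each factor h_a of the product becomes h_a - u h_(a-1), and a power of u is absorbed by
  the first row. Choosing the second summand thus moves one box from that row into the first;
  choosing it nowhere gives the subtracted term.\<close>

lemma bernstein_complete_prod_expansion:
  assumes "additive_subgroup Q"
    and "\<And>N' \<kappa>. list_all2 (\<le>) \<kappa> \<mu> \<Longrightarrow> N' > N \<Longrightarrow> N' + sum_list \<kappa> = N + sum_list \<mu> \<Longrightarrow> complete N' * complete_prod \<kappa> \<in> Q"
  shows "bernstein N (shift (-1) (complete_prod \<mu>)) - complete N * complete_prod \<mu> \<in> Q"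
  using assms
proof (induction \<mu> arbitrary: N Q)
  case Nil
  then show ?case by (simp add: additive_subgroup_def)
next
  case (Cons a \<mu>)
  show ?case
  proof (cases a)
    case 0
    have "complete N' * complete_prod \<kappa> \<in> Q" if "list_all2 (\<le>) \<kappa> \<mu>" "N' > N" "N' + sum_list \<kappa> = N + sum_list \<mu>" for N' \<kappa>
      using Cons.prems(2)[of "0 # \<kappa>" N'] that 0 by simp
    then show ?thesis using Cons.IH[OF Cons.prems(1), of N] 0 by simp
  next
    case (Suc b)
    let ?X = "shift (-1) (complete_prod \<mu>)"
    \<comment> \<open>Pulling \<open>Q\<close> back along multiplication by a fixed h_c removes that
      factor, which is how the induction passes to a shorter product.\<close>
    have sub: "additive_subgroup {F. complete c * F \<in> Q}" for c
      using Cons.prems(1) by (rule additive_subgroup_vimage) (simp_all add: algebra_simps)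
    have 1: "complete a * (bernstein N ?X - complete N * complete_prod \<mu>) \<in> Q"
    proof -
      have "bernstein N ?X - complete N * complete_prod \<mu> \<in> {F. complete a * F \<in> Q}"
      proof (rule Cons.IH[OF sub])
        fix N' \<kappa> assume "list_all2 (\<le>) \<kappa> \<mu>" "N' > N" "N' + sum_list \<kappa> = N + sum_list \<mu>"
        then show "complete N' * complete_prod \<kappa> \<in> {F. complete a * F \<in> Q}"
          using Cons.prems(2)[of "a # \<kappa>" N'] by (simp add: mult.left_commute)
      qed
      then show ?thesis by simp
    qed
    have 2: "complete b * (bernstein (Suc N) ?X - complete (Suc N) * complete_prod \<mu>) \<in> Q"
    proof -
      have "bernstein (Suc N) ?X - complete (Suc N) * complete_prod \<mu> \<in> {F. complete b * F \<in> Q}"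
      proof (rule Cons.IH[OF sub])
        fix N' \<kappa> assume "list_all2 (\<le>) \<kappa> \<mu>" "N' > Suc N" "N' + sum_list \<kappa> = Suc N + sum_list \<mu>"
        then show "complete N' * complete_prod \<kappa> \<in> {F. complete b * F \<in> Q}"
          using Cons.prems(2)[of "b # \<kappa>" N'] Suc by (simp add: mult.left_commute)
      qed
      then show ?thesis by simp
    qed
    have 3: "complete b * (complete (Suc N) * complete_prod \<mu>) \<in> Q"
      using Cons.prems(2)[of "b # \<mu>" "Suc N"] Suc by (simp add: mult.left_commute list_all2_refl)
    have "bernstein N (shift (-1) (complete_prod (a # \<mu>))) - complete N * complete_prod (a # \<mu>) =
        complete a * (bernstein N ?X - complete N * complete_prod \<mu>) - (complete b * (bernstein (Suc N) ?X - complete (Suc N) * complete_prod \<mu>) + complete b * (complete (Suc N) * complete_prod \<mu>))"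
      by (simp add: Suc shift_complete algebra_simps flip: smult_minus_left)
    then show ?thesis using 1 2 3 Cons.prems(1) by (simp only: additive_subgroup_def)
  qed
qed

text \<open>
  The statistic \<open>\<Sum>\<^sub>i i \<kappa>\<^sub>i\<close> with rows counted from 0.  It drops whenever boxes are moved to the first row,
  and the column argument below bounds it as well, so it can replace the dominance order.
\<close>

fun row_weight :: "nat list \<Rightarrow> nat" where
  "row_weight [] = 0"
| "row_weight (a # \<kappa>) = sum_list \<kappa> + row_weight \<kappa>"

lemma row_weight_mono: "list_all2 (\<le>) \<kappa> \<mu> \<Longrightarrow> row_weight \<kappa> \<le> row_weight \<mu> \<and> sum_list \<kappa> \<le> sum_list \<mu>"
  by (induction rule: list_all2_induct) auto

text \<open>
  The subgroup \<open>Q\<close> stands for whatever property of the terms of the triangular expansion of \<open>s\<^sub>\<mu>\<close> is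
  needed; this avoids naming its integer coefficients.
\<close>

lemma schur_expansion:
  assumes "additive_subgroup Q"
    and "\<And>\<kappa>. sum_list \<kappa> = sum_list \<mu> \<Longrightarrow> row_weight \<kappa> < row_weight \<mu> \<Longrightarrow> complete_prod \<kappa> \<in> Q"
  shows "schur \<mu> - complete_prod \<mu> \<in> Q"
  using assms
proof (induction \<mu> arbitrary: Q)
  case Nil
  then show ?case by (simp add: additive_subgroup_def)
next
  case (Cons N \<nu>)
  let ?f = "\<lambda>F. bernstein N (shift (-1) F)"
  have expand: "?f (complete_prod \<kappa>) - complete_prod (N # \<kappa>) \<in> Q" if "sum_list \<kappa> = sum_list \<nu>" "row_weight \<kappa> \<le> row_weight \<nu>" for \<kappa>
    unfolding complete_prod_simps
  proof (rule bernstein_complete_prod_expansion[OF Cons.prems(1)])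
    fix N' \<kappa>' assume *: "list_all2 (\<le>) \<kappa>' \<kappa>" "N' > N" "N' + sum_list \<kappa>' = N + sum_list \<kappa>"
    then have "row_weight (N' # \<kappa>') < row_weight (N # \<nu>)" using that row_weight_mono[of \<kappa>' \<kappa>] by auto
    then show "complete N' * complete_prod \<kappa>' \<in> Q" using Cons.prems(2)[of "N' # \<kappa>'"] * that by simp
  qed
  have "schur \<nu> - complete_prod \<nu> \<in> {F. ?f F \<in> Q}"
  proof (rule Cons.IH)
    show "additive_subgroup {F. ?f F \<in> Q}"
      using Cons.prems(1) by (rule additive_subgroup_vimage) simp_all
    fix \<kappa> assume *: "sum_list \<kappa> = sum_list \<nu>" "row_weight \<kappa> < row_weight \<nu>"
    have "complete_prod (N # \<kappa>) \<in> Q" using Cons.prems(2)[of "N # \<kappa>"] * by simp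
    with expand[of \<kappa>] * have "(?f (complete_prod \<kappa>) - complete_prod (N # \<kappa>)) + complete_prod (N # \<kappa>) \<in> Q"
      by (intro additive_subgroup_add[OF Cons.prems(1)]) auto
    then show "complete_prod \<kappa> \<in> {F. ?f F \<in> Q}" by simp
  qed
  then have "(?f (schur \<nu>) - ?f (complete_prod \<nu>)) + (?f (complete_prod \<nu>) - complete_prod (N # \<nu>)) \<in> Q"
    using expand[of \<nu>] by (intro additive_subgroup_add[OF Cons.prems(1)]) auto
  then show ?case by simp
qed

lemma schur_in:
  assumes "additive_subgroup Q" and "\<And>\<kappa>. sum_list \<kappa> = sum_list \<mu> \<Longrightarrow> complete_prod \<kappa> \<in> Q"
  shows "schur \<mu> \<in> Q"
proof -
  have "(schur \<mu> - complete_prod \<mu>) + complete_prod \<mu> \<in> Q"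
    using schur_expansion[of Q \<mu>] assms by (intro additive_subgroup_add) auto
  then show ?thesis by simp
qed

lemma lookup_complete_mult_eq_0: "(\<And>M. type_size M \<noteq> n \<Longrightarrow> Poly_Mapping.lookup F M = 0) \<Longrightarrow> type_size M \<noteq> m + n \<Longrightarrow>
    Poly_Mapping.lookup (complete m * F) M = 0"
proof -
  assume F: "\<And>M. type_size M \<noteq> n \<Longrightarrow> Poly_Mapping.lookup F M = 0" and M: "type_size M \<noteq> m + n"
  have "complete m * F = (\<Sum>N | type_size N = m. const (1 / of_nat (cent_order N)) * (power_sums N * F))"
    unfolding complete_def sum_distrib_right by (subst single_conv_power_sums) (simp add: mult.assoc)
  moreover have "Poly_Mapping.lookup (const c * (power_sums N * F)) M = 0" if "type_size N = m" for N c
    using F[of "M - N"] M that by (auto simp: lookup_const_mult lookup_power_sums_mult type_size_diff)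
      (metis add.commute le_add_diff_inverse2 nat_le_iff_add subset_mset.add_diff_inverse type_size_simps(3))
  ultimately show ?thesis by (simp add: Poly_Mapping.lookup_sum)
qed

lemma lookup_complete_prod_eq_0: "type_size M \<noteq> sum_list \<kappa> \<Longrightarrow> Poly_Mapping.lookup (complete_prod \<kappa>) M = 0"
proof (induction \<kappa> arbitrary: M)
  case Nil
  then show ?case by (auto simp: Poly_Mapping.lookup_one when_def)
next
  case (Cons a \<kappa>)
  then show ?case by (simp add: lookup_complete_mult_eq_0[of "sum_list \<kappa>"])
qed

lemma lookup_schur_eq_0:
  assumes "type_size M \<noteq> sum_list \<mu>" shows "Poly_Mapping.lookup (schur \<mu>) M = 0"
proof -
  have "schur \<mu> \<in> {F. Poly_Mapping.lookup F M = 0}"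
    by (rule schur_in) (auto simp: additive_subgroup_def lookup_complete_prod_eq_0 assms Poly_Mapping.lookup_add Poly_Mapping.lookup_minus)
  then show ?thesis by simp
qed

text \<open>The class function of a symmetric function, evaluated at the cycle type \<open>M\<close>.\<close>

definition class_value :: "nat multiset \<Rightarrow> symfun \<Rightarrow> complex" where
  "class_value M F = of_nat (cent_order M) * Poly_Mapping.lookup F M"

lemma class_value_add [simp]: "class_value M (F + G) = class_value M F + class_value M G"
  and class_value_diff [simp]: "class_value M (F - G) = class_value M F - class_value M G"
  and class_value_0 [simp]: "class_value M 0 = 0"
  and class_value_const [simp]: "class_value M (const c * F) = c * class_value M F"
  by (simp_all add: class_value_def Poly_Mapping.lookup_add Poly_Mapping.lookup_minus lookup_const_mult ring_distribs mult.left_commute)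

lemma class_value_sum: "class_value M (sum f A) = (\<Sum>x\<in>A. class_value M (f x))"
  by (induction A rule: infinite_finite_induct) auto

lemma class_value_hall: "class_value M F = hall (type_size M) F (power_sums M)"
  by (simp add: class_value_def hall_power_sums)


text \<open>The class value at A is the pairing with p_A. By adjointness h_m moves to p_A, and
  skewing p_A gives an integer combination of power sums, whose pairings with G are class values of
  G.\<close>

lemma class_value_complete_mult_Ints:
  assumes "\<And>M. class_value M G \<in> \<int>"
  shows "class_value A (complete m * G) \<in> \<int>"
proof -
  \<comment> \<open>The extra factor p_B collects the parts of A that the induction has already
    split off and kept.\<close>
  have *: "hall n G (power_sums B * skew_h m (power_sums A)) \<in> \<int>" for n B
  proof (induction A arbitrary: n m B)
    case empty
    then show ?case using assms[of B] by (auto simp: skew_h_1 class_value_def hall_power_sums mult.commute)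
  next
    case (add i A)
    have "power_sums B * skew_h m (power_sums (add_mset i A)) =
        power_sums (add_mset i B) * skew_h m (power_sums A) + (if Suc i \<le> m then power_sums B * skew_h (m - Suc i) (power_sums A) else 0)"
      by (simp add: power_sums_add_mset skew_h_power_sum_mult distrib_left mult.assoc mult.left_commute[of "power_sums B"])
    then show ?case using add[where B = "add_mset i B" and n = n and m = m] add[where m = "m - Suc i" and n = n and B = B] by auto
  qed
  show ?thesis
    using *[of "type_size A - m" "{#}"] by (simp add: class_value_hall hall_commute[of _ _ "power_sums A"] hall_complete_mult hall_commute[of _ _ G])
qed

text \<open>Used twice: for the integrality of the multiplicities, and to know that the class
  function is real when it is compared with the Specht character.\<close>

lemma class_value_schur_Ints: "class_value M (schur \<mu>) \<in> \<int>"
proof -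
  have "class_value M (complete_prod \<kappa>) \<in> \<int>" for \<kappa> M
  proof (induction \<kappa> arbitrary: M)
    case Nil
    then show ?case by (simp add: class_value_def Poly_Mapping.lookup_one when_def)
  next
    case (Cons a \<kappa>)
    then show ?case by (simp add: class_value_complete_mult_Ints)
  qed
  then have "schur \<mu> \<in> {F. class_value M F \<in> \<int>}"
    by (intro schur_in) (auto simp: additive_subgroup_def)
  then show ?thesis by simp
qed

section \<open>Completeness of the Schur functions\<close>

lemma bij_betw_partitions_types: "bij_betw (\<lambda>\<nu>. mset (map (\<lambda>x. x - 1) \<nu>)) (partitions n) {M. type_size M = n}"
proof (rule bij_betwI[where g = "\<lambda>M. rev (sorted_list_of_multiset (image_mset Suc M))"])
  have type_size_mset: "type_size (mset xs) = sum_list (map Suc xs)" for xs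
    by (induction xs) auto
  have map_id: "map (\<lambda>x. Suc (x - 1)) \<nu> = \<nu>" if "0 \<notin> set \<nu>" for \<nu>
    using that by (induction \<nu>) auto
  show "(\<lambda>\<nu>. mset (map (\<lambda>x. x - 1) \<nu>)) \<in> partitions n \<rightarrow> {M. type_size M = n}"
    by (auto simp: partitions_def type_size_mset comp_def map_id[simplified] simp del: mset_map)
  show "(\<lambda>M. rev (sorted_list_of_multiset (image_mset Suc M))) \<in> {M. type_size M = n} \<rightarrow> partitions n"
    by (auto simp: partitions_def sorted_wrt_rev type_size_def simp flip: sum_mset_sum_list)
  show "rev (sorted_list_of_multiset (image_mset Suc (mset (map (\<lambda>x. x - 1) \<nu>)))) = \<nu>" if "\<nu> \<in> partitions n" for \<nu>
  proof -
    have "image_mset Suc (mset (map (\<lambda>x. x - 1) \<nu>)) = mset (rev \<nu>)"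
      using that map_id[of \<nu>] by (simp add: partitions_def comp_def flip: mset_map)
    moreover have "sorted (rev \<nu>)" using that by (simp add: partitions_def sorted_wrt_rev)
    ultimately show ?thesis
      by (metis rev_rev_ident sorted_list_of_multiset_mset sorted_sort_id)
  qed
qed (auto simp: multiset.map_comp comp_def)

text \<open>A one-sided inverse of a square matrix is two-sided. The two index sets remain different
  because rows will be partitions and columns cycle types.\<close>

lemma left_right_inverse_finite:
  fixes A :: "'i \<Rightarrow> 'j \<Rightarrow> 'a::field"
  assumes "finite I" "finite J" "card I = card J"
    and AB: "\<And>i k. i \<in> I \<Longrightarrow> k \<in> I \<Longrightarrow> (\<Sum>j\<in>J. A i j * B j k) = (if i = k then 1 else 0)"
    and jl: "j \<in> J" "l \<in> J"
  shows "(\<Sum>i\<in>I. B j i * A i l) = (if j = l then 1 else 0)"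
proof -
  define m where "m = card I"
  obtain f where f: "bij_betw f {0..<m} I" using ex_bij_betw_nat_finite[OF assms(1)] m_def by auto
  obtain g where g: "bij_betw g {0..<m} J" using ex_bij_betw_nat_finite[OF assms(2)] m_def assms(3) by auto
  define P where "P = mat m m (\<lambda>(x, y). A (f x) (g y))"
  define Q where "Q = mat m m (\<lambda>(x, y). B (g x) (f y))"
  have fI: "f x \<in> I" if "x < m" for x using f that by (auto simp: bij_betw_def)
  have f_eq: "f x = f y \<longleftrightarrow> x = y" if "x < m" "y < m" for x y
    using f that by (auto simp: bij_betw_def inj_on_def)
  have "P * Q = 1\<^sub>m m"
  proof (rule eq_matI)
    fix x y assume xy: "x < dim_row (1\<^sub>m m :: 'a mat)" "y < dim_col (1\<^sub>m m :: 'a mat)"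
    then have "(P * Q) $$ (x, y) = (\<Sum>z = 0..<m. A (f x) (g z) * B (g z) (f y))"
      by (simp add: P_def Q_def scalar_prod_def)
    also have "\<dots> = (\<Sum>j\<in>J. A (f x) j * B j (f y))"
      using sum.reindex_bij_betw[OF g, of "\<lambda>j. A (f x) j * B j (f y)"] by simp
    finally show "(P * Q) $$ (x, y) = 1\<^sub>m m $$ (x, y)"
      using xy by (simp add: AB fI f_eq)
  qed (simp_all add: P_def Q_def)
  then have QP: "Q * P = 1\<^sub>m m"
    by (rule mat_mult_left_right_inverse[rotated 2]) (simp_all add: P_def Q_def)
  obtain x y where xy: "x < m" "y < m" "j = g x" "l = g y"
    using jl g by (auto simp: bij_betw_def)
  have "(\<Sum>i\<in>I. B j i * A i l) = (\<Sum>z = 0..<m. B j (f z) * A (f z) l)"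
    using sum.reindex_bij_betw[OF f, of "\<lambda>i. B j i * A i l"] by simp
  also have "\<dots> = (Q * P) $$ (x, y)"
    using xy by (simp add: P_def Q_def scalar_prod_def)
  also have "\<dots> = (if j = l then 1 else 0)"
    using xy g unfolding QP by (auto simp: bij_betw_def inj_on_def)
  finally show ?thesis .
qed

text \<open>Orthonormality of the Schur functions is row orthogonality of a square matrix; the
  column orthogonality that follows is this expansion, read off coefficient by coefficient.\<close>

lemma sum_class_value_schur:
  assumes M: "type_size M = n"
  shows "(\<Sum>\<nu>\<in>partitions n. const (class_value M (schur \<nu>)) * schur \<nu>) = power_sums M"
proof (rule poly_mapping_eqI)
  fix N
  have L: "Poly_Mapping.lookup (\<Sum>\<nu>\<in>partitions n. const (class_value M (schur \<nu>)) * schur \<nu>) N =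
      (\<Sum>\<nu>\<in>partitions n. class_value M (schur \<nu>) * Poly_Mapping.lookup (schur \<nu>) N)"
    by (simp add: Poly_Mapping.lookup_sum lookup_const_mult)
  show "Poly_Mapping.lookup (\<Sum>\<nu>\<in>partitions n. const (class_value M (schur \<nu>)) * schur \<nu>) N = Poly_Mapping.lookup (power_sums M) N"
  proof (cases "type_size N = n")
    case True
    have "(\<Sum>\<nu>\<in>partitions n. class_value M (schur \<nu>) * Poly_Mapping.lookup (schur \<nu>) N) = (if M = N then 1 else 0)"
    proof (rule left_right_inverse_finite[where J = "{M. type_size M = n}"])
      show "card (partitions n) = card {M. type_size M = n}"
        by (rule bij_betw_same_card[OF bij_betw_partitions_types])
      show "(\<Sum>j | type_size j = n. Poly_Mapping.lookup (schur i) j * class_value j (schur k)) = (if i = k then 1 else 0)"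
        if "i \<in> partitions n" "k \<in> partitions n" for i k
        using hall_schur[OF that] by (simp add: hall_def class_value_def mult_ac)
    qed (use finite_partitions finite_type_size True M in auto)
    then show ?thesis unfolding L by (simp add: power_sums_def Poly_Mapping.lookup_single when_def)
  next
    case False
    then have "(\<Sum>\<nu>\<in>partitions n. class_value M (schur \<nu>) * Poly_Mapping.lookup (schur \<nu>) N) = 0"
      by (intro sum.neutral) (auto simp: lookup_schur_eq_0 partitions_def)
    then show ?thesis unfolding L using False M by (auto simp: power_sums_def Poly_Mapping.lookup_single when_def)
  qed
qed

section \<open>Cycle types of permutations\<close>

definition cycle_type :: "('a \<Rightarrow> 'a) \<Rightarrow> 'a set \<Rightarrow> nat multiset" where
  "cycle_type p A = image_mset (\<lambda>C. card C - 1) (mset_set (orbit p ` A))"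

lemma orbit_self: "p permutes A \<Longrightarrow> finite A \<Longrightarrow> x \<in> orbit p x"
  by (simp add: permutes_imp_permutation permutation_self_in_orbit)

lemma orbit_eq: "p permutes A \<Longrightarrow> finite A \<Longrightarrow> y \<in> orbit p x \<Longrightarrow> orbit p y = orbit p x"
  by (rule orbit_cyclic_eq3[OF cyclic_on_orbit])

lemma card_orbit_pos: "p permutes A \<Longrightarrow> finite A \<Longrightarrow> card (orbit p x) > 0"
  by (metis card_gt_0_iff empty_iff finite_orbit orbit_self)

lemma sum_orbits:
  fixes g :: "'a set \<Rightarrow> 'b::comm_semiring_1"
  assumes p: "p permutes A" and A: "finite A"
  shows "(\<Sum>b\<in>A. g (orbit p b)) = (\<Sum>C\<in>orbit p ` A. of_nat (card C) * g C)"
proof -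
  have "(\<Sum>b\<in>A. g (orbit p b)) = (\<Sum>C\<in>orbit p ` A. \<Sum>b\<in>{b \<in> A. orbit p b = C}. g (orbit p b))"
    by (rule sum.image_gen[OF A])
  also have "\<dots> = (\<Sum>C\<in>orbit p ` A. of_nat (card C) * g C)"
  proof (rule sum.cong[OF refl])
    fix C assume "C \<in> orbit p ` A"
    then obtain x where x: "x \<in> A" "C = orbit p x" by auto
    then have "{b \<in> A. orbit p b = C} = C"
      using permutes_orbit_subset[OF p] orbit_self[OF p A] orbit_eq[OF p A] by blast
    moreover have "(\<Sum>b\<in>{b \<in> A. orbit p b = C}. g (orbit p b)) = of_nat (card {b \<in> A. orbit p b = C}) * g C"
      by simp
    ultimately show "(\<Sum>b\<in>{b \<in> A. orbit p b = C}. g (orbit p b)) = of_nat (card C) * g C" by simp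
  qed
  finally show ?thesis .
qed

lemma sum_orbits_cycle_type:
  fixes g :: "nat \<Rightarrow> 'b::comm_semiring_1"
  assumes p: "p permutes A" and A: "finite A"
  shows "(\<Sum>b\<in>A. g (card (orbit p b) - 1)) = (\<Sum>i\<in>#cycle_type p A. of_nat (Suc i) * g i)"
proof -
  have "(\<Sum>b\<in>A. g (card (orbit p b) - 1)) = (\<Sum>C\<in>orbit p ` A. of_nat (card C) * g (card C - 1))"
    by (rule sum_orbits[OF assms])
  also have "\<dots> = (\<Sum>C\<in>orbit p ` A. of_nat (Suc (card C - 1)) * g (card C - 1))"
    using card_orbit_pos[OF assms] by (intro sum.cong refl) (auto simp del: of_nat_Suc)
  finally show ?thesis by (simp add: cycle_type_def sum_unfold_sum_mset multiset.map_comp comp_def)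
qed

lemma type_size_cycle_type: "p permutes A \<Longrightarrow> finite A \<Longrightarrow> type_size (cycle_type p A) = card A"
  using sum_orbits_cycle_type[of p A "\<lambda>_. 1 :: nat"] by (simp add: type_size_def)

text \<open>Composing with the transposition inserts the fixed point \<open>a\<close> into the cycle
  of \<open>b\<close>, immediately before \<open>b\<close>; all other cycles are untouched.\<close>

lemma orbit_insert:
  assumes p: "p permutes A" and A: "finite A" "a \<notin> A" and b: "b \<in> A"
  defines "q \<equiv> transpose a b \<circ> p"
  shows "x \<in> insert a (orbit p b) \<Longrightarrow> orbit q x = insert a (orbit p b)"
    and "x \<in> A - orbit p b \<Longrightarrow> orbit q x = orbit p x"
proof -
  have q: "q permutes insert a A"
    unfolding q_def using p b
    by (intro permutes_compose[of p] permutes_swap_id) (auto intro: permutes_subset)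
  have finq: "finite (insert a A)" using A by simp
  have pa: "p a = a" using p A by (simp add: permutes_not_in)
  have qa: "q a = b" by (simp add: q_def pa)
  have q_b: "q y = a" if "p y = b" for y using that by (simp add: q_def)
  have qe: "q y = p y" if "p y \<noteq> b" "y \<in> A" for y
  proof -
    have "p y \<noteq> a" using that A p permutes_in_image[OF p, of y] by auto
    then show ?thesis using that by (simp add: q_def)
  qed
  note OA = permutes_orbit_subset[OF p b]
  have sub1: "y \<in> orbit q b" if "y \<in> orbit p b" for y
    using that
  proof induction
    case base
    show ?case
    proof (cases "p b = b")
      case True
      then show ?thesis using orbit_self[OF q finq] by simp
    next
      case False
      then show ?thesis using qe[of b] b by (metis orbit.base)
    qed
  next
    case (step y)
    have "y \<in> A" using step(1) OA by auto
    show ?case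
    proof (cases "p y = b")
      case True
      then show ?thesis using orbit_self[OF q finq] by simp
    next
      case False
      then show ?thesis using qe[OF False \<open>y \<in> A\<close>] step by (metis orbit.step)
    qed
  qed
  have "b \<in> orbit p b" by (rule orbit_self[OF p A(1)])
  then obtain y where y: "y \<in> orbit p b" "p y = b"
    by (metis A(1) orbit.cases orbit_self p)
  have "a \<in> orbit q b" using sub1[OF y(1)] q_b[OF y(2)] by (metis orbit.step)
  then have 1: "insert a (orbit p b) \<subseteq> orbit q b" using sub1 by auto
  have "y \<in> insert a (orbit p b)" if "y \<in> orbit q b" for y
    using that
  proof induction
    case base
    then show ?case using qe[of b] b q_b[of b] orbit.base[of p b] by (cases "p b = b") auto
  next
    case (step y)
    show ?case
    proof (cases "y = a")
      case True
      then show ?thesis using qa \<open>b \<in> orbit p b\<close> by simp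
    next
      case False
      then have "y \<in> orbit p b" "y \<in> A" using step OA by auto
      then show ?thesis using qe[of y] q_b[of y] orbit.step[of y p b] by (cases "p y = b") auto
    qed
  qed
  with 1 have O: "orbit q b = insert a (orbit p b)" by auto
  show "x \<in> insert a (orbit p b) \<Longrightarrow> orbit q x = insert a (orbit p b)"
    using orbit_eq[OF q finq, of x b] O by simp
  show "orbit q x = orbit p x" if x: "x \<in> A - orbit p b"
  proof (rule orbit_cong)
    show "x \<in> orbit p x" by (rule orbit_self[OF p A(1)])
    fix s assume s: "s \<in> orbit p x"
    have "p s \<noteq> b"
    proof
      assume "p s = b"
      then have "b \<in> orbit p x" using s by (metis orbit.step)
      then have "orbit p b = orbit p x" by (rule orbit_eq[OF p A(1)])
      then show False using x orbit_self[OF p A(1), of x] by auto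
    qed
    moreover have "s \<in> A" using s x permutes_orbit_subset[OF p, of x] by auto
    ultimately show "q s = p s" by (rule qe)
  qed
qed

lemma cycle_type_insert:
  assumes p: "p permutes A" and A: "finite A" "a \<notin> A" and b: "b \<in> A"
  shows "cycle_type (transpose a b \<circ> p) (insert a A) =
    add_mset (Suc (card (orbit p b) - 1)) (cycle_type p A - {#card (orbit p b) - 1#})"
proof -
  let ?q = "transpose a b \<circ> p" and ?O = "orbit p b"
  have disj: "?O \<noteq> orbit p x" if "x \<in> A - ?O" for x
    using that orbit_self[OF p A(1), of x] by auto
  have "orbit ?q ` insert a A = orbit ?q ` insert a ?O \<union> orbit ?q ` (A - ?O)"
    using permutes_orbit_subset[OF p b] by auto
  also have "orbit ?q ` insert a ?O = {insert a ?O}"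
    using orbit_insert(1)[OF assms] by auto
  also have "orbit ?q ` (A - ?O) = orbit p ` (A - ?O)"
    using orbit_insert(2)[OF assms] by auto
  also have "orbit p ` (A - ?O) = orbit p ` A - {?O}"
    using disj orbit_eq[OF p A(1)] by blast
  finally have orb: "orbit ?q ` insert a A = insert (insert a ?O) (orbit p ` A - {?O})"
    unfolding insert_is_Un[of "insert a ?O", symmetric] .
  have aO: "a \<notin> C" if "C \<in> orbit p ` A" for C
    using that permutes_orbit_subset[OF p] A(2) by auto
  have fin: "finite (orbit p ` A)" using A by simp
  have "insert a ?O \<notin> orbit p ` A - {?O}" using aO by auto
  then have "cycle_type ?q (insert a A) = add_mset (card (insert a ?O) - 1) (image_mset (\<lambda>C. card C - 1) (mset_set (orbit p ` A - {?O})))"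
    unfolding cycle_type_def orb using fin by simp
  also have "mset_set (orbit p ` A - {?O}) = mset_set (orbit p ` A) - {#?O#}"
    using fin b by (subst mset_set_Diff) auto
  also have "image_mset (\<lambda>C. card C - 1) \<dots> = cycle_type p A - {#card ?O - 1#}"
    using fin b by (subst image_mset_Diff) (auto simp: cycle_type_def)
  also have "card (insert a ?O) - 1 = Suc (card ?O - 1)"
    using aO b card_orbit_pos[OF p A(1), of b] by (subst card_insert_disjoint) (auto simp: card_gt_0_iff)
  finally show ?thesis .
qed

lemma cycle_type_insert_fixed:
  assumes p: "p permutes A" and A: "finite A" "a \<notin> A"
  shows "cycle_type p (insert a A) = add_mset 0 (cycle_type p A)"
proof -
  have pa: "orbit p a = {a}" using p A by (simp add: permutes_not_in orbit_eq_singleton_iff)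
  have "{a} \<notin> orbit p ` A" using permutes_orbit_subset[OF p] A(2) by fastforce
  then show ?thesis using A by (simp add: cycle_type_def pa)
qed

text \<open>
  The permutations of \<open>insert a A\<close> arise from those of \<open>A\<close> by making \<open>a\<close> a fixed point or by inserting it
  into a cycle; \<open>sum_div_cent_order\<close> shows that \<open>n! / z\<^sub>M\<close> satisfies the same recursion.
\<close>

lemma sum_cycle_type:
  fixes f :: "nat multiset \<Rightarrow> complex"
  assumes "finite A"
  shows "(\<Sum>p | p permutes A. f (cycle_type p A)) = fact (card A) * (\<Sum>M | type_size M = card A. f M / of_nat (cent_order M))"
  using assms
proof (induction A arbitrary: f rule: finite_induct)
  case empty
  have "{M. type_size M = 0} = {{#}}"
  proof -
    have "type_size M = 0 \<longleftrightarrow> M = {#}" for M by (cases M) auto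
    then show ?thesis by auto
  qed
  then show ?case by (simp add: cycle_type_def)
next
  case (insert a A)
  define n where "n = card A"
  \<comment> \<open>\<open>F M\<close> adds \<open>f\<close> over all insertions into a permutation
    of type M: the new point is fixed, or it enters a cycle of length i + 1 at one of its i + 1
    places.\<close>
  define F where "F M = f (add_mset 0 M) + (\<Sum>i\<in>#M. of_nat (Suc i) * f (add_mset (Suc i) (M - {#i#})))" for M
  have "(\<Sum>p | p permutes insert a A. f (cycle_type p (insert a A))) =
      (\<Sum>b\<in>insert a A. \<Sum>p | p permutes A. f (cycle_type (transpose a b \<circ> p) (insert a A)))"
    by (rule sum_over_permutations_insert) fact+
  also have "\<dots> = (\<Sum>p | p permutes A. \<Sum>b\<in>insert a A. f (cycle_type (transpose a b \<circ> p) (insert a A)))"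
    by (rule sum.swap)
  also have "\<dots> = (\<Sum>p | p permutes A. F (cycle_type p A))"
  proof (rule sum.cong[OF refl], clarify)
    fix p assume p: "p permutes A"
    have "(\<Sum>b\<in>insert a A. f (cycle_type (transpose a b \<circ> p) (insert a A))) =
        f (add_mset 0 (cycle_type p A)) +
        (\<Sum>b\<in>A. f (add_mset (Suc (card (orbit p b) - 1)) (cycle_type p A - {#card (orbit p b) - 1#})))"
      using insert.hyps by (simp add: cycle_type_insert_fixed[OF p] cycle_type_insert[OF p])
    then show "(\<Sum>b\<in>insert a A. f (cycle_type (transpose a b \<circ> p) (insert a A))) = F (cycle_type p A)"
      unfolding F_def sum_orbits_cycle_type[OF p insert.hyps(1), of "\<lambda>i. f (add_mset (Suc i) (cycle_type p A - {#i#}))"] .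
  qed
  also have "\<dots> = fact n * (\<Sum>M | type_size M = n. F M / of_nat (cent_order M))"
    unfolding n_def by (rule insert.IH)
  also have "(\<Sum>M | type_size M = n. F M / of_nat (cent_order M)) =
      of_nat (Suc n) * (\<Sum>M | type_size M = Suc n. f M / of_nat (cent_order M))"
  proof -
    have mset_sum: "(\<Sum>i\<in>#M. g i) = (\<Sum>i\<in>set_mset M. of_nat (count M i) * g i)" for g :: "nat \<Rightarrow> complex" and M
    proof (induction M)
      case (add j M)
      have "(\<Sum>i\<in>set_mset (add_mset j M). of_nat (count (add_mset j M) i) * g i) =
          (\<Sum>i\<in>insert j (set_mset M). of_nat (count M i) * g i + (if i = j then g i else 0))"
        by (intro sum.cong) (auto simp: algebra_simps)
      also have "\<dots> = (\<Sum>i\<in>insert j (set_mset M). of_nat (count M i) * g i) + g j"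
        by (simp add: sum.distrib del: sum.insert_if)
      also have "(\<Sum>i\<in>insert j (set_mset M). of_nat (count M i) * g i) = (\<Sum>i\<in>set_mset M. of_nat (count M i) * g i)"
        by (intro sum.mono_neutral_right) (auto simp: not_in_iff)
      finally show ?case using add by (simp add: add.commute)
    qed simp
    have "of_nat (Suc n) * (\<Sum>M | type_size M = Suc n. f M / of_nat (cent_order M)) =
        (\<Sum>M | type_size M = Suc n. \<Sum>i\<in>set_mset M. of_nat (Suc i * count M i) * f (add_mset i (M - {#i#})) / of_nat (cent_order M))"
      unfolding sum_distrib_left
    proof (rule sum.cong[OF refl], clarify)
      fix M :: "nat multiset" assume M: "type_size M = Suc n"
      have "(\<Sum>i\<in>set_mset M. of_nat (Suc i * count M i) * f (add_mset i (M - {#i#})) / of_nat (cent_order M)) =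
          (\<Sum>i\<in>set_mset M. of_nat (Suc i * count M i)) * (f M / of_nat (cent_order M))"
        unfolding sum_distrib_right by (intro sum.cong) auto
      then show "of_nat (Suc n) * (f M / of_nat (cent_order M)) =
          (\<Sum>i\<in>set_mset M. of_nat (Suc i * count M i) * f (add_mset i (M - {#i#})) / of_nat (cent_order M))"
        by (simp only: sum_count_weighted M)
    qed
    also have "\<dots> = (\<Sum>i<Suc n. \<Sum>K | type_size K = Suc n - Suc i. f (add_mset i K) / of_nat (cent_order K))"
      by (rule sum_div_cent_order)
    also have "\<dots> = (\<Sum>K | type_size K = n. f (add_mset 0 K) / of_nat (cent_order K)) +
        (\<Sum>i<n. \<Sum>K | type_size K = n - Suc i. f (add_mset (Suc i) K) / of_nat (cent_order K))"
      unfolding sum.lessThan_Suc_shift by simp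
    also have "(\<Sum>i<n. \<Sum>K | type_size K = n - Suc i. f (add_mset (Suc i) K) / of_nat (cent_order K)) =
        (\<Sum>M | type_size M = n. \<Sum>i\<in>set_mset M. of_nat (Suc i * count M i) * f (add_mset (Suc i) (M - {#i#})) / of_nat (cent_order M))"
      by (rule sum_div_cent_order[symmetric])
    also have "(\<Sum>K | type_size K = n. f (add_mset 0 K) / of_nat (cent_order K)) + \<dots> = (\<Sum>M | type_size M = n. F M / of_nat (cent_order M))"
      unfolding F_def mset_sum add_divide_distrib sum.distrib sum_divide_distrib
      by (simp only: of_nat_mult mult_ac)
    finally show ?thesis by simp
  qed
  finally show ?case using insert.hyps by (simp add: n_def mult_ac)
qed

section \<open>Conjugacy of permutations with equal cycle type\<close>

lemma funpow_eq_iff_mod: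
  assumes p: "p permutes A" and A: "finite A"
  shows "(p ^^ i) a = (p ^^ j) a \<longleftrightarrow> i mod card (orbit p a) = j mod card (orbit p a)"
proof -
  have a: "a \<in> orbit p a" by (rule orbit_self[OF assms])
  let ?k = "funpow_dist1 p a a"
  have k: "(p ^^ ?k) a = a" "?k > 0" using funpow_dist1_prop[OF a] by auto
  have inj: "inj_on (\<lambda>n. (p ^^ n) a) {0..<?k}" by (rule inj_on_funpow_dist1[OF a])
  have "card (orbit p a) = card ((\<lambda>n. (p ^^ n) a) ` {0..<?k})"
    by (subst orbit_conv_funpow_dist1[OF a]) simp
  then have c: "card (orbit p a) = ?k" using card_image[OF inj] by simp
  have "(p ^^ i) a = (p ^^ j) a \<longleftrightarrow> (p ^^ (i mod ?k)) a = (p ^^ (j mod ?k)) a"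
    using funpow_mod_eq[OF k(1)] by simp
  also have "\<dots> \<longleftrightarrow> i mod ?k = j mod ?k"
    using inj k(2) by (auto simp: inj_on_def)
  finally show ?thesis unfolding c .
qed

lemma orbit_funpow: "p permutes A \<Longrightarrow> finite A \<Longrightarrow> orbit p a = range (\<lambda>n. (p ^^ n) a)"
  by (subst orbit_altdef_permutation) (auto simp: permutes_imp_permutation)

lemma cycle_type_Diff_orbit:
  assumes p: "p permutes S" "finite S" and A: "A \<subseteq> S" "a \<in> A"
  shows "orbit p ` (A - orbit p a) = orbit p ` A - {orbit p a}"
    and "cycle_type p (A - orbit p a) = cycle_type p A - {#card (orbit p a) - 1#}"
proof -
  show 1: "orbit p ` (A - orbit p a) = orbit p ` A - {orbit p a}"
    using orbit_eq[OF p] orbit_self[OF p] by blast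
  have "finite A" using A p finite_subset by blast
  then show "cycle_type p (A - orbit p a) = cycle_type p A - {#card (orbit p a) - 1#}"
    unfolding cycle_type_def 1 using A by (subst mset_set_Diff, simp, simp, subst image_mset_Diff) auto
qed

lemma intertwine_orbits:
  assumes p: "p permutes S" and S: "finite S" and q: "q permutes T" and T: "finite T"
    and c: "card (orbit p a) = card (orbit q b)"
  shows "\<exists>g. bij_betw g (orbit p a) (orbit q b) \<and> (\<forall>x\<in>orbit p a. g (p x) = q (g x))"
proof -
  \<comment> \<open>The map sends p^i a to q^i b. Any exponent may be chosen, because both orbits
    have the same period.\<close>
  define g where "g x = (q ^^ (SOME i. (p ^^ i) a = x)) b" for x
  have g: "g ((p ^^ i) a) = (q ^^ i) b" for i
  proof -
    have "(p ^^ (SOME j. (p ^^ j) a = (p ^^ i) a)) a = (p ^^ i) a"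
      by (rule someI_ex) auto
    then show ?thesis
      unfolding g_def using funpow_eq_iff_mod[OF p S] funpow_eq_iff_mod[OF q T] c by metis
  qed
  have "bij_betw g (orbit p a) (orbit q b)"
    unfolding bij_betw_def inj_on_def orbit_funpow[OF p S] orbit_funpow[OF q T]
    using funpow_eq_iff_mod[OF p S] funpow_eq_iff_mod[OF q T] c by (auto simp: g image_image)
  moreover have "g (p x) = q (g x)" if "x \<in> orbit p a" for x
  proof -
    obtain i where "x = (p ^^ i) a" using \<open>x \<in> orbit p a\<close> unfolding orbit_funpow[OF p S] by auto
    then show ?thesis using g[of "Suc i"] g[of i] by simp
  qed
  ultimately show ?thesis by blast
qed

text \<open>Stated for invariant subsets, so that matching orbits can be removed one at a time while
  \<open>p\<close> and \<open>q\<close> remain permutations of the fixed sets \<open>S\<close> and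
  \<open>T\<close>.\<close>

lemma intertwine_cycle_type:
  assumes p: "p permutes S" and S: "finite S" and q: "q permutes T" and T: "finite T"
    and A: "A \<subseteq> S" "\<And>x. x \<in> A \<Longrightarrow> orbit p x \<subseteq> A"
    and B: "B \<subseteq> T" "\<And>x. x \<in> B \<Longrightarrow> orbit q x \<subseteq> B"
    and c: "cycle_type p A = cycle_type q B"
  shows "\<exists>g. bij_betw g A B \<and> (\<forall>x\<in>A. g (p x) = q (g x))"
  using A B c
proof (induction "card A" arbitrary: A B rule: less_induct)
  case less
  have fin: "finite A" "finite B" using less.prems S T finite_subset by blast+
  show ?case
  proof (cases "A = {}")
    case True
    then have "cycle_type q B = {#}" using less.prems(5) by (simp add: cycle_type_def)
    then have "B = {}" using fin by (auto simp: cycle_type_def mset_set_empty_iff)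
    then show ?thesis using True by (auto simp: bij_betw_def)
  next
    case False
    then obtain a where a: "a \<in> A" by auto
    have "card (orbit p a) - 1 \<in># cycle_type q B"
      using a fin less.prems(5)[symmetric] by (auto simp: cycle_type_def)
    then obtain b where b: "b \<in> B" "card (orbit p a) - 1 = card (orbit q b) - 1"
      using fin by (auto simp: cycle_type_def)
    then have cc: "card (orbit p a) = card (orbit q b)"
      using card_orbit_pos[OF p S, of a] card_orbit_pos[OF q T, of b] by linarith
    let ?A = "A - orbit p a" and ?B = "B - orbit q b"
    have OA: "orbit p a \<subseteq> A" and OB: "orbit q b \<subseteq> B" using less.prems a b by auto
    have dA: "orbit p x \<inter> orbit p a = {}" if "x \<notin> orbit p a" for x
      using that orbit_eq[OF p S] orbit_self[OF p S] by blast
    have dB: "orbit q x \<inter> orbit q b = {}" if "x \<notin> orbit q b" for x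
      using that orbit_eq[OF q T] orbit_self[OF q T] by blast
    have "\<exists>g. bij_betw g ?A ?B \<and> (\<forall>x\<in>?A. g (p x) = q (g x))"
    proof (rule less.hyps)
      show "card ?A < card A"
        using a fin orbit_self[OF p S, of a] by (intro psubset_card_mono) auto
      show "cycle_type p ?A = cycle_type q ?B"
        using cycle_type_Diff_orbit(2)[OF p S less.prems(1) a] cycle_type_Diff_orbit(2)[OF q T less.prems(3) b(1)] cc less.prems(5)
        by simp
    qed (use less.prems dA dB in blast)+
    then obtain g where g: "bij_betw g ?A ?B" "\<And>x. x \<in> ?A \<Longrightarrow> g (p x) = q (g x)" by blast
    obtain h where h: "bij_betw h (orbit p a) (orbit q b)" "\<And>x. x \<in> orbit p a \<Longrightarrow> h (p x) = q (h x)"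
      using intertwine_orbits[OF p S q T cc] by blast
    define k where "k x = (if x \<in> orbit p a then h x else g x)" for x
    have "bij_betw k (orbit p a \<union> ?A) (orbit q b \<union> ?B)"
      using h(1) g(1) unfolding k_def by (intro bij_betw_disjoint_Un) auto
    then have "bij_betw k A B"
      using OA OB by (simp add: Un_absorb1)
    moreover have "k (p x) = q (k x)" if x: "x \<in> A" for x
    proof (cases "x \<in> orbit p a")
      case True
      then show ?thesis using h(2) by (simp add: k_def orbit.step)
    next
      case False
      then have "p x \<notin> orbit p a"
        using dA[OF False] orbit.base[of p x] by auto
      then show ?thesis using False g(2) x by (simp add: k_def)
    qed
    ultimately show ?thesis by blast
  qed
qed

lemma cycle_type_eq_imp_conjugate:
  assumes p: "p permutes A" and q: "q permutes A" and A: "finite A" and c: "cycle_type p A = cycle_type q A"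
  obtains g where "g permutes A" "q = g \<circ> p \<circ> inv g"
proof -
  obtain h where h: "bij_betw h A A" "\<And>x. x \<in> A \<Longrightarrow> h (p x) = q (h x)"
    using intertwine_cycle_type[OF p A q A order.refl _ order.refl _ c] permutes_orbit_subset[OF p] permutes_orbit_subset[OF q]
    by blast
  define g where "g x = (if x \<in> A then h x else x)" for x
  have "bij_betw g A A" using h(1) by (subst bij_betw_cong[of A g h]) (auto simp: g_def)
  then have g: "g permutes A" by (rule bij_imp_permutes) (auto simp: g_def)
  have comm: "g (p x) = q (g x)" for x
  proof (cases "x \<in> A")
    case True
    then show ?thesis using h permutes_in_image[OF p] by (simp add: g_def)
  next
    case False
    then show ?thesis using p q by (simp add: g_def permutes_not_in)
  qed
  have "q = g \<circ> p \<circ> inv g"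
    using comm permutes_inverses[OF g] by (auto simp: fun_eq_iff)
  then show ?thesis using that g by blast
qed

lemma cycle_type_inv: "p permutes A \<Longrightarrow> finite A \<Longrightarrow> cycle_type (inv p) A = cycle_type p A"
  by (simp add: cycle_type_def orbit_inv_eq permutes_imp_permutation)

lemma num_cycles_conv_cycle_type:
  assumes "\<sigma> permutes {..<n}" "j > 0"
  shows "num_cycles j n \<sigma> = count (cycle_type \<sigma> {..<n}) (j - 1)"
proof -
  have "count (cycle_type \<sigma> {..<n}) (j - 1) = card {C \<in> orbit \<sigma> ` {..<n}. card C - 1 = j - 1}"
    unfolding cycle_type_def by (intro count_image_mset_eq_card_vimage) auto
  also have "{C \<in> orbit \<sigma> ` {..<n}. card C - 1 = j - 1} = {C \<in> orbit \<sigma> ` {..<n}. card C = j}"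
  proof -
    have "card (orbit \<sigma> x) - 1 = j - 1 \<longleftrightarrow> card (orbit \<sigma> x) = j" for x
      using card_orbit_pos[OF assms(1), of x] assms(2) by auto
    then show ?thesis by auto
  qed
  finally show ?thesis by (simp add: num_cycles_def)
qed

text \<open>Existence by counting: the number of such permutations is n! / z_M, which is not
  0.\<close>

lemma exists_cycle_type:
  assumes "finite A" "type_size M = card A"
  shows "\<exists>p. p permutes A \<and> cycle_type p A = M"
proof (rule ccontr)
  assume "\<not> ?thesis"
  then have "(\<Sum>p | p permutes A. if cycle_type p A = M then 1 else 0 :: complex) = 0"
    by (intro sum.neutral) auto
  moreover have "(\<Sum>N | type_size N = card A. (if N = M then 1 else 0) / of_nat (cent_order N) :: complex) = 1 / of_nat (cent_order M)"
  proof -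
    have "(\<Sum>N | type_size N = card A. (if N = M then 1 else 0) / of_nat (cent_order N) :: complex) =
        (\<Sum>N | type_size N = card A. if N = M then 1 / of_nat (cent_order N) else 0)"
      by (intro sum.cong) auto
    then show ?thesis using assms(2) by (simp add: finite_type_size)
  qed
  ultimately show False
    using sum_cycle_type[OF assms(1), of "\<lambda>N. if N = M then 1 else 0"] by simp
qed

section \<open>Cycle indices of symmetric groups and Young subgroups\<close>

lemma sum_power_sums_cycle_type:
  assumes "finite A"
  shows "(\<Sum>p | p permutes A. power_sums (cycle_type p A)) = const (fact (card A)) * complete (card A)"
proof (rule poly_mapping_eqI)
  fix M
  have "Poly_Mapping.lookup (\<Sum>p | p permutes A. power_sums (cycle_type p A)) M = (\<Sum>p | p permutes A. if cycle_type p A = M then 1 else 0)"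
    by (simp add: Poly_Mapping.lookup_sum power_sums_def Poly_Mapping.lookup_single when_def)
  also have "\<dots> = fact (card A) * (\<Sum>N | type_size N = card A. (if N = M then 1 else 0) / of_nat (cent_order N))"
    by (rule sum_cycle_type[OF assms])
  also have "(\<Sum>N | type_size N = card A. (if N = M then 1 else 0) / of_nat (cent_order N)) =
      (\<Sum>N | type_size N = card A. if N = M then 1 / of_nat (cent_order N) else (0 :: complex))"
    by (intro sum.cong) auto
  also have "\<dots> = Poly_Mapping.lookup (complete (card A)) M"
    by (simp add: finite_type_size lookup_complete)
  finally show "Poly_Mapping.lookup (\<Sum>p | p permutes A. power_sums (cycle_type p A)) M =
      Poly_Mapping.lookup (const (fact (card A)) * complete (card A)) M"
    by (simp add: lookup_const_mult)
qed

lemma perm_restrict_permutes: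
  assumes r: "r permutes S" and A: "finite A" "\<And>x. x \<in> A \<Longrightarrow> r x \<in> A"
  shows "perm_restrict r A permutes A"
proof (rule bij_imp_permutes)
  have inj: "inj_on r A" using permutes_inj[OF r] by (rule inj_on_subset) auto
  then have "r ` A = A" using A by (intro endo_inj_surj) auto
  then have "bij_betw r A A" using inj by (simp add: bij_betw_def)
  then show "bij_betw (perm_restrict r A) A A"
    by (subst bij_betw_cong[of A _ r]) (auto simp: perm_restrict_def)
qed (simp add: perm_restrict_def)

text \<open>\<open>f\<close> will be the row index, \<open>B\<close> the last row and
  \<open>A\<close> the union of the earlier rows. The Young subgroup is then the direct product of a
  smaller one with the full symmetric group of \<open>B\<close>.\<close>

lemma young_bij:
  assumes fin: "finite A" "finite B" and disj: "A \<inter> B = {}" and f: "\<And>x y. x \<in> A \<Longrightarrow> y \<in> B \<Longrightarrow> f x \<noteq> f y"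
    and fB: "\<And>x y. x \<in> B \<Longrightarrow> y \<in> B \<Longrightarrow> f x = f y"
  shows "bij_betw (\<lambda>(p, q). p \<circ> q)
    ({p. p permutes A \<and> (\<forall>x\<in>A. f (p x) = f x)} \<times> {q. q permutes B})
    {r. r permutes (A \<union> B) \<and> (\<forall>x\<in>A \<union> B. f (r x) = f x)}"
proof (rule bij_betwI[where g = "\<lambda>r. (perm_restrict r A, perm_restrict r B)"])
  have fp: "p x = x" if "p permutes A" "x \<in> B" for p x
    using that disj by (auto intro: permutes_not_in)
  have fq: "q x = x" if "q permutes B" "x \<in> A" for q x
    using that disj by (auto intro: permutes_not_in)
  have pq: "(p \<circ> q) x = (if x \<in> A then p x else q x)" if "p permutes A" "q permutes B" for p q x
    using that fp[OF that(1), of "q x"] fq[OF that(2)] permutes_in_image[OF that(2), of x]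
      permutes_not_in[OF that(1)] permutes_not_in[OF that(2), of x] by auto
  show "(\<lambda>(p, q). p \<circ> q) \<in> {p. p permutes A \<and> (\<forall>x\<in>A. f (p x) = f x)} \<times> {q. q permutes B} \<rightarrow>
      {r. r permutes (A \<union> B) \<and> (\<forall>x\<in>A \<union> B. f (r x) = f x)}"
  proof (safe, goal_cases)
    case (1 p q)
    then show ?case by (intro permutes_compose) (auto intro: permutes_subset)
  next
    case (2 p q x)
    then show ?case using pq[of p q x] by auto
  next
    case (3 p q x)
    then have "x \<notin> A" using disj by auto
    then show ?case using pq[of p q x] 3 fB[of "q x" x] permutes_in_image[of q B x] by auto
  qed
  have rA: "r x \<in> A" if "r permutes (A \<union> B)" "\<forall>x\<in>A \<union> B. f (r x) = f x" "x \<in> A" for r x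
    using that permutes_in_image[OF that(1), of x] f[of x "r x"] by auto
  have rB: "r x \<in> B" if "r permutes (A \<union> B)" "\<forall>x\<in>A \<union> B. f (r x) = f x" "x \<in> B" for r x
    using that permutes_in_image[OF that(1), of x] f[of "r x" x] by auto
  have R: "perm_restrict r A permutes A" "perm_restrict r B permutes B"
    if "r permutes (A \<union> B)" "\<forall>x\<in>A \<union> B. f (r x) = f x" for r
    using that rA rB fin by (auto intro!: perm_restrict_permutes)
  show "(\<lambda>r. (perm_restrict r A, perm_restrict r B)) \<in> {r. r permutes (A \<union> B) \<and> (\<forall>x\<in>A \<union> B. f (r x) = f x)} \<rightarrow>
      {p. p permutes A \<and> (\<forall>x\<in>A. f (p x) = f x)} \<times> {q. q permutes B}"
    using R by (auto simp: perm_restrict_simps)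
  show "(\<lambda>r. (perm_restrict r A, perm_restrict r B)) ((\<lambda>(p, q). p \<circ> q) x) = x"
    if "x \<in> {p. p permutes A \<and> (\<forall>x\<in>A. f (p x) = f x)} \<times> {q. q permutes B}" for x
  proof -
    obtain p q where x: "x = (p, q)" "p permutes A" "q permutes B" using \<open>x \<in> _\<close> by auto
    have "perm_restrict (p \<circ> q) A = p" "perm_restrict (p \<circ> q) B = q"
      using pq[OF x(2,3)] x(2,3) disj
      by (auto simp: fun_eq_iff perm_restrict_def permutes_not_in simp del: comp_apply)
    then show ?thesis using x(1) by simp
  qed
  show "(\<lambda>(p, q). p \<circ> q) ((\<lambda>r. (perm_restrict r A, perm_restrict r B)) r) = r"
    if "r \<in> {r. r permutes (A \<union> B) \<and> (\<forall>x\<in>A \<union> B. f (r x) = f x)}" for r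
    using that R[of r] disj by (simp add: perm_restrict_union)
qed

lemma cycle_type_comp_disjoint:
  assumes p: "p permutes A" "finite A" and q: "q permutes B" "finite B" and disj: "A \<inter> B = {}"
  shows "cycle_type (p \<circ> q) (A \<union> B) = cycle_type p A + cycle_type q B"
proof -
  have 1: "orbit (p \<circ> q) x = orbit p x" if "x \<in> A" for x
  proof (rule orbit_cong[OF orbit_self[OF p]])
    fix s assume "s \<in> orbit p x"
    then have "s \<in> A" using permutes_orbit_subset[OF p(1) that] by auto
    then have "q s = s" using disj q by (auto intro: permutes_not_in)
    then show "(p \<circ> q) s = p s" by simp
  qed
  have 2: "orbit (p \<circ> q) x = orbit q x" if "x \<in> B" for x
  proof (rule orbit_cong[OF orbit_self[OF q]])
    fix s assume "s \<in> orbit q x"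
    then have "q s \<in> B" using permutes_orbit_subset[OF q(1) that] permutes_in_image[OF q(1), of s] by auto
    then show "(p \<circ> q) s = q s" using disj p by (auto intro: permutes_not_in)
  qed
  have "orbit (p \<circ> q) ` (A \<union> B) = orbit p ` A \<union> orbit q ` B"
    unfolding image_Un using 1 2 by auto
  moreover have "orbit p ` A \<inter> orbit q ` B = {}"
  proof (rule equals0I)
    fix C assume "C \<in> orbit p ` A \<inter> orbit q ` B"
    then obtain x y where xy: "C = orbit p x" "x \<in> A" "C = orbit q y" "y \<in> B" by auto
    have "C \<subseteq> A" "C \<subseteq> B"
      using permutes_orbit_subset[OF p(1) xy(2)] permutes_orbit_subset[OF q(1) xy(4)] xy by auto
    then show False using disj orbit_nonempty[of p x] xy(1) by auto
  qed
  ultimately show ?thesis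
    using p q by (simp add: cycle_type_def mset_set_Union)
qed

text \<open>Cycle indices multiply along the direct product of \<open>young_bij\<close>, so each row
  contributes its own cycle index as a factor.\<close>

lemma sum_power_sums_young:
  fixes f :: "'a \<Rightarrow> nat"
  assumes "finite A" "f ` A \<subseteq> {..<l}"
  shows "(\<Sum>p | p permutes A \<and> (\<forall>x\<in>A. f (p x) = f x). power_sums (cycle_type p A)) =
    (\<Prod>i<l. const (fact (card {x\<in>A. f x = i})) * complete (card {x\<in>A. f x = i}))"
  using assms
proof (induction l arbitrary: A)
  case 0
  then have "{p. p permutes A \<and> (\<forall>x\<in>A. f (p x) = f x)} = {id}" by auto
  then show ?case using 0 by (simp add: cycle_type_def)
next
  case (Suc l)
  let ?A = "{x \<in> A. f x < l}" and ?B = "{x \<in> A. f x = l}"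
  have AB: "A = ?A \<union> ?B" using Suc.prems(2) by (auto simp: less_Suc_eq)
  have "(\<Sum>p | p permutes A \<and> (\<forall>x\<in>A. f (p x) = f x). power_sums (cycle_type p A)) =
      (\<Sum>r | r permutes (?A \<union> ?B) \<and> (\<forall>x\<in>?A \<union> ?B. f (r x) = f x). power_sums (cycle_type r (?A \<union> ?B)))"
    by (subst (1 2 3) AB) (rule refl)
  also have "\<dots> = (\<Sum>(p, q)\<in>{p. p permutes ?A \<and> (\<forall>x\<in>?A. f (p x) = f x)} \<times> {q. q permutes ?B}. power_sums (cycle_type (p \<circ> q) (?A \<union> ?B)))"
    using Suc.prems(1) by (subst sum.reindex_bij_betw[OF young_bij, symmetric]) (auto simp: case_prod_unfold)
  also have "\<dots> = (\<Sum>(p, q)\<in>{p. p permutes ?A \<and> (\<forall>x\<in>?A. f (p x) = f x)} \<times> {q. q permutes ?B}. power_sums (cycle_type p ?A) * power_sums (cycle_type q ?B))"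
    using Suc.prems(1) by (intro sum.cong refl) (clarify, subst cycle_type_comp_disjoint, auto simp: power_sums_add)
  also have "\<dots> = (\<Sum>p | p permutes ?A \<and> (\<forall>x\<in>?A. f (p x) = f x). power_sums (cycle_type p ?A)) * (\<Sum>q | q permutes ?B. power_sums (cycle_type q ?B))"
    by (simp add: sum_product sum.cartesian_product)
  also have "(\<Sum>p | p permutes ?A \<and> (\<forall>x\<in>?A. f (p x) = f x). power_sums (cycle_type p ?A)) =
      (\<Prod>i<l. const (fact (card {x\<in>?A. f x = i})) * complete (card {x\<in>?A. f x = i}))"
    using Suc.prems by (intro Suc.IH) auto
  also have "\<dots> = (\<Prod>i<l. const (fact (card {x\<in>A. f x = i})) * complete (card {x\<in>A. f x = i}))"
  proof (intro prod.cong refl)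
    fix i assume "i \<in> {..<l}"
    then have "{x\<in>?A. f x = i} = {x\<in>A. f x = i}" by auto
    then show "const (fact (card {x\<in>?A. f x = i})) * complete (card {x\<in>?A. f x = i}) =
      const (fact (card {x\<in>A. f x = i})) * complete (card {x\<in>A. f x = i})" by simp
  qed
  also have "(\<Sum>q | q permutes ?B. power_sums (cycle_type q ?B)) = const (fact (card ?B)) * complete (card ?B)"
    using Suc.prems(1) by (intro sum_power_sums_cycle_type) auto
  finally show ?case by simp
qed

section \<open>Characters of Specht modules\<close>

abbreviation "cell_row \<mu> k \<equiv> fst (tableau_cell \<mu> k)"
abbreviation "cell_col \<mu> k \<equiv> snd (tableau_cell \<mu> k)"

lemma bij_betw_tableau_cell:
  "bij_betw (tableau_cell \<mu>) {..<sum_list \<mu>} (SIGMA i:{..<length \<mu>}. {..<\<mu> ! i})"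
proof -
  define xs where "xs = concat (map (\<lambda>i. map (Pair i) [0..<\<mu> ! i]) [0..<length \<mu>])"
  have D: "distinct (concat (map (\<lambda>i. map (Pair i) [0..<\<mu> ! i]) is))" if "distinct is" for "is"
    using that by (induction "is") (auto simp: distinct_map inj_on_def)
  have 1: "distinct xs" unfolding xs_def by (rule D) simp
  have 2: "{..<sum_list \<mu>} = {..<length xs}"
    by (simp add: xs_def length_concat comp_def map_nth)
  have 3: "(SIGMA i:{..<length \<mu>}. {..<\<mu> ! i}) = set xs"
    by (auto simp: xs_def)
  show ?thesis
    using bij_betw_nth[OF 1 2 3] by (simp add: tableau_cell_def xs_def[symmetric] cong: bij_betw_cong)
qed

lemma inj_on_tableau_cell: "inj_on (tableau_cell \<mu>) {..<sum_list \<mu>}"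
  using bij_betw_tableau_cell by (simp add: bij_betw_def)

lemma tableau_cell_eq_iff:
  "x < sum_list \<mu> \<Longrightarrow> y < sum_list \<mu> \<Longrightarrow> cell_row \<mu> x = cell_row \<mu> y \<and> cell_col \<mu> x = cell_col \<mu> y \<longleftrightarrow> x = y"
  using inj_on_tableau_cell[of \<mu>] by (auto simp: inj_on_def prod_eq_iff)

lemma sum_row: "(\<Sum>k<sum_list \<mu>. cell_row \<mu> k) = row_weight \<mu>"
proof -
  have "(\<Sum>k<sum_list \<mu>. cell_row \<mu> k) = (\<Sum>x\<in>(SIGMA i:{..<length \<mu>}. {..<\<mu> ! i}). fst x)"
    by (rule sum.reindex_bij_betw[OF bij_betw_tableau_cell])
  also have "\<dots> = (\<Sum>i<length \<mu>. \<Sum>j<\<mu> ! i. i)"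
    by (subst sum.Sigma) (auto simp: case_prod_unfold)
  also have "\<dots> = (\<Sum>i<length \<mu>. i * \<mu> ! i)"
    by (simp add: mult.commute)
  also have "\<dots> = row_weight \<mu>"
  proof (induction \<mu>)
    case (Cons a \<mu>)
    have "(\<Sum>i<length (a # \<mu>). i * (a # \<mu>) ! i) = (\<Sum>i<length \<mu>. \<mu> ! i) + (\<Sum>i<length \<mu>. i * \<mu> ! i)"
      by (simp add: sum.lessThan_Suc_shift sum.distrib del: sum.lessThan_Suc)
    then show ?case using Cons by (simp add: sum_list_sum_nth atLeast0LessThan)
  qed simp
  finally show ?thesis .
qed

lemma card_row: "i < length \<mu> \<Longrightarrow> card {k\<in>{..<sum_list \<mu>}. cell_row \<mu> k = i} = \<mu> ! i"
proof -
  assume i: "i < length \<mu>"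
  have "tableau_cell \<mu> ` {k\<in>{..<sum_list \<mu>}. cell_row \<mu> k = i} = Pair i ` {..<\<mu> ! i}"
  proof -
    have "tableau_cell \<mu> ` {k\<in>{..<sum_list \<mu>}. cell_row \<mu> k = i} = {x \<in> tableau_cell \<mu> ` {..<sum_list \<mu>}. fst x = i}"
      by auto
    also have "\<dots> = Pair i ` {..<\<mu> ! i}"
      using bij_betw_tableau_cell[of \<mu>] i by (auto simp: bij_betw_def)
    finally show ?thesis .
  qed
  moreover have "card (tableau_cell \<mu> ` {k\<in>{..<sum_list \<mu>}. cell_row \<mu> k = i}) = card {k\<in>{..<sum_list \<mu>}. cell_row \<mu> k = i}"
    by (rule card_image, rule inj_on_subset[OF inj_on_tableau_cell]) auto
  ultimately show ?thesis by (simp add: card_image inj_on_def)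
qed

lemma row_less: "k < sum_list \<mu> \<Longrightarrow> cell_row \<mu> k < length \<mu>"
  using bij_betw_apply[OF bij_betw_tableau_cell[of \<mu>], of k] by (cases "tableau_cell \<mu> k") simp

section \<open>The column argument\<close>

lemma sum_ge_sum_lessThan:
  fixes S :: "nat set"
  assumes "finite S"
  shows "\<Sum>{..<card S} \<le> \<Sum>S \<and> (\<Sum>S = \<Sum>{..<card S} \<longrightarrow> S = {..<card S})"
  using assms
proof (induction "card S" arbitrary: S)
  case 0
  then show ?case by simp
next
  case (Suc m)
  then have S: "S \<noteq> {}" by auto
  define x where "x = Max S"
  have x: "x \<in> S" using Suc.prems S by (simp add: x_def)
  have "S \<subseteq> {..x}" using Suc.prems by (auto simp: x_def)
  then have "card S \<le> Suc x" using card_mono[of "{..x}" S] by simp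
  then have xm: "m \<le> x" using Suc.hyps(2) by simp
  let ?T = "S - {x}"
  have T: "card ?T = m" using x Suc by simp
  have IH: "\<Sum>{..<m} \<le> \<Sum>?T" "\<Sum>?T = \<Sum>{..<m} \<longrightarrow> ?T = {..<m}"
    using Suc.hyps(1)[of ?T] T Suc.prems by auto
  have sum: "\<Sum>S = x + \<Sum>?T" using Suc.prems x by (simp add: sum.remove)
  have sum': "\<Sum>{..<card S} = m + \<Sum>{..<m}" by (simp flip: Suc.hyps(2))
  show ?case
  proof (intro conjI impI)
    show "\<Sum>{..<card S} \<le> \<Sum>S" using sum sum' xm IH by simp
    assume "\<Sum>S = \<Sum>{..<card S}"
    then have "x = m" "?T = {..<m}" using sum sum' xm IH by auto
    then have "S = insert m {..<m}" using x by auto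
    then show "S = {..<card S}" by (auto simp flip: Suc.hyps(2))
  qed
qed

lemma down_closed_eq:
  fixes S :: "nat set"
  assumes "finite S" "\<And>i i'. i \<in> S \<Longrightarrow> i' < i \<Longrightarrow> i' \<in> S"
  shows "S = {..<card S}"
proof -
  define m where "m = (LEAST m. m \<notin> S)"
  have "\<exists>m. m \<notin> S" using assms(1) by (metis ex_new_if_finite infinite_UNIV_nat)
  then have m: "m \<notin> S" unfolding m_def by (rule LeastI_ex)
  have "S = {..<m}"
  proof (intro Set.set_eqI iffI)
    fix i assume "i \<in> S"
    then show "i \<in> {..<m}" using m assms(2)[of i m] by (cases "i < m") (auto simp: not_less le_less)
  next
    fix i assume "i \<in> {..<m}"
    then show "i \<in> S" using not_less_Least[of i "\<lambda>m. m \<notin> S"] by (auto simp: m_def)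
  qed
  then show ?thesis by simp
qed

text \<open>
  A column of length \<open>l\<close> has row indices \<open>0, \<dots>, l - 1\<close>, and \<open>l\<close> distinct values of \<open>f\<close> cannot have a smaller
  sum.
\<close>

lemma column_injective:
  assumes sorted: "sorted_wrt (\<ge>) \<mu>"
    and inj: "inj_on (\<lambda>k. (f k, cell_col \<mu> k)) {..<sum_list \<mu>}"
  shows "row_weight \<mu> \<le> (\<Sum>k<sum_list \<mu>. f k)"
    and "(\<Sum>k<sum_list \<mu>. f k) = row_weight \<mu> \<Longrightarrow>
      (\<lambda>k. (f k, cell_col \<mu> k)) ` {..<sum_list \<mu>} = tableau_cell \<mu> ` {..<sum_list \<mu>}"
proof -
  let ?n = "sum_list \<mu>"
  define C where "C j = {k\<in>{..<?n}. cell_col \<mu> k = j}" for j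
  have finC: "finite (C j)" for j by (simp add: C_def)
  have injr: "inj_on (cell_row \<mu>) (C j)" for j
  proof (rule inj_onI)
    fix x y assume "x \<in> C j" "y \<in> C j" "cell_row \<mu> x = cell_row \<mu> y"
    then show "x = y" using tableau_cell_eq_iff[of x \<mu> y] by (auto simp: C_def)
  qed
  have row: "cell_row \<mu> ` C j = {..<card (C j)}" for j
  proof -
    have im: "cell_row \<mu> ` C j = {i. i < length \<mu> \<and> j < \<mu> ! i}"
    proof -
      have "cell_row \<mu> ` C j = fst ` {x \<in> tableau_cell \<mu> ` {..<?n}. snd x = j}"
        by (auto simp: C_def)
      also have "\<dots> = {i. i < length \<mu> \<and> j < \<mu> ! i}"
      proof -
        have "fst ` {x \<in> S. snd x = j} = {i. (i, j) \<in> S}" for S :: "(nat \<times> nat) set" by force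
        then show ?thesis unfolding bij_betw_imp_surj_on[OF bij_betw_tableau_cell] by auto
      qed
      finally show ?thesis .
    qed
    have "cell_row \<mu> ` C j = {..<card (cell_row \<mu> ` C j)}"
    proof (rule down_closed_eq)
      show "finite (cell_row \<mu> ` C j)" by (simp add: finC)
      fix i i' assume "i \<in> cell_row \<mu> ` C j" "i' < i"
      then show "i' \<in> cell_row \<mu> ` C j"
        unfolding im using sorted_wrt_nth_less[OF sorted, of i' i] by auto
    qed
    then show ?thesis by (simp add: card_image injr)
  qed
  have injf: "inj_on f (C j)" for j using inj by (auto simp: inj_on_def C_def)
  have sumr: "(\<Sum>k\<in>C j. cell_row \<mu> k) = \<Sum>{..<card (C j)}" for j
    using sum.reindex[OF injr, of id j] row[of j] by simp
  have sumf: "(\<Sum>k\<in>C j. f k) = \<Sum>(f ` C j)" for j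
    using sum.reindex[OF injf, of id j] by simp
  have cardf: "card (f ` C j) = card (C j)" for j by (rule card_image[OF injf])
  note key = sum_ge_sum_lessThan[of "f ` C j" for j, unfolded cardf, OF finite_imageI[OF finC]]
  have le: "(\<Sum>k\<in>C j. cell_row \<mu> k) \<le> (\<Sum>k\<in>C j. f k)" for j
    unfolding sumr sumf using key by simp
  have split: "(\<Sum>k<?n. g k) = (\<Sum>j\<in>cell_col \<mu> ` {..<?n}. \<Sum>k\<in>C j. g k)" for g :: "nat \<Rightarrow> nat"
    unfolding C_def by (rule sum.image_gen) simp
  show "row_weight \<mu> \<le> (\<Sum>k<?n. f k)"
    unfolding sum_row[symmetric] split by (rule sum_mono) (rule le)
  assume eq: "(\<Sum>k<?n. f k) = row_weight \<mu>"
  have eq': "(\<Sum>j\<in>cell_col \<mu> ` {..<?n}. \<Sum>k\<in>C j. cell_row \<mu> k) = (\<Sum>j\<in>cell_col \<mu> ` {..<?n}. \<Sum>k\<in>C j. f k)"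
    using eq unfolding sum_row[symmetric] split by simp
  have imC: "(\<lambda>k. (f k, cell_col \<mu> k)) ` C j = (\<lambda>k. (cell_row \<mu> k, cell_col \<mu> k)) ` C j" if j: "j \<in> cell_col \<mu> ` {..<?n}" for j
  proof -
    \<comment> \<open>The inequality holds column by column, so equality of the totals forces it in
      each column.\<close>
    have "(\<Sum>k\<in>C j. cell_row \<mu> k) = (\<Sum>k\<in>C j. f k)"
      using sum_mono_inv[OF eq' le j] by simp
    then have "f ` C j = cell_row \<mu> ` C j"
      using key[of j] unfolding sumr sumf row by simp
    moreover have "(\<lambda>k. (g k, cell_col \<mu> k)) ` C j = (\<lambda>i. (i, j)) ` g ` C j" for g :: "nat \<Rightarrow> nat"
      unfolding image_image by (rule image_cong) (simp_all add: C_def)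
    ultimately show ?thesis by metis
  qed
  have split_im: "g ` {..<?n} = (\<Union>j\<in>cell_col \<mu> ` {..<?n}. g ` C j)" for g :: "nat \<Rightarrow> nat \<times> nat"
    by (auto simp: C_def)
  have im: "(\<lambda>k. (f k, cell_col \<mu> k)) ` {..<?n} = (\<lambda>k. (cell_row \<mu> k, cell_col \<mu> k)) ` {..<?n}"
    unfolding split_im by (rule SUP_cong[OF refl imC])
  show "(\<lambda>k. (f k, cell_col \<mu> k)) ` {..<?n} = tableau_cell \<mu> ` {..<?n}" unfolding im by simp
qed

section \<open>The Young symmetrizer\<close>

abbreviation Sym :: "nat \<Rightarrow> (nat \<Rightarrow> nat) set" where
  "Sym n \<equiv> {p. p permutes {..<n}}"

lemma sum_Sym_left: "g permutes {..<n} \<Longrightarrow> (\<Sum>u\<in>Sym n. F (g \<circ> u)) = (\<Sum>u\<in>Sym n. F u)"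
  by (rule setum_permutations_compose_left[symmetric])

lemma sum_Sym_right: "g permutes {..<n} \<Longrightarrow> (\<Sum>u\<in>Sym n. F (u \<circ> g)) = (\<Sum>u\<in>Sym n. F u)"
  by (rule sum_permutations_compose_right[symmetric])

lemma sum_Sym_inv: "(\<Sum>u\<in>Sym n. F (inv u)) = (\<Sum>u\<in>Sym n. F u)"
  by (rule sum.reindex_bij_witness[of _ inv inv]) (auto simp: permutes_inv permutes_inv_inv)

lemma sum_Sym_conj:
  assumes "g permutes {..<n}"
  shows "(\<Sum>u\<in>Sym n. F (g \<circ> u \<circ> inv g)) = (\<Sum>u\<in>Sym n. F u)"
  using sum_Sym_left[OF assms, of "\<lambda>u. F (u \<circ> inv g)"] sum_Sym_right[OF permutes_inv[OF assms], of F] by simp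

lemma finite_Sym: "finite (Sym n)"
  by (simp add: finite_permutations)

lemma inv_comp_perm: "p permutes S \<Longrightarrow> q permutes S \<Longrightarrow> inv (p \<circ> q) = inv q \<circ> inv p"
  by (intro o_inv_distrib permutes_bij)

lemma row_stabilizer_alt:
  "row_stabilizer \<kappa> = {p. p permutes {..<sum_list \<kappa>} \<and> (\<forall>x\<in>{..<sum_list \<kappa>}. cell_row \<kappa> (p x) = cell_row \<kappa> x)}"
  by (auto simp: row_stabilizer_def)

locale young =
  fixes \<mu> :: "nat list"
  assumes sorted_shape: "sorted_wrt (\<ge>) \<mu>"
begin

definition n where "n = sum_list \<mu>"

abbreviation "R \<equiv> row_stabilizer \<mu>"
abbreviation "C \<equiv> column_stabilizer \<mu>"
abbreviation "c \<equiv> young_symmetrizer \<mu>"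

lemma R_perm: "p \<in> R \<Longrightarrow> p permutes {..<n}" and C_perm: "q \<in> C \<Longrightarrow> q permutes {..<n}"
  by (simp_all add: row_stabilizer_def column_stabilizer_def n_def)

lemma R_comp: "p \<in> R \<Longrightarrow> p' \<in> R \<Longrightarrow> p \<circ> p' \<in> R"
proof -
  assume p: "p \<in> R" "p' \<in> R"
  then have "cell_row \<mu> (p (p' k)) = cell_row \<mu> k" if "k < n" for k
    using that permutes_in_image[OF R_perm[OF p(2)], of k] by (simp add: row_stabilizer_def n_def)
  then show ?thesis using p by (auto simp: row_stabilizer_def n_def intro: permutes_compose)
qed

lemma C_comp: "p \<in> C \<Longrightarrow> p' \<in> C \<Longrightarrow> p \<circ> p' \<in> C"
proof -
  assume p: "p \<in> C" "p' \<in> C"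
  then have "cell_col \<mu> (p (p' k)) = cell_col \<mu> k" if "k < n" for k
    using that permutes_in_image[OF C_perm[OF p(2)], of k] by (simp add: column_stabilizer_def n_def)
  then show ?thesis using p by (auto simp: column_stabilizer_def n_def intro: permutes_compose)
qed

lemma R_inv: "p \<in> R \<Longrightarrow> inv p \<in> R"
proof -
  assume p: "p \<in> R"
  have "cell_row \<mu> (inv p k) = cell_row \<mu> k" if "k < n" for k
  proof -
    have "inv p k < n" using that permutes_in_image[OF permutes_inv[OF R_perm[OF p]], of k] by simp
    then have "cell_row \<mu> (p (inv p k)) = cell_row \<mu> (inv p k)" using p by (simp add: row_stabilizer_def n_def)
    then show ?thesis using permutes_inverses[OF R_perm[OF p]] by simp
  qed
  then show ?thesis using p by (auto simp: row_stabilizer_def n_def permutes_inv)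
qed

lemma C_inv: "p \<in> C \<Longrightarrow> inv p \<in> C"
proof -
  assume p: "p \<in> C"
  have "cell_col \<mu> (inv p k) = cell_col \<mu> k" if "k < n" for k
  proof -
    have "inv p k < n" using that permutes_in_image[OF permutes_inv[OF C_perm[OF p]], of k] by simp
    then have "cell_col \<mu> (p (inv p k)) = cell_col \<mu> (inv p k)" using p by (simp add: column_stabilizer_def n_def)
    then show ?thesis using permutes_inverses[OF C_perm[OF p]] by simp
  qed
  then show ?thesis using p by (auto simp: column_stabilizer_def n_def permutes_inv)
qed

lemma id_R: "id \<in> R" and id_C: "id \<in> C"
  by (simp_all add: row_stabilizer_def column_stabilizer_def permutes_id)

lemma finite_R: "finite R" and finite_C: "finite C"
  by (rule finite_subset[OF _ finite_Sym[of n]], auto dest: R_perm C_perm)+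

lemma comp_inv_cancel:
  assumes "p permutes {..<n}"
  shows "p \<circ> (inv p \<circ> g) = g" "inv p \<circ> (p \<circ> g) = g" "g \<circ> p \<circ> inv p = g" "g \<circ> inv p \<circ> p = g"
  using permutes_inverses[OF assms] by (auto simp: fun_eq_iff)

lemma c_left:
  assumes p: "p \<in> R" shows "c (p \<circ> g) = c g"
proof -
  note perm = R_perm[OF p]
  have "c (p \<circ> g) = (\<Sum>p'\<in>R. \<Sum>q\<in>C. if inv p \<circ> p' \<circ> q = g then of_int (sign q) else 0)"
    unfolding young_symmetrizer_def
  proof (intro sum.cong refl if_cong)
    fix p' q
    show "(p' \<circ> q = p \<circ> g) = (inv p \<circ> p' \<circ> q = g)"
      using comp_inv_cancel(1,2)[OF perm] by (metis comp_assoc)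
  qed
  also have "\<dots> = c g"
    unfolding young_symmetrizer_def
    by (rule sum.reindex_bij_witness[of _ "\<lambda>p'. p \<circ> p'" "\<lambda>p'. inv p \<circ> p'"])
      (use comp_inv_cancel[OF perm] R_comp R_inv p in auto)
  finally show ?thesis .
qed

lemma c_right:
  assumes q: "q \<in> C" shows "c (g \<circ> q) = of_int (sign q) * c g"
proof -
  note perm = C_perm[OF q]
  have fin: "permutation q'" if "q' \<in> C" for q'
    using C_perm[OF that] by (rule permutes_imp_permutation[rotated]) simp
  have "c (g \<circ> q) = (\<Sum>p\<in>R. \<Sum>q'\<in>C. of_int (sign q) * (if p \<circ> q' = g then of_int (sign q') else 0))"
    unfolding young_symmetrizer_def
  proof (rule sum.cong[OF refl])
    fix p assume "p \<in> R"
    show "(\<Sum>q'\<in>C. if p \<circ> q' = g \<circ> q then of_int (sign q') else 0) =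
        (\<Sum>q'\<in>C. of_int (sign q) * (if p \<circ> q' = g then of_int (sign q') else 0 :: complex))"
    proof (rule sum.reindex_bij_witness[of _ "\<lambda>q'. q' \<circ> q" "\<lambda>q'. q' \<circ> inv q"], goal_cases)
      case (5 q')
      have "p \<circ> (q' \<circ> inv q) = g \<longleftrightarrow> p \<circ> q' = g \<circ> q"
        using comp_inv_cancel(3,4)[OF perm] by (metis comp_assoc)
      moreover have "sign (q' \<circ> inv q) = sign q' * sign q"
        using fin q 5 C_inv by (simp add: sign_compose sign_inverse)
      moreover have "sign q * sign q = (1 :: int)" by (simp add: sign_def)
      then have "sign q * (sign q' * sign q) = (sign q' :: int)" by (simp add: mult.left_commute)
      ultimately show ?case by (auto simp flip: of_int_mult)
    qed (use comp_inv_cancel[OF perm] C_comp C_inv q in auto)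
  qed
  then show ?thesis by (simp add: young_symmetrizer_def sum_distrib_left)
qed

lemma R_C_trivial:
  assumes "p \<in> R" "p \<in> C" shows "p = id"
proof
  fix k
  show "p k = id k"
  proof (cases "k < n")
    case True
    then have "p k < n" using permutes_in_image[OF R_perm[OF assms(1)], of k] by simp
    then show ?thesis
      using assms True tableau_cell_eq_iff[of "p k" \<mu> k] by (simp add: row_stabilizer_def column_stabilizer_def n_def)
  next
    case False
    then show ?thesis using R_perm[OF assms(1)] by (simp add: permutes_not_in)
  qed
qed

lemma c_id: "c id = 1"
proof -
  have "p \<circ> q = id \<longleftrightarrow> p = id \<and> q = id" if "p \<in> R" "q \<in> C" for p q
  proof
    assume pq: "p \<circ> q = id"
    then have "p = inv q" using comp_inv_cancel(3)[OF C_perm[OF that(2)], of p] by simp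
    then have "p = id" using R_C_trivial[of p] C_inv that by simp
    then show "p = id \<and> q = id" using pq by simp
  qed simp
  then have "c id = (\<Sum>p\<in>R. \<Sum>q\<in>C. if p = id \<and> q = id then 1 else 0)"
    unfolding young_symmetrizer_def by (intro sum.cong refl) auto
  also have "\<dots> = (\<Sum>p\<in>R. if p = id then (\<Sum>q\<in>C. if q = id then 1 else 0) else 0)"
    by (intro sum.cong refl) auto
  also have "\<dots> = 1" using finite_R finite_C id_R id_C by simp
  finally show ?thesis .
qed

lemma c_outside: "\<not> g permutes {..<n} \<Longrightarrow> c g = 0"
  unfolding young_symmetrizer_def
  by (intro sum.neutral ballI) (auto dest!: R_perm C_perm intro: permutes_compose)

lemma c_Ints: "c g \<in> \<int>"
  by (auto simp: young_symmetrizer_def intro!: Ints_sum)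

lemma transposition_in_C:
  assumes "x < n" "y < n" "cell_col \<mu> x = cell_col \<mu> y"
  shows "transpose x y \<in> C"
  using assms by (auto simp: column_stabilizer_def n_def transpose_def intro!: permutes_swap_id)

lemma transpose_comp_perm:
  assumes "g permutes S"
  shows "transpose (g x) (g y) \<circ> g = g \<circ> transpose x y"
  using permutes_inj[OF assms] by (auto simp: fun_eq_iff transpose_def inj_eq)

text \<open>
  Either \<open>g\<close> factors as a row permutation times a column permutation, or some transposition \<open>t\<close> in \<open>C\<close>
  is conjugated by \<open>g\<close> into \<open>R\<close>, and then \<open>f g = - f g\<close>.
\<close>

lemma equivariant_unique:
  assumes g: "g permutes {..<n}"
    and left: "\<And>p g. p \<in> R \<Longrightarrow> g permutes {..<n} \<Longrightarrow> f (p \<circ> g) = f g"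
    and right: "\<And>q g. q \<in> C \<Longrightarrow> g permutes {..<n} \<Longrightarrow> f (g \<circ> q) = of_int (sign q) * f g"
  shows "f g = f id * c g"
proof (cases "inj_on (\<lambda>k. (cell_row \<mu> (g k), cell_col \<mu> k)) {..<n}")
  case True
  let ?h = "\<lambda>k. (cell_row \<mu> (g k), cell_col \<mu> k)"
  \<comment> \<open>As \<open>g\<close> only permutes the entries, the total of the row indices is
    unchanged, which is the equality case of \<open>column_injective\<close>.\<close>
  have "(\<Sum>k<n. cell_row \<mu> (g k)) = (\<Sum>k<n. cell_row \<mu> k)"
    using sum.permute[OF g, of "cell_row \<mu>"] by (simp add: comp_def)
  also have "\<dots> = row_weight \<mu>" by (simp add: n_def sum_row)
  finally have im: "?h ` {..<n} = tableau_cell \<mu> ` {..<n}"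
    using column_injective(2)[OF sorted_shape, of "\<lambda>k. cell_row \<mu> (g k)"] True unfolding n_def by simp
  \<comment> \<open>\<open>q k\<close> is the entry in the column of \<open>k\<close> and the row of
    \<open>g k\<close>; the cell exists by \<open>im\<close>. So \<open>q\<close> preserves columns,
    and what remains of \<open>g\<close> preserves rows.\<close>
  define q where "q k = (if k < n then inv_into {..<n} (tableau_cell \<mu>) (?h k) else k)" for k
  have q: "q k < n \<and> tableau_cell \<mu> (q k) = ?h k" if "k < n" for k
  proof -
    have "?h k \<in> tableau_cell \<mu> ` {..<n}" using im that by blast
    then show ?thesis using that inv_into_into[of "?h k" "tableau_cell \<mu>" "{..<n}"]
      by (auto simp: q_def f_inv_into_f simp del: tableau_cell_def)
  qed
  have qperm: "q permutes {..<n}"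
  proof (rule bij_imp_permutes)
    have inj: "inj_on q {..<n}"
    proof (rule inj_onI)
      fix x y assume "x \<in> {..<n}" "y \<in> {..<n}" "q x = q y"
      then have "?h x = ?h y" using q[of x] q[of y] by simp
      then show "x = y" using True \<open>x \<in> _\<close> \<open>y \<in> _\<close> by (auto dest: inj_onD)
    qed
    moreover have "q ` {..<n} = {..<n}" using q by (intro endo_inj_surj inj) auto
    ultimately show "bij_betw q {..<n} {..<n}" by (simp add: bij_betw_def)
  qed (simp add: q_def)
  have qC: "q \<in> C" using qperm q by (simp add: column_stabilizer_def n_def)
  define p where "p = g \<circ> inv q"
  have pq: "p \<circ> q = g" by (simp add: p_def comp_inv_cancel[OF qperm])
  have pperm: "p permutes {..<n}" unfolding p_def by (intro permutes_compose permutes_inv qperm g)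
  have "cell_row \<mu> (p k) = cell_row \<mu> k" if "k < n" for k
  proof -
    have "inv q k < n" using that permutes_in_image[OF permutes_inv[OF qperm], of k] by simp
    then have "tableau_cell \<mu> (q (inv q k)) = ?h (inv q k)" using q by blast
    then show ?thesis using permutes_inverses[OF qperm] by (simp add: p_def)
  qed
  then have pR: "p \<in> R" using pperm by (simp add: row_stabilizer_def n_def)
  have "f g = of_int (sign q) * f id"
    using left[OF pR qperm] right[OF qC permutes_id] pq by simp
  moreover have "c g = of_int (sign q)"
    using c_left[OF pR, of q] c_right[OF qC, of id] c_id pq by simp
  ultimately show ?thesis by simp
next
  case False
  then obtain x y where xy: "x < n" "y < n" "x \<noteq> y" "cell_row \<mu> (g x) = cell_row \<mu> (g y)" "cell_col \<mu> x = cell_col \<mu> y"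
    by (auto simp: inj_on_def)
  let ?t = "transpose x y" and ?s = "transpose (g x) (g y)"
  have gxy: "g x < n" "g y < n" using xy permutes_in_image[OF g] by auto
  have t: "?t \<in> C" using xy by (intro transposition_in_C)
  have s: "?s \<in> R" using xy gxy by (auto simp: row_stabilizer_def n_def transpose_def intro!: permutes_swap_id)
  have sgn: "sign ?t = -1" using xy by (simp add: sign_swap_id)
  note st = transpose_comp_perm[OF g, of x y]
  have "f g = - f g" using left[OF s g] right[OF t g] sgn unfolding st by simp
  moreover have "c g = - c g" using c_left[OF s, of g] c_right[OF t, of g] sgn unfolding st by simp
  ultimately show ?thesis by simp
qed

text \<open>The coefficient of the identity in the square of the symmetrizer, hence the factor in c
  c = \<kappa> c.\<close>

definition \<kappa> :: complex where "\<kappa> = (\<Sum>u\<in>Sym n. c u * c (inv u))"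

text \<open>The sum has the symmetry required by \<open>equivariant_unique\<close> as a function of
  \<open>x\<close>, and for x = id also as a function of \<open>h\<close>. Applying that lemma twice
  leaves the value at h = x = id, which is \<kappa>. For h = id this is c c = \<kappa> c.\<close>

lemma c_convolution:
  assumes h: "h permutes {..<n}" and x: "x permutes {..<n}"
  shows "(\<Sum>u\<in>Sym n. c u * c (h \<circ> inv u \<circ> x)) = \<kappa> * c h * c x"
proof -
  have 1: "(\<Sum>u\<in>Sym n. c u * c (h \<circ> inv u \<circ> x)) = (\<Sum>u\<in>Sym n. c u * c (h \<circ> inv u \<circ> id)) * c x"
  proof (rule equivariant_unique[OF x, of "\<lambda>x. \<Sum>u\<in>Sym n. c u * c (h \<circ> inv u \<circ> x)"])
    fix p g assume p: "p \<in> R" and "g permutes {..<n}"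
    note pp = R_perm[OF p]
    have "(\<Sum>u\<in>Sym n. c u * c (h \<circ> inv u \<circ> (p \<circ> g))) = (\<Sum>u\<in>Sym n. c (p \<circ> u) * c (h \<circ> inv (p \<circ> u) \<circ> (p \<circ> g)))"
      by (rule sum_Sym_left[OF pp, symmetric])
    also have "\<dots> = (\<Sum>u\<in>Sym n. c u * c (h \<circ> inv u \<circ> g))"
    proof (intro sum.cong refl, clarify)
      fix u :: "nat \<Rightarrow> nat" assume u: "u permutes {..<n}"
      have "h \<circ> inv (p \<circ> u) \<circ> (p \<circ> g) = h \<circ> inv u \<circ> g"
        using comp_inv_cancel(2)[OF pp, of g] by (simp add: inv_comp_perm[OF pp u] comp_assoc)
      then show "c (p \<circ> u) * c (h \<circ> inv (p \<circ> u) \<circ> (p \<circ> g)) = c u * c (h \<circ> inv u \<circ> g)"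
        by (simp add: c_left[OF p])
    qed
    finally show "(\<Sum>u\<in>Sym n. c u * c (h \<circ> inv u \<circ> (p \<circ> g))) = (\<Sum>u\<in>Sym n. c u * c (h \<circ> inv u \<circ> g))" .
  next
    fix q g assume q: "q \<in> C" and "g permutes {..<n}"
    show "(\<Sum>u\<in>Sym n. c u * c (h \<circ> inv u \<circ> (g \<circ> q))) = of_int (sign q) * (\<Sum>u\<in>Sym n. c u * c (h \<circ> inv u \<circ> g))"
      using c_right[OF q] by (simp add: sum_distrib_left mult.left_commute flip: comp_assoc)
  qed
  have "(\<Sum>u\<in>Sym n. c u * c (h \<circ> inv u)) = (\<Sum>u\<in>Sym n. c u * c (id \<circ> inv u)) * c h"
  proof (rule equivariant_unique[OF h, of "\<lambda>h. \<Sum>u\<in>Sym n. c u * c (h \<circ> inv u)"])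
    fix p g assume p: "p \<in> R" and "g permutes {..<n}"
    show "(\<Sum>u\<in>Sym n. c u * c ((p \<circ> g) \<circ> inv u)) = (\<Sum>u\<in>Sym n. c u * c (g \<circ> inv u))"
      using c_left[OF p] by (simp add: comp_assoc)
  next
    fix q g assume q: "q \<in> C" and "g permutes {..<n}"
    note qp = C_perm[OF q]
    have "(\<Sum>u\<in>Sym n. c u * c (g \<circ> q \<circ> inv u)) = (\<Sum>u\<in>Sym n. c (u \<circ> q) * c (g \<circ> q \<circ> inv (u \<circ> q)))"
      by (rule sum_Sym_right[OF qp, symmetric])
    also have "\<dots> = (\<Sum>u\<in>Sym n. of_int (sign q) * (c u * c (g \<circ> inv u)))"
    proof (intro sum.cong refl, clarify)
      fix u :: "nat \<Rightarrow> nat" assume u: "u permutes {..<n}"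
      have "g \<circ> q \<circ> inv (u \<circ> q) = g \<circ> inv u"
        using comp_inv_cancel(3)[OF qp, of g] by (simp add: inv_comp_perm[OF u qp] flip: comp_assoc)
      then show "c (u \<circ> q) * c (g \<circ> q \<circ> inv (u \<circ> q)) = of_int (sign q) * (c u * c (g \<circ> inv u))"
        by (simp add: c_right[OF q])
    qed
    finally show "(\<Sum>u\<in>Sym n. c u * c (g \<circ> q \<circ> inv u)) = of_int (sign q) * (\<Sum>u\<in>Sym n. c u * c (g \<circ> inv u))"
      by (simp add: sum_distrib_left)
  qed
  then show ?thesis unfolding 1 by (simp add: \<kappa>_def)
qed

end

section \<open>Traces on finitely spanned function spaces\<close>

lemma sum_fun_apply: "(\<Sum>a\<in>A. f a) x = (\<Sum>a\<in>A. f a x)" for f :: "'a \<Rightarrow> 'b \<Rightarrow> 'c::comm_monoid_add"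
  by (induction A rule: infinite_finite_induct) auto

lemma trace_on_basis:
  assumes "finite S"
  shows "\<exists>B. finite B \<and> cfun.independent B \<and> cfun.span B = cfun.span S \<and>
    (\<forall>T. trace_on (cfun.span S) T = (\<Sum>b\<in>B. cfun.representation B (T b) b))"
proof -
  define B where "B = (SOME B. cfun.independent B \<and> cfun.span B = cfun.span S)"
  have "\<exists>B. cfun.independent B \<and> cfun.span B = cfun.span S"
  proof -
    obtain B where "B \<subseteq> cfun.span S" "cfun.independent B" "cfun.span S \<subseteq> cfun.span B"
      by (rule cfun.maximal_independent_subset)
    then show ?thesis by (metis cfun.span_mono cfun.span_span order_antisym)
  qed
  then have "cfun.independent B \<and> cfun.span B = cfun.span S"
    unfolding B_def by (rule someI_ex)
  then have B: "cfun.independent B" "cfun.span B = cfun.span S" by auto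
  have fB: "finite B"
    using cfun.independent_span_bound[OF assms B(1)] B(2) cfun.span_superset[of B] by simp
  have "trace_on (cfun.span S) T = (\<Sum>b\<in>B. cfun.representation B (T b) b)" for T
    unfolding trace_on_def B_def by (simp only: Let_def)
  then show ?thesis using fB B by blast
qed

lemma trace_on_scale:
  assumes "finite S"
  shows "\<exists>m::nat. trace_on (cfun.span S) (\<lambda>f x. k * f x) = k * of_nat m"
proof -
  obtain B where B: "finite B" "cfun.independent B" "cfun.span B = cfun.span S"
    and T: "\<And>T. trace_on (cfun.span S) T = (\<Sum>b\<in>B. cfun.representation B (T b) b)"
    using trace_on_basis[OF assms] by auto
  have "cfun.representation B (\<lambda>x. k * b x) b = k" if "b \<in> B" for b
    using that cfun.representation_scale[OF B(2) cfun.span_base[OF that], of k] cfun.representation_basis[OF B(2) that]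
    by simp
  then have "trace_on (cfun.span S) (\<lambda>f x. k * f x) = k * of_nat (card B)"
    unfolding T by simp
  then show ?thesis by blast
qed

text \<open>On the span, \<open>T\<close> is a sum of rank one maps, each evaluating f at u and
  multiplying \<open>v u\<close> by the result. The trace of such a map is \<open>v u u\<close>,
  whatever the basis.\<close>

lemma trace_on_eq:
  assumes S: "finite S" and G: "finite G"
    and v: "\<And>u. u \<in> G \<Longrightarrow> v u \<in> cfun.span S"
    and T: "\<And>f. f \<in> cfun.span S \<Longrightarrow> T f = (\<Sum>u\<in>G. (\<lambda>x. f u * v u x))"
  shows "trace_on (cfun.span S) T = (\<Sum>u\<in>G. v u u)"
proof -
  obtain B where B: "finite B" "cfun.independent B" "cfun.span B = cfun.span S"
    and tr: "\<And>T. trace_on (cfun.span S) T = (\<Sum>b\<in>B. cfun.representation B (T b) b)"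
    using trace_on_basis[OF S] by auto
  have "trace_on (cfun.span S) T = (\<Sum>b\<in>B. \<Sum>u\<in>G. b u * cfun.representation B (v u) b)"
    unfolding tr
  proof (rule sum.cong[OF refl])
    fix b assume "b \<in> B"
    then have b: "b \<in> cfun.span S" using B(3) cfun.span_base by blast
    have "cfun.representation B (T b) = (\<lambda>b'. \<Sum>u\<in>G. cfun.representation B (\<lambda>x. b u * v u x) b')"
      unfolding T[OF b] using v B by (intro cfun.representation_sum) (auto intro: cfun.span_scale)
    also have "\<dots> = (\<lambda>b'. \<Sum>u\<in>G. b u * cfun.representation B (v u) b')"
      using v B by (intro ext sum.cong refl) (simp add: cfun.representation_scale)
    finally show "cfun.representation B (T b) b = (\<Sum>u\<in>G. b u * cfun.representation B (v u) b)" by simp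
  qed
  also have "\<dots> = (\<Sum>u\<in>G. \<Sum>b\<in>B. cfun.representation B (v u) b * b u)"
    by (subst sum.swap) (simp add: mult.commute)
  also have "\<dots> = (\<Sum>u\<in>G. v u u)"
  proof (rule sum.cong[OF refl])
    fix u assume u: "u \<in> G"
    have "(\<Sum>b\<in>B. (\<lambda>x. cfun.representation B (v u) b * b x)) = v u"
      using v[OF u] B by (intro cfun.sum_representation_eq) auto
    then have "(\<Sum>b\<in>B. (\<lambda>x. cfun.representation B (v u) b * b x)) u = v u u" by simp
    then show "(\<Sum>b\<in>B. cfun.representation B (v u) b * b u) = v u u"
      by (simp add: sum_fun_apply)
  qed
  finally show ?thesis .
qed

context young
begin

definition gens where "gens = (\<lambda>g. left_mult g c) ` Sym n"

lemma specht_module_span: "specht_module \<mu> = cfun.span gens" and finite_gens: "finite gens"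
  by (simp_all add: specht_module_def gens_def n_def finite_permutations)

lemma left_mult_c_in_V: "u permutes {..<n} \<Longrightarrow> left_mult u c \<in> cfun.span gens"
  by (rule cfun.span_base) (simp add: gens_def)

text \<open>
  Right multiplication by the symmetrizer maps the group algebra into the Specht module and acts
  there as the scalar \<open>\<kappa>\<close>, so traces on the module become traces on the group algebra.
\<close>

lemma right_mult_c_on_V:
  assumes "f \<in> cfun.span gens"
  shows "(\<Sum>u\<in>Sym n. (\<lambda>x. f u * left_mult u c x)) = (\<lambda>x. \<kappa> * f x)"
  using assms
proof (induction rule: cfun.span_induct_alt)
  case base
  then show ?case by (simp add: fun_eq_iff sum_fun_apply)
next
  case (step a f f')
  then obtain g where g: "g permutes {..<n}" and f: "f = left_mult g c" by (auto simp: gens_def)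
  have main: "(\<Sum>u\<in>Sym n. f u * left_mult u c x) = \<kappa> * f x" for x
  proof (cases "x permutes {..<n}")
    case True
    have gi: "inv g permutes {..<n}" by (rule permutes_inv[OF g])
    have "(\<Sum>u\<in>Sym n. f u * left_mult u c x) = (\<Sum>u\<in>Sym n. f (g \<circ> u) * left_mult (g \<circ> u) c x)"
      by (rule sum_Sym_left[OF g, symmetric])
    also have "\<dots> = (\<Sum>u\<in>Sym n. c u * c (id \<circ> inv u \<circ> (inv g \<circ> x)))"
    proof (intro sum.cong refl, clarify)
      fix u :: "nat \<Rightarrow> nat" assume u: "u permutes {..<n}"
      show "f (g \<circ> u) * left_mult (g \<circ> u) c x = c u * c (id \<circ> inv u \<circ> (inv g \<circ> x))"
        by (simp add: f left_mult_def inv_comp_perm[OF g u] comp_inv_cancel[OF g] comp_assoc)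
    qed
    also have "\<dots> = \<kappa> * c (inv g \<circ> x)"
      using c_convolution[OF permutes_id permutes_compose[OF True gi]] by (simp add: c_id)
    finally show ?thesis by (simp add: f left_mult_def)
  next
    case False
    have out: "left_mult u c x = 0" if "u permutes {..<n}" for u
    proof -
      have "\<not> inv u \<circ> x permutes {..<n}"
      proof
        assume "inv u \<circ> x permutes {..<n}"
        then have "u \<circ> (inv u \<circ> x) permutes {..<n}" using that by (rule permutes_compose)
        then show False using False comp_inv_cancel(1)[OF that, of x] by simp
      qed
      then show ?thesis by (simp add: left_mult_def c_outside)
    qed
    then show ?thesis using g by (simp add: f)
  qed
  have "(\<Sum>u\<in>Sym n. ((\<lambda>xa. a * f xa) + f') u * left_mult u c x) = \<kappa> * ((\<lambda>xa. a * f xa) + f') x" for x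
  proof -
    have "(\<Sum>u\<in>Sym n. ((\<lambda>xa. a * f xa) + f') u * left_mult u c x) =
        a * (\<Sum>u\<in>Sym n. f u * left_mult u c x) + (\<Sum>u\<in>Sym n. f' u * left_mult u c x)"
      by (simp add: sum_distrib_left distrib_right sum.distrib mult.assoc)
    also have "(\<Sum>u\<in>Sym n. f' u * left_mult u c x) = \<kappa> * f' x"
      using fun_cong[OF step(2), of x] by (simp add: sum_fun_apply)
    finally show ?thesis by (simp add: main algebra_simps)
  qed
  then show ?case by (simp add: fun_eq_iff sum_fun_apply)
qed

text \<open>The trace of the scalar \<kappa> on the Specht module, computed in two ways, is \<kappa>
  times the dimension and also n! times \<open>c id\<close>, that is n!.\<close>

lemma \<kappa>_nonzero: "\<kappa> \<noteq> 0"
proof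
  assume 0: "\<kappa> = 0"
  obtain m :: nat where "trace_on (cfun.span gens) (\<lambda>f x. \<kappa> * f x) = \<kappa> * of_nat m"
    using trace_on_scale[OF finite_gens] by blast
  moreover have "trace_on (cfun.span gens) (\<lambda>f x. \<kappa> * f x) = (\<Sum>u\<in>Sym n. left_mult u c u)"
    using left_mult_c_in_V right_mult_c_on_V
    by (intro trace_on_eq finite_gens finite_Sym) auto
  moreover have "(\<Sum>u\<in>Sym n. left_mult u c u) = (\<Sum>u\<in>Sym n. 1)"
    by (intro sum.cong refl) (simp add: left_mult_def c_id permutes_inv_o)
  ultimately show False using 0 by (simp add: card_permutations)
qed

text \<open>Since f is 1/\<kappa> times the sum of the f(u) u c, applying \<sigma> gives the rank
  one form of \<open>trace_on_eq\<close>. The coefficient of u in \<sigma> u c is the value of c in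
  the sum.\<close>

lemma irr_char_eq:
  assumes \<sigma>: "\<sigma> permutes {..<n}"
  shows "irr_char \<mu> \<sigma> = (\<Sum>u\<in>Sym n. c (inv u \<circ> inv \<sigma> \<circ> u)) / \<kappa>"
proof -
  define v where "v u = (\<lambda>x. (1 / \<kappa>) * left_mult \<sigma> (left_mult u c) x)" for u
  have comp: "left_mult \<sigma> (left_mult u c) = left_mult (\<sigma> \<circ> u) c" if "u permutes {..<n}" for u
    by (simp add: left_mult_def inv_comp_perm[OF \<sigma> that] comp_assoc)
  have "irr_char \<mu> \<sigma> = trace_on (cfun.span gens) (left_mult \<sigma>)"
    by (simp add: irr_char_def specht_module_span)
  also have "\<dots> = (\<Sum>u\<in>Sym n. v u u)"
  proof (rule trace_on_eq[where v = v, OF finite_gens finite_Sym])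
    fix u assume "u \<in> Sym n"
    then show "v u \<in> cfun.span gens"
      unfolding v_def using \<sigma> by (intro cfun.span_scale) (simp add: comp left_mult_c_in_V permutes_compose)
  next
    fix f assume f: "f \<in> cfun.span gens"
    have "f = (\<lambda>x. (1 / \<kappa>) * (\<Sum>u\<in>Sym n. f u * left_mult u c x))"
      using right_mult_c_on_V[OF f] \<kappa>_nonzero by (simp add: fun_eq_iff sum_fun_apply)
    then have "left_mult \<sigma> f x = (1 / \<kappa>) * (\<Sum>u\<in>Sym n. f u * left_mult u c (inv \<sigma> \<circ> x))" for x
      unfolding left_mult_def[of \<sigma>] by (rule fun_cong)
    then show "left_mult \<sigma> f = (\<Sum>u\<in>Sym n. (\<lambda>x. f u * v u x))"
      by (simp add: fun_eq_iff sum_fun_apply v_def left_mult_def[of \<sigma>] sum_distrib_left mult_ac)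
  qed
  also have "\<dots> = (\<Sum>u\<in>Sym n. c (inv u \<circ> inv \<sigma> \<circ> u)) / \<kappa>"
    unfolding sum_divide_distrib
    by (intro sum.cong refl) (simp add: v_def left_mult_def comp_assoc)
  finally show ?thesis .
qed

lemma c_Reals: "c g \<in> \<real>"
  using c_Ints[of g] by (auto elim!: Ints_cases)

lemma \<kappa>_Reals: "\<kappa> \<in> \<real>"
  unfolding \<kappa>_def by (intro sum_in_Reals Reals_mult c_Reals)

lemma irr_char_Reals: "\<sigma> permutes {..<n} \<Longrightarrow> irr_char \<mu> \<sigma> \<in> \<real>"
  unfolding irr_char_eq by (intro Reals_divide sum_in_Reals c_Reals \<kappa>_Reals)

lemma irr_char_conj:
  assumes \<sigma>: "\<sigma> permutes {..<n}" and g: "g permutes {..<n}"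
  shows "irr_char \<mu> (g \<circ> \<sigma> \<circ> inv g) = irr_char \<mu> \<sigma>"
proof -
  have gi: "inv g permutes {..<n}" by (rule permutes_inv[OF g])
  have p: "g \<circ> \<sigma> \<circ> inv g permutes {..<n}" using \<sigma> g gi by (intro permutes_compose)
  have inv: "inv (g \<circ> \<sigma> \<circ> inv g) = g \<circ> inv \<sigma> \<circ> inv g"
    using \<sigma> g gi by (simp add: inv_comp_perm[of _ "{..<n}"] permutes_compose permutes_inv_inv[OF g] comp_assoc)
  have "(\<Sum>u\<in>Sym n. c (inv u \<circ> inv (g \<circ> \<sigma> \<circ> inv g) \<circ> u)) = (\<Sum>u\<in>Sym n. c (inv (g \<circ> u) \<circ> (g \<circ> inv \<sigma> \<circ> inv g) \<circ> (g \<circ> u)))"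
    unfolding inv by (rule sum_Sym_left[OF g, symmetric])
  also have "\<dots> = (\<Sum>u\<in>Sym n. c (inv u \<circ> inv \<sigma> \<circ> u))"
  proof (intro sum.cong refl, clarify)
    fix u :: "nat \<Rightarrow> nat" assume u: "u permutes {..<n}"
    show "c (inv (g \<circ> u) \<circ> (g \<circ> inv \<sigma> \<circ> inv g) \<circ> (g \<circ> u)) = c (inv u \<circ> inv \<sigma> \<circ> u)"
      by (simp add: inv_comp_perm[OF g u] comp_assoc comp_inv_cancel[OF g])
  qed
  finally show ?thesis by (simp add: irr_char_eq p \<sigma>)
qed

lemma irr_char_cycle_type:
  assumes "\<sigma> permutes {..<n}" "\<tau> permutes {..<n}" "cycle_type \<sigma> {..<n} = cycle_type \<tau> {..<n}"
  shows "irr_char \<mu> \<sigma> = irr_char \<mu> \<tau>"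
proof -
  obtain g where "g permutes {..<n}" "\<tau> = g \<circ> \<sigma> \<circ> inv g"
    using cycle_type_eq_imp_conjugate[OF assms(1,2) finite_lessThan assms(3)] .
  then show ?thesis using irr_char_conj assms by simp
qed

text \<open>A permutation and its inverse have the same cycle type, so the square can be written as
  a product of values at \<sigma> and its inverse. Conjugating the summation variable makes all n!
  terms over u equal, and each of them is evaluated by \<open>c_convolution\<close>.\<close>

lemma irr_char_norm: "(\<Sum>\<sigma>\<in>Sym n. irr_char \<mu> \<sigma> ^ 2) = fact n"
proof -
  let ?X = "\<lambda>\<sigma>. \<Sum>u\<in>Sym n. c (inv u \<circ> \<sigma> \<circ> u)"
  have 1: "irr_char \<mu> \<sigma> = ?X \<sigma> / \<kappa>" if \<sigma>: "\<sigma> permutes {..<n}" for \<sigma>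
  proof -
    have "irr_char \<mu> \<sigma> = irr_char \<mu> (inv \<sigma>)"
      using \<sigma> by (intro irr_char_cycle_type) (simp_all add: permutes_inv cycle_type_inv)
    then show ?thesis using \<sigma> by (simp add: irr_char_eq permutes_inv permutes_inv_inv)
  qed
  have "(\<Sum>\<sigma>\<in>Sym n. irr_char \<mu> \<sigma> ^ 2) = (\<Sum>\<sigma>\<in>Sym n. (?X (inv \<sigma>) / \<kappa>) * (?X \<sigma> / \<kappa>))"
  proof (rule sum.cong[OF refl], clarify)
    fix \<sigma> :: "nat \<Rightarrow> nat" assume \<sigma>: "\<sigma> permutes {..<n}"
    show "irr_char \<mu> \<sigma> ^ 2 = (?X (inv \<sigma>) / \<kappa>) * (?X \<sigma> / \<kappa>)"
      unfolding 1[OF \<sigma>, symmetric] irr_char_eq[OF \<sigma>, symmetric] by (rule power2_eq_square)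
  qed
  also have "\<dots> = (\<Sum>\<sigma>\<in>Sym n. ?X (inv \<sigma>) * ?X \<sigma>) / \<kappa>^2"
  proof -
    have "(\<Sum>\<sigma>\<in>Sym n. (f \<sigma> / \<kappa>) * (g \<sigma> / \<kappa>)) = (\<Sum>\<sigma>\<in>Sym n. f \<sigma> * g \<sigma>) / \<kappa>^2" for f g
      by (simp add: sum_divide_distrib power2_eq_square)
    then show ?thesis .
  qed
  also have "(\<Sum>\<sigma>\<in>Sym n. ?X (inv \<sigma>) * ?X \<sigma>) = (\<Sum>u\<in>Sym n. \<kappa>^2)"
  proof -
    have "(\<Sum>\<sigma>\<in>Sym n. ?X (inv \<sigma>) * ?X \<sigma>) = (\<Sum>\<sigma>\<in>Sym n. \<Sum>u\<in>Sym n. c (inv u \<circ> inv \<sigma> \<circ> u) * ?X \<sigma>)"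
      by (simp add: sum_distrib_right)
    also have "\<dots> = (\<Sum>u\<in>Sym n. \<Sum>\<sigma>\<in>Sym n. c (inv u \<circ> inv \<sigma> \<circ> u) * ?X \<sigma>)"
      by (rule sum.swap)
    also have "\<dots> = (\<Sum>u\<in>Sym n. \<kappa>^2)"
    proof (intro sum.cong refl, clarify)
      fix u :: "nat \<Rightarrow> nat" assume u: "u permutes {..<n}"
      note ui = permutes_inv[OF u]
      have "(\<Sum>\<sigma>\<in>Sym n. c (inv u \<circ> inv \<sigma> \<circ> u) * ?X \<sigma>) =
          (\<Sum>\<sigma>\<in>Sym n. c (inv u \<circ> inv (u \<circ> \<sigma> \<circ> inv u) \<circ> u) * ?X (u \<circ> \<sigma> \<circ> inv u))"
        by (rule sum_Sym_conj[OF u, symmetric])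
      also have "\<dots> = (\<Sum>\<sigma>\<in>Sym n. c (inv \<sigma>) * ?X \<sigma>)"
      proof (intro sum.cong refl, clarify)
        fix \<sigma> :: "nat \<Rightarrow> nat" assume \<sigma>: "\<sigma> permutes {..<n}"
        have "inv u \<circ> inv (u \<circ> \<sigma> \<circ> inv u) \<circ> u = inv \<sigma>"
          using \<sigma> u ui by (simp add: inv_comp_perm[of _ "{..<n}"] permutes_compose permutes_inv_inv[OF u]
              comp_assoc comp_inv_cancel[OF u] permutes_inv_o[OF u])
        moreover have "?X (u \<circ> \<sigma> \<circ> inv u) = ?X \<sigma>"
        proof -
          have "?X (u \<circ> \<sigma> \<circ> inv u) = (\<Sum>w\<in>Sym n. c (inv (u \<circ> w) \<circ> (u \<circ> \<sigma> \<circ> inv u) \<circ> (u \<circ> w)))"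
            by (rule sum_Sym_left[OF u, symmetric])
          also have "\<dots> = ?X \<sigma>"
          proof (intro sum.cong refl, clarify)
            fix w :: "nat \<Rightarrow> nat" assume w: "w permutes {..<n}"
            show "c (inv (u \<circ> w) \<circ> (u \<circ> \<sigma> \<circ> inv u) \<circ> (u \<circ> w)) = c (inv w \<circ> \<sigma> \<circ> w)"
              by (simp add: inv_comp_perm[OF u w] comp_assoc comp_inv_cancel[OF u])
          qed
          finally show ?thesis .
        qed
        ultimately show "c (inv u \<circ> inv (u \<circ> \<sigma> \<circ> inv u) \<circ> u) * ?X (u \<circ> \<sigma> \<circ> inv u) = c (inv \<sigma>) * ?X \<sigma>"
          by simp
      qed
      also have "\<dots> = (\<Sum>\<sigma>\<in>Sym n. c (inv (inv \<sigma>)) * ?X (inv \<sigma>))"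
        by (rule sum_Sym_inv[symmetric])
      also have "\<dots> = (\<Sum>\<sigma>\<in>Sym n. \<Sum>w\<in>Sym n. c \<sigma> * c (inv w \<circ> inv \<sigma> \<circ> w))"
        by (intro sum.cong refl) (simp add: sum_distrib_left permutes_inv_inv)
      also have "\<dots> = (\<Sum>w\<in>Sym n. \<Sum>\<sigma>\<in>Sym n. c \<sigma> * c (inv w \<circ> inv \<sigma> \<circ> w))"
        by (rule sum.swap)
      \<comment> \<open>This is \<open>c_convolution\<close> with h the inverse of w and x = w; the
        remaining sum over w is again \<kappa>.\<close>
      also have "\<dots> = (\<Sum>w\<in>Sym n. \<kappa> * (c w * c (inv w)))"
        by (intro sum.cong refl) (simp add: c_convolution permutes_inv)
      also have "\<dots> = \<kappa>^2"
        by (simp add: power2_eq_square \<kappa>_def flip: sum_distrib_left)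
      finally show "(\<Sum>\<sigma>\<in>Sym n. c (inv u \<circ> inv \<sigma> \<circ> u) * ?X \<sigma>) = \<kappa>^2" .
    qed
    finally show ?thesis .
  qed
  finally show ?thesis using \<kappa>_nonzero by (simp add: card_permutations)
qed

text \<open>The trivial character of the row stabilizer occurs exactly once in the Specht module,
  which by reciprocity gives inner product 1 with the class function of \<open>h_\<mu>\<close>.
  Averaging c over row permutations keeps the symmetry in the last argument, so
  \<open>equivariant_unique\<close> splits off \<open>c u\<close> and \<open>c_convolution\<close>
  finishes.\<close>

lemma sum_irr_char_row_stabilizer: "(\<Sum>p\<in>R. irr_char \<mu> p) = of_nat (card R)"
proof -
  have "(\<Sum>p\<in>R. irr_char \<mu> p) = (\<Sum>p\<in>R. \<Sum>u\<in>Sym n. c (inv u \<circ> inv p \<circ> u)) / \<kappa>"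
    unfolding sum_divide_distrib[symmetric]
    by (simp add: irr_char_eq R_perm sum_divide_distrib)
  also have "(\<Sum>p\<in>R. \<Sum>u\<in>Sym n. c (inv u \<circ> inv p \<circ> u)) = (\<Sum>p\<in>R. \<Sum>u\<in>Sym n. c (inv u \<circ> p \<circ> u))"
    by (rule sum.reindex_bij_witness[of _ inv inv]) (auto simp: R_inv permutes_inv_inv[OF R_perm])
  also have "\<dots> = (\<Sum>u\<in>Sym n. \<Sum>p\<in>R. c (inv u \<circ> p \<circ> u))"
    by (rule sum.swap)
  also have "\<dots> = (\<Sum>u\<in>Sym n. \<Sum>p\<in>R. c (inv u \<circ> p) * c u)"
  proof (rule sum.cong[OF refl], clarify)
    fix u :: "nat \<Rightarrow> nat" assume u: "u permutes {..<n}"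
    have "(\<Sum>p\<in>R. c (inv u \<circ> p \<circ> u)) = (\<Sum>p\<in>R. c (inv u \<circ> p \<circ> id)) * c u"
    proof (rule equivariant_unique[OF u, of "\<lambda>y. \<Sum>p\<in>R. c (inv u \<circ> p \<circ> y)"])
      fix p g assume p: "p \<in> R"
      show "(\<Sum>p'\<in>R. c (inv u \<circ> p' \<circ> (p \<circ> g))) = (\<Sum>p'\<in>R. c (inv u \<circ> p' \<circ> g))"
        by (rule sum.reindex_bij_witness[of _ "\<lambda>p'. p' \<circ> inv p" "\<lambda>p'. p' \<circ> p"])
          (use p R_comp R_inv comp_inv_cancel[OF R_perm[OF p]] in \<open>auto simp: comp_assoc\<close>)
    next
      fix q g assume q: "q \<in> C"
      show "(\<Sum>p\<in>R. c (inv u \<circ> p \<circ> (g \<circ> q))) = of_int (sign q) * (\<Sum>p\<in>R. c (inv u \<circ> p \<circ> g))"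
        using c_right[OF q] by (simp add: sum_distrib_left flip: comp_assoc)
    qed
    then show "(\<Sum>p\<in>R. c (inv u \<circ> p \<circ> u)) = (\<Sum>p\<in>R. c (inv u \<circ> p) * c u)"
      by (simp add: sum_distrib_right)
  qed
  also have "\<dots> = (\<Sum>p\<in>R. \<Sum>u\<in>Sym n. c u * c (id \<circ> inv u \<circ> p))"
    by (subst sum.swap) (simp add: mult.commute)
  also have "\<dots> = (\<Sum>p\<in>R. \<kappa>)"
  proof (intro sum.cong refl)
    fix p assume p: "p \<in> R"
    have "c p = 1" using c_left[OF p, of id] by (simp add: c_id)
    then show "(\<Sum>u\<in>Sym n. c u * c (id \<circ> inv u \<circ> p)) = \<kappa>"
      using c_convolution[OF permutes_id R_perm[OF p]] by (simp add: c_id)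
  qed
  finally show ?thesis using \<kappa>_nonzero by simp
qed

text \<open>By the column argument, every u puts two entries of one column of \<mu> into a common
  row of \<nu>. Their transposition is a column permutation on one side and, conjugated by u, an
  element of the Young subgroup on the other, so the inner sum equals its own negative.\<close>

lemma sum_irr_char_young_eq_0:
  assumes sum: "sum_list \<nu> = n" and less: "row_weight \<nu> < row_weight \<mu>"
  shows "(\<Sum>p\<in>row_stabilizer \<nu>. irr_char \<mu> p) = 0"
proof -
  let ?Y = "row_stabilizer \<nu>"
  have Yp: "p permutes {..<n}" if "p \<in> ?Y" for p using that sum by (simp add: row_stabilizer_def)
  have "(\<Sum>p\<in>?Y. irr_char \<mu> p) = (\<Sum>p\<in>?Y. \<Sum>u\<in>Sym n. c (inv u \<circ> inv p \<circ> u)) / \<kappa>"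
    by (simp add: irr_char_eq Yp sum_divide_distrib)
  also have "(\<Sum>p\<in>?Y. \<Sum>u\<in>Sym n. c (inv u \<circ> inv p \<circ> u)) = (\<Sum>u\<in>Sym n. \<Sum>p\<in>?Y. c (inv u \<circ> inv p \<circ> u))"
    by (rule sum.swap)
  also have "\<dots> = 0"
  proof (rule sum.neutral, rule ballI, clarify)
    fix u :: "nat \<Rightarrow> nat" assume u: "u permutes {..<n}"
    have "\<not> inj_on (\<lambda>k. (cell_row \<nu> (u k), cell_col \<mu> k)) {..<n}"
    proof
      assume "inj_on (\<lambda>k. (cell_row \<nu> (u k), cell_col \<mu> k)) {..<n}"
      then have "row_weight \<mu> \<le> (\<Sum>k<n. cell_row \<nu> (u k))"
        using column_injective(1)[OF sorted_shape, of "\<lambda>k. cell_row \<nu> (u k)"] unfolding n_def by simp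
      also have "\<dots> = (\<Sum>k<n. cell_row \<nu> k)"
        using sum.permute[OF u, of "cell_row \<nu>"] by (simp add: comp_def)
      also have "\<dots> = row_weight \<nu>" using sum_row[of \<nu>] sum by simp
      finally show False using less by simp
    qed
    then obtain x y where xy: "x < n" "y < n" "x \<noteq> y" "cell_row \<nu> (u x) = cell_row \<nu> (u y)" "cell_col \<mu> x = cell_col \<mu> y"
      by (auto simp: inj_on_def)
    let ?t = "transpose x y" and ?s = "transpose (u x) (u y)"
    have uxy: "u x < n" "u y < n" using xy permutes_in_image[OF u] by auto
    have t: "?t \<in> C" using xy by (intro transposition_in_C)
    have sgn: "sign ?t = -1" using xy by (simp add: sign_swap_id)
    note st = transpose_comp_perm[OF u, of x y]
    have sp: "?s permutes {..<n}" using uxy by (intro permutes_swap_id) auto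
    have s: "cell_row \<nu> (?s k) = cell_row \<nu> k" for k using xy(4) by (simp add: transpose_def)
    have sY: "?s \<circ> p \<in> ?Y" if "p \<in> ?Y" for p
      using that sp Yp[OF that] s sum by (auto simp: row_stabilizer_def intro: permutes_compose)
    have ss: "?s \<circ> (?s \<circ> p) = p" for p :: "nat \<Rightarrow> nat" by (simp add: fun_eq_iff)
    have "(\<Sum>p\<in>?Y. c (inv u \<circ> inv p \<circ> u)) = (\<Sum>p\<in>?Y. c (inv u \<circ> inv (?s \<circ> p) \<circ> u))"
      by (rule sum.reindex_bij_witness[of _ "\<lambda>p. ?s \<circ> p" "\<lambda>p. ?s \<circ> p"]) (auto simp: ss sY simp del: o_apply)
    also have "\<dots> = (\<Sum>p\<in>?Y. - c (inv u \<circ> inv p \<circ> u))"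
    proof (intro sum.cong refl)
      fix p assume p: "p \<in> ?Y"
      have "inv (?s \<circ> p) = inv p \<circ> ?s" by (simp add: inv_comp_perm[OF sp Yp[OF p]])
      then have "inv u \<circ> inv (?s \<circ> p) \<circ> u = (inv u \<circ> inv p \<circ> u) \<circ> ?t"
        using st by (simp add: comp_assoc)
      then show "c (inv u \<circ> inv (?s \<circ> p) \<circ> u) = - c (inv u \<circ> inv p \<circ> u)"
        using c_right[OF t, of "inv u \<circ> inv p \<circ> u"] sgn by simp
    qed
    also have "\<dots> = - (\<Sum>p\<in>?Y. c (inv u \<circ> inv p \<circ> u))" by (simp add: sum_negf)
    finally show "(\<Sum>p\<in>?Y. c (inv u \<circ> inv p \<circ> u)) = 0" by simp
  qed
  finally show ?thesis by simp
qed

end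

section \<open>Specht characters are the class functions of Schur functions\<close>

lemma hall_complete_complete_prod: "sum_list \<kappa> = n \<Longrightarrow> hall n (complete n) (complete_prod \<kappa>) = 1"
proof (induction \<kappa> arbitrary: n)
  case Nil
  then show ?case using hall_power_sums[of 0 1 "{#}"] by (simp add: Poly_Mapping.lookup_one)
next
  case (Cons a \<kappa>)
  then show ?case by (auto simp: hall_complete_mult skew_h_complete)
qed

lemma sum_power_sums_row_stabilizer:
  fixes \<kappa> :: "nat list"
  defines "n \<equiv> sum_list \<kappa>"
  shows "(\<Sum>p\<in>row_stabilizer \<kappa>. power_sums (cycle_type p {..<n})) = const (of_nat (card (row_stabilizer \<kappa>))) * complete_prod \<kappa>"
proof -
  let ?Y = "row_stabilizer \<kappa>"
  define d :: complex where "d = (\<Prod>i<length \<kappa>. fact (\<kappa> ! i))"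
  have "(\<Sum>p\<in>?Y. power_sums (cycle_type p {..<n})) =
      (\<Prod>i<length \<kappa>. const (fact (card {x\<in>{..<n}. cell_row \<kappa> x = i})) * complete (card {x\<in>{..<n}. cell_row \<kappa> x = i}))"
    unfolding row_stabilizer_alt n_def
    by (rule sum_power_sums_young) (use row_less in auto)
  also have "\<dots> = (\<Prod>i<length \<kappa>. const (fact (\<kappa> ! i)) * complete (\<kappa> ! i))"
    by (intro prod.cong refl) (use card_row[of _ \<kappa>] in \<open>simp add: n_def\<close>)
  also have "\<dots> = const d * (\<Prod>i<length \<kappa>. complete (\<kappa> ! i))"
  proof -
    have "(\<Prod>i\<in>I. const (f i)) = const (\<Prod>i\<in>I. f i)" for f :: "nat \<Rightarrow> complex" and I
      by (induction I rule: infinite_finite_induct) (simp_all add: mult_single)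
    then show ?thesis by (simp add: prod.distrib d_def)
  qed
  also have "(\<Prod>i<length \<kappa>. complete (\<kappa> ! i)) = complete_prod \<kappa>"
    by (induction \<kappa>) (simp_all add: prod.lessThan_Suc_shift del: prod.lessThan_Suc)
  finally have eq: "(\<Sum>p\<in>?Y. power_sums (cycle_type p {..<n})) = const d * complete_prod \<kappa>" .
  \<comment> \<open>Pairing with h_n sends every p_M and every product of complete functions of
    degree n to 1, which identifies the product of factorials with the order of the
    subgroup.\<close>
  have "hall n (complete n) (\<Sum>p\<in>?Y. power_sums (cycle_type p {..<n})) = (\<Sum>p\<in>?Y. 1)"
    unfolding hall_sum
  proof (rule sum.cong[OF refl])
    fix p assume "p \<in> ?Y"
    then have "type_size (cycle_type p {..<n}) = n" using type_size_cycle_type[of p "{..<n}"] by (simp add: row_stabilizer_def n_def)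
    then show "hall n (complete n) (power_sums (cycle_type p {..<n})) = 1" by (simp add: hall_power_sums lookup_complete)
  qed
  moreover have "hall n (complete n) (const d * complete_prod \<kappa>) = d"
    using hall_complete_complete_prod[of \<kappa> n] by (simp add: n_def)
  ultimately have "d = of_nat (card ?Y)" unfolding eq by simp
  then show ?thesis using eq by simp
qed

lemma irr_char_eq_class_value_schur:
  assumes \<mu>: "\<mu> \<in> partitions n" and \<sigma>: "\<sigma> permutes {..<n}"
  shows "irr_char \<mu> \<sigma> = class_value (cycle_type \<sigma> {..<n}) (schur \<mu>)"
proof -
  interpret young \<mu> using \<mu> by unfold_locales (simp add: partitions_def)
  have n: "young.n \<mu> = n" using \<mu> by (simp add: n_def partitions_def)
  note facts = irr_char_Reals[unfolded n] irr_char_cycle_type[unfolded n] irr_char_norm[unfolded n]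
    sum_irr_char_row_stabilizer[unfolded n] sum_irr_char_young_eq_0[unfolded n]
  have sum\<mu>: "sum_list \<mu> = n" using \<mu> by (simp add: partitions_def)
  \<comment> \<open>\<open>X F\<close> is n! times the inner product of the Specht character with
    the class function of \<open>F\<close>.\<close>
  define X where "X F = (\<Sum>\<sigma>\<in>Sym n. irr_char \<mu> \<sigma> * class_value (cycle_type \<sigma> {..<n}) F)" for F
  have X_add: "X (F + G) = X F + X G" and X_diff: "X (F - G) = X F - X G" and X_0: "X 0 = 0" for F G
    by (simp_all add: X_def algebra_simps sum.distrib sum_subtractf)
  have X_const: "X (const k * F) = k * X F" for F k
    by (simp add: X_def sum_distrib_left mult.left_commute)
  have X_sum: "X (sum f A) = (\<Sum>x\<in>A. X (f x))" for f :: "(nat \<Rightarrow> nat) \<Rightarrow> symfun" and A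
    by (induction A rule: infinite_finite_induct) (auto simp: X_add X_0)
  have X_power_sums: "X (power_sums (cycle_type p {..<n})) = fact n * irr_char \<mu> p" if p: "p permutes {..<n}" for p
  proof -
    let ?M = "cycle_type p {..<n}"
    have "X (power_sums ?M) = (\<Sum>\<sigma>\<in>Sym n. irr_char \<mu> p * (if cycle_type \<sigma> {..<n} = ?M then of_nat (cent_order ?M) else 0))"
      unfolding X_def
    proof (rule sum.cong[OF refl], clarify)
      fix \<sigma> :: "nat \<Rightarrow> nat" assume "\<sigma> permutes {..<n}"
      then show "irr_char \<mu> \<sigma> * class_value (cycle_type \<sigma> {..<n}) (power_sums ?M) =
          irr_char \<mu> p * (if cycle_type \<sigma> {..<n} = ?M then of_nat (cent_order ?M) else 0)"
        using facts(2)[of \<sigma> p] p by (auto simp: class_value_def power_sums_def Poly_Mapping.lookup_single when_def)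
    qed
    also have "\<dots> = irr_char \<mu> p * (\<Sum>\<sigma>\<in>Sym n. if cycle_type \<sigma> {..<n} = ?M then of_nat (cent_order ?M) else 0)"
      by (simp add: sum_distrib_left)
    also have "(\<Sum>\<sigma>\<in>Sym n. if cycle_type \<sigma> {..<n} = ?M then of_nat (cent_order ?M) else 0) =
        fact n * (\<Sum>N | type_size N = n. (if N = ?M then of_nat (cent_order ?M) else 0) / of_nat (cent_order N) :: complex)"
      using sum_cycle_type[of "{..<n}" "\<lambda>N. if N = ?M then of_nat (cent_order ?M) else 0"] by simp
    also have "(\<Sum>N | type_size N = n. (if N = ?M then of_nat (cent_order ?M) else 0) / of_nat (cent_order N) :: complex) =
        (\<Sum>N | type_size N = n. if N = ?M then 1 else 0)"
      by (intro sum.cong) auto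
    also have "\<dots> = 1" using type_size_cycle_type[OF p] by (simp add: finite_type_size)
    finally show ?thesis by simp
  qed
  have X_complete_prod: "of_nat (card (row_stabilizer \<kappa>')) * X (complete_prod \<kappa>') = fact n * (\<Sum>p\<in>row_stabilizer \<kappa>'. irr_char \<mu> p)"
    if "sum_list \<kappa>' = n" for \<kappa>'
  proof -
    have "of_nat (card (row_stabilizer \<kappa>')) * X (complete_prod \<kappa>') = X (\<Sum>p\<in>row_stabilizer \<kappa>'. power_sums (cycle_type p {..<n}))"
      by (simp only: sum_power_sums_row_stabilizer[of \<kappa>', unfolded that] X_const)
    also have "\<dots> = (\<Sum>p\<in>row_stabilizer \<kappa>'. X (power_sums (cycle_type p {..<n})))"
      by (rule X_sum)
    also have "\<dots> = (\<Sum>p\<in>row_stabilizer \<kappa>'. fact n * irr_char \<mu> p)"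
      using that by (intro sum.cong refl X_power_sums) (simp add: row_stabilizer_def)
    finally show ?thesis by (simp add: sum_distrib_left)
  qed
  have card_pos: "card (row_stabilizer \<kappa>') \<noteq> 0" for \<kappa>'
  proof -
    have "finite (row_stabilizer \<kappa>')"
      by (rule finite_subset[OF _ finite_Sym[of "sum_list \<kappa>'"]]) (auto simp: row_stabilizer_def)
    moreover have "id \<in> row_stabilizer \<kappa>'" by (simp add: row_stabilizer_def permutes_id)
    ultimately show ?thesis by auto
  qed
  \<comment> \<open>The functions orthogonal to the character form a subgroup containing all lower
    products, so \<open>s_\<mu>\<close> and \<open>h_\<mu>\<close> have the same inner product with
    it.\<close>
  have "schur \<mu> - complete_prod \<mu> \<in> {F. X F = 0}"
  proof (rule schur_expansion)
    show "additive_subgroup {F. X F = 0}" by (auto simp: additive_subgroup_def X_add X_diff X_0)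
    fix \<kappa>' assume k: "sum_list \<kappa>' = sum_list \<mu>" "row_weight \<kappa>' < row_weight \<mu>"
    then show "complete_prod \<kappa>' \<in> {F. X F = 0}"
      using X_complete_prod[of \<kappa>'] facts(5)[of \<kappa>'] sum\<mu> card_pos[of \<kappa>'] by simp
  qed
  moreover have "X (complete_prod \<mu>) = fact n"
    using X_complete_prod[OF sum\<mu>] card_pos[of \<mu>] facts(4) by simp
  ultimately have Xs: "X (schur \<mu>) = fact n" by (simp add: X_diff)
  let ?\<psi> = "\<lambda>\<sigma>. class_value (cycle_type \<sigma> {..<n}) (schur \<mu>)"
  have norm: "(\<Sum>\<sigma>\<in>Sym n. ?\<psi> \<sigma> ^ 2) = fact n"
  proof -
    have "(\<Sum>\<sigma>\<in>Sym n. ?\<psi> \<sigma> ^ 2) = fact n * (\<Sum>M | type_size M = n. class_value M (schur \<mu>) ^ 2 / of_nat (cent_order M))"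
      using sum_cycle_type[of "{..<n}" "\<lambda>M. class_value M (schur \<mu>) ^ 2"] by simp
    also have "(\<Sum>M | type_size M = n. class_value M (schur \<mu>) ^ 2 / of_nat (cent_order M)) = hall n (schur \<mu>) (schur \<mu>)"
      unfolding hall_def by (intro sum.cong refl) (simp add: class_value_def power2_eq_square)
    finally show ?thesis using hall_schur[OF \<mu> \<mu>] by simp
  qed
  define D where "D \<tau> = irr_char \<mu> \<tau> - ?\<psi> \<tau>" for \<tau>
  have "(\<Sum>\<tau>\<in>Sym n. D \<tau> ^ 2) =
      (\<Sum>\<tau>\<in>Sym n. irr_char \<mu> \<tau> ^ 2) - 2 * X (schur \<mu>) + (\<Sum>\<tau>\<in>Sym n. ?\<psi> \<tau> ^ 2)"
    by (simp add: D_def X_def power2_diff sum.distrib sum_subtractf sum_distrib_left mult.assoc)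
  then have "(\<Sum>\<tau>\<in>Sym n. D \<tau> ^ 2) = 0" unfolding Xs norm facts(3) by simp
  \<comment> \<open>A vanishing sum of complex squares says nothing by itself; each term vanishes
    only because \<open>D\<close> is real.\<close>
  moreover have D_real: "D \<tau> = of_real (Re (D \<tau>))" if "\<tau> permutes {..<n}" for \<tau>
  proof -
    have "?\<psi> \<tau> \<in> \<real>" using class_value_schur_Ints[of "cycle_type \<tau> {..<n}" \<mu>] by (auto elim!: Ints_cases)
    then have "D \<tau> \<in> \<real>" unfolding D_def using facts(1)[OF that] by (rule Reals_diff[rotated])
    then show ?thesis by (simp add: of_real_Re)
  qed
  moreover have "(\<Sum>\<tau>\<in>Sym n. D \<tau> ^ 2) = of_real (\<Sum>\<tau>\<in>Sym n. Re (D \<tau>) ^ 2)"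
    unfolding of_real_sum
  proof (rule sum.cong[OF refl], clarify)
    fix \<tau> :: "nat \<Rightarrow> nat" assume "\<tau> permutes {..<n}"
    then show "D \<tau> ^ 2 = of_real (Re (D \<tau>) ^ 2)" by (metis D_real of_real_power)
  qed
  ultimately have "(\<Sum>\<tau>\<in>Sym n. Re (D \<tau>) ^ 2) = 0" by (metis of_real_eq_0_iff)
  then have "Re (D \<sigma>) ^ 2 = 0"
    using \<sigma> by (subst (asm) sum_nonneg_eq_0_iff) (auto simp: finite_Sym)
  then have "D \<sigma> = 0" using D_real[OF \<sigma>] by simp
  then show ?thesis by (simp add: D_def)
qed

text \<open>The chosen permutation is only known to have t cycles of length j. These already fill
  all tj points, so its cycle type is determined.\<close>

lemma irr_char_rect_eq:
  assumes \<nu>: "\<nu> \<in> partitions (t * j)" and j: "j \<ge> 1"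
  shows "irr_char_rect \<nu> j t = class_value (replicate_mset t (j - 1)) (schur \<nu>)"
proof -
  let ?M = "replicate_mset t (j - 1)" and ?P = "\<lambda>\<tau>. \<tau> permutes {..<t * j} \<and> num_cycles j (t * j) \<tau> = t"
  have wtM: "type_size ?M = t * j" using j by (induction t) auto
  obtain \<tau> where "\<tau> permutes {..<t * j}" "cycle_type \<tau> {..<t * j} = ?M"
    using exists_cycle_type[of "{..<t * j}" ?M] wtM by auto
  then have "?P \<tau>" using j by (simp add: num_cycles_conv_cycle_type)
  then have P: "?P (SOME \<tau>. ?P \<tau>)" by (rule someI[of ?P])
  define \<rho> where "\<rho> = (SOME \<tau>. ?P \<tau>)"
  have \<rho>: "\<rho> permutes {..<t * j}" "count (cycle_type \<rho> {..<t * j}) (j - 1) = t"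
    using P j num_cycles_conv_cycle_type[of \<rho> "t * j" j] by (simp_all add: \<rho>_def)
  have "?M \<subseteq># cycle_type \<rho> {..<t * j}" using \<rho>(2) by (simp add: count_le_replicate_mset_subset_eq flip: count_le_replicate_mset_subset_eq)
  then obtain K where K: "cycle_type \<rho> {..<t * j} = ?M + K" by (metis subset_mset.add_diff_inverse)
  then have "type_size K = 0" using type_size_cycle_type[OF \<rho>(1)] wtM by simp
  then have "K = {#}" by (cases K) auto
  then show ?thesis
    unfolding irr_char_rect_def \<rho>_def[symmetric] using irr_char_eq_class_value_schur[OF \<nu> \<rho>(1)] K by simp
qed

section \<open>Class functions of powers of a power sum, and inversion formulas\<close>

lemma class_value_power_sum_mult: "class_value M (power_sum i * F) = of_nat (Suc i * count M i) * class_value (M - {#i#}) F"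
proof (cases "i \<in># M")
  case True
  then obtain N where "M = add_mset i N" by (metis insert_DiffM)
  then show ?thesis by (simp add: class_value_def lookup_power_sum_mult cent_order_add_mset del: of_nat_Suc mult_Suc mult_Suc_right)
next
  case False
  then have "count M i = 0" by (simp add: not_in_iff)
  then show ?thesis using False by (simp add: class_value_def lookup_power_sum_mult)
qed

text \<open>Each factor p_j removes one j-cycle at the cost of a factor j times the number of
  j-cycles still present, which builds up the falling factorial.\<close>

lemma class_value_power_sum_power_mult:
  "class_value M (power_sum i ^ s * F) = of_nat (Suc i ^ s * (\<Prod>k<s. count M i - k)) * class_value (M - replicate_mset s i) F"
proof (induction s arbitrary: M)
  case (Suc s)
  have "class_value M (power_sum i ^ Suc s * F) = of_nat (Suc i * count M i) * class_value (M - {#i#}) (power_sum i ^ s * F)"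
    by (simp add: class_value_power_sum_mult mult.assoc)
  also have "class_value (M - {#i#}) (power_sum i ^ s * F) =
      of_nat (Suc i ^ s * (\<Prod>k<s. count M i - 1 - k)) * class_value (M - {#i#} - replicate_mset s i) F"
    by (simp add: Suc)
  also have "(\<Prod>k<s. count M i - 1 - k) = (\<Prod>k<s. count M i - Suc k)" by simp
  also have "M - {#i#} - replicate_mset s i = M - replicate_mset (Suc s) i" by simp
  finally show ?case
    by (simp only: prod.lessThan_Suc_shift of_nat_mult power_Suc mult_ac comp_def diff_zero)
qed simp

lemma class_value_power_sum_power_complete:
  assumes "type_size M = n"
  shows "class_value M (power_sum i ^ s * complete (n - s * Suc i)) = of_nat (Suc i ^ s * (\<Prod>k<s. count M i - k))"
proof (cases "s \<le> count M i")
  case True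
  then have "replicate_mset s i \<subseteq># M" by (simp add: count_le_replicate_mset_subset_eq)
  moreover have "type_size (replicate_mset s i) = s * Suc i" by (induction s) auto
  ultimately have "type_size (M - replicate_mset s i) = n - s * Suc i" using assms by (simp add: type_size_diff)
  then show ?thesis unfolding class_value_power_sum_power_mult by (simp add: class_value_def lookup_complete)
next
  case False
  \<comment> \<open>The factor with k = \<open>count M i\<close> is 0. This case contains every s
    for which the subtraction n - s(i + 1) is truncated.\<close>
  then have "(\<Prod>k<s. count M i - k) = 0" by (auto intro!: bexI[of _ "count M i"])
  then show ?thesis by (simp add: class_value_power_sum_power_mult)
qed

lemma bernstein_monom: "bernstein N (monom c k) = c * complete (N + k)"
  using bernstein_monom_mult[of N c k 1] by simp

lemma class_value_bernstein_power_sum_power: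
  assumes M: "type_size M = n" and t: "t * Suc i \<le> n"
  shows "class_value M (bernstein (n - t * Suc i) (shift (-1) (power_sum i ^ t))) =
    (\<Sum>s\<le>t. of_nat (t choose s) * (-1) ^ (t - s) * of_nat (Suc i ^ s * (\<Prod>k<s. count M i - k)))"
proof -
  let ?N = "n - t * Suc i"
  have "shift (-1) (power_sum i ^ t) = (\<Sum>s\<le>t. of_nat (t choose s) * [:power_sum i:] ^ s * monom (-1) (Suc i) ^ (t - s))"
    by (simp only: shift_power shift_power_sum binomial_ring)
  also have "\<dots> = (\<Sum>s\<le>t. smult (of_nat (t choose s) * power_sum i ^ s) (monom ((-1) ^ (t - s)) (Suc i * (t - s))))"
    by (intro sum.cong refl) (simp add: poly_const_pow of_nat_poly monom_power mult_ac del: mult_Suc)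
  finally have "bernstein ?N (shift (-1) (power_sum i ^ t)) =
      (\<Sum>s\<le>t. (-1) ^ (t - s) * (complete (?N + Suc i * (t - s)) * (of_nat (t choose s) * power_sum i ^ s)))"
    by (simp add: bernstein_sum bernstein_monom mult_ac del: mult_Suc mult_Suc_right)
  also have "\<dots> = (\<Sum>s\<le>t. const (of_nat (t choose s) * (-1) ^ (t - s)) * (power_sum i ^ s * complete (n - s * Suc i)))"
  proof (intro sum.cong refl)
    fix s assume "s \<in> {..t}"
    then have "s * Suc i \<le> t * Suc i" by (intro mult_right_mono) auto
    \<comment> \<open>The t - s factors -u^j raise the index of the complete function from n - tj to
      n - sj.\<close>
    then have 1: "?N + Suc i * (t - s) = n - s * Suc i"
      using t by (simp add: diff_mult_distrib2 mult.commute del: mult_Suc mult_Suc_right)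
    have cpow: "(-1 :: symfun) ^ k = const ((-1) ^ k)" for k
    proof (induction k)
      case (Suc k)
      then show ?case by (simp add: single_uminus)
    qed simp
    have "const (of_nat (t choose s) * (-1) ^ (t - s)) = of_nat (t choose s) * (-1) ^ (t - s)"
      unfolding const_mult cpow by simp
    then show "(-1) ^ (t - s) * (complete (?N + Suc i * (t - s)) * (of_nat (t choose s) * power_sum i ^ s)) =
        const (of_nat (t choose s) * (-1) ^ (t - s)) * (power_sum i ^ s * complete (n - s * Suc i))"
      unfolding 1 by (simp only: mult_ac)
  qed
  finally show ?thesis
    using class_value_power_sum_power_complete[OF M] by (simp only: class_value_sum class_value_const)
qed

lemma sum_triangle_swap:
  fixes a :: nat
  shows "(\<Sum>t\<le>a. \<Sum>s\<le>t. f t s) = (\<Sum>s\<le>a. \<Sum>t=s..a. f t s)"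
proof -
  have "(\<Sum>t\<le>a. \<Sum>s\<le>t. f t s) = (\<Sum>(t, s)\<in>(SIGMA t:{..a}. {..t}). f t s)"
    by (simp add: sum.Sigma)
  also have "\<dots> = (\<Sum>(s, t)\<in>(SIGMA s:{..a}. {s..a}). f t s)"
    by (rule sum.reindex_bij_witness[of _ "\<lambda>(s, t). (t, s)" "\<lambda>(t, s). (s, t)"]) auto
  also have "\<dots> = (\<Sum>s\<le>a. \<Sum>t=s..a. f t s)"
    by (simp add: sum.Sigma)
  finally show ?thesis .
qed

text \<open>By (a choose t)(t choose s) = (a choose s)(a-s choose t-s), the coefficient of
  \<open>V s\<close> is an alternating row sum of binomials, which vanishes unless s = a.\<close>

lemma binomial_inversion:
  fixes V :: "nat \<Rightarrow> 'a::comm_ring_1"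
  shows "(\<Sum>t\<le>a. of_nat (a choose t) * (\<Sum>s\<le>t. of_nat (t choose s) * (-1) ^ (t - s) * V s)) = V a"
proof -
  have "(\<Sum>t\<le>a. of_nat (a choose t) * (\<Sum>s\<le>t. of_nat (t choose s) * (-1) ^ (t - s) * V s)) =
      (\<Sum>t\<le>a. \<Sum>s\<le>t. of_nat ((a choose t) * (t choose s)) * (-1) ^ (t - s) * V s)"
    by (simp add: sum_distrib_left mult.assoc)
  also have "\<dots> = (\<Sum>s\<le>a. \<Sum>t\<in>{s..a}. of_nat ((a choose t) * (t choose s)) * (-1) ^ (t - s) * V s)"
    by (rule sum_triangle_swap)
  also have "\<dots> = (\<Sum>s\<le>a. if s = a then V a else 0)"
  proof (rule sum.cong[OF refl])
    fix s assume s: "s \<in> {..a}"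
    have "(\<Sum>t\<in>{s..a}. of_nat ((a choose t) * (t choose s)) * (-1) ^ (t - s) * V s) =
        (\<Sum>k\<le>a - s. of_nat (a choose s) * V s * ((-1) ^ k * of_nat ((a - s) choose k)))"
    proof (rule sum.reindex_bij_witness[of _ "\<lambda>k. k + s" "\<lambda>t. t - s"], goal_cases)
      case (5 t)
      then show ?case using choose_mult[of s t a] by (simp add: mult_ac)
    qed (use s in auto)
    also have "\<dots> = of_nat (a choose s) * V s * (\<Sum>k\<le>a - s. (-1) ^ k * of_nat ((a - s) choose k))"
      by (simp add: sum_distrib_left)
    also have "\<dots> = (if s = a then V a else 0)"
      using choose_alternating_sum[where 'a = 'a, of "a - s"] s by (cases "s = a") auto
    finally show "(\<Sum>t\<in>{s..a}. of_nat ((a choose t) * (t choose s)) * (-1) ^ (t - s) * V s) = (if s = a then V a else 0)" .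
  qed
  finally show ?thesis by simp
qed

text \<open>The product is the falling factorial even for k > a, where truncated subtraction
  produces a factor 0. Multiplying it by a = (a - k) + k reproduces the recurrence of the Stirling
  numbers.\<close>

lemma power_eq_sum_Stirling:
  fixes a :: nat
  shows "a ^ r = (\<Sum>k\<le>r. Stirling r k * (\<Prod>i<k. a - i))"
proof (induction r)
  case (Suc r)
  let ?f = "\<lambda>k. \<Prod>i<k. a - i"
  have step: "a * ?f k = ?f (Suc k) + k * ?f k" for k
  proof (cases "k \<le> a")
    case True
    then have "a * ?f k = ((a - k) + k) * ?f k" by simp
    then show ?thesis by (simp only: distrib_right prod.lessThan_Suc mult.commute)
  next
    case False
    then have 0: "?f k = 0" by (auto intro!: bexI[of _ a])
    show ?thesis unfolding prod.lessThan_Suc 0 by simp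
  qed
  have "a ^ Suc r = (\<Sum>k\<le>r. Stirling r k * (a * ?f k))"
    by (simp add: Suc sum_distrib_left mult.left_commute[of a])
  also have "\<dots> = (\<Sum>k\<le>r. Stirling r k * (?f (Suc k) + k * ?f k))"
    by (simp only: step)
  also have "\<dots> = (\<Sum>k\<le>r. Stirling r k * ?f (Suc k)) + (\<Sum>k\<le>r. k * Stirling r k * ?f k)"
    by (simp add: algebra_simps sum.distrib)
  also have "(\<Sum>k\<le>r. k * Stirling r k * ?f k) = (\<Sum>k\<le>Suc r. k * Stirling r k * ?f k)"
    by simp
  also have "\<dots> = (\<Sum>k\<le>r. Suc k * Stirling r (Suc k) * ?f (Suc k))"
    by (subst sum.atMost_Suc_shift) simp
  also have "(\<Sum>k\<le>r. Stirling r k * ?f (Suc k)) + \<dots> = (\<Sum>k\<le>r. Stirling (Suc r) (Suc k) * ?f (Suc k))"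
    by (simp add: sum.distrib[symmetric] algebra_simps)
  also have "\<dots> = (\<Sum>k\<le>Suc r. Stirling (Suc r) k * ?f k)"
    by (subst sum.atMost_Suc_shift) simp
  finally show ?case .
qed simp

section \<open>The multiplicities and the final summation\<close>

lemma cycle_mult_eq:
  assumes "tl \<mu> \<in> partitions (t * j)" "t \<le> r" "j \<ge> 1"
  shows "cycle_mult j r \<mu> = class_value (replicate_mset t (j - 1)) (schur (tl \<mu>)) *
    (\<Sum>a=t..r. of_nat (Stirling r a * (a choose t) * j ^ (r - a)))"
proof -
  have "(THE t. tl \<mu> \<in> partitions (t * j)) = t"
  proof (rule the_equality)
    fix t' assume "tl \<mu> \<in> partitions (t' * j)"
    then have "t' * j = t * j" using assms(1) by (simp add: partitions_def)
    then show "t' = t" using assms(3) by simp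
  qed (rule assms)
  moreover have "\<exists>t\<le>r. tl \<mu> \<in> partitions (t * j)" using assms by blast
  ultimately show ?thesis
    using irr_char_rect_eq[OF assms(1,3)] by (simp add: cycle_mult_def)
qed

lemma cycle_mult_Ints:
  assumes "j \<ge> 1"
  shows "cycle_mult j r \<mu> \<in> \<int>"
proof (cases "\<exists>t\<le>r. tl \<mu> \<in> partitions (t * j)")
  case True
  then obtain t where t: "t \<le> r" "tl \<mu> \<in> partitions (t * j)" by blast
  show ?thesis
    unfolding cycle_mult_eq[OF t(2,1) assms]
    by (intro Ints_mult class_value_schur_Ints Ints_sum Ints_of_nat)
next
  case False
  show ?thesis unfolding cycle_mult_def if_not_P[OF False] by (rule Ints_0)
qed

text \<open>Putting a first row of length n - tj on top of \<nu> must give a partition for every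
  \<nu> of size tj; this holds since tj <= n - tj, and it is where the bound on n enters in full
  strength.\<close>

lemma sum_cycle_mult_reindex:
  assumes j: "j \<ge> 1" and n: "n \<ge> 2 * r * j"
  shows "(\<Sum>\<mu>\<in>partitions n. cycle_mult j r \<mu> * class_value M (schur \<mu>)) =
    (\<Sum>t\<le>r. \<Sum>\<nu>\<in>partitions (t * j). cycle_mult j r ((n - t * j) # \<nu>) * class_value M (schur ((n - t * j) # \<nu>)))"
\<comment> \<open>For n = 0 the reindexing would produce \<open>[0]\<close>, which is not a
  partition; both sides still agree because \<open>[0]\<close> and \<open>[]\<close> have the same
  tail and the same Schur function.\<close>
proof (cases "n = 0")
  case True
  then have r: "r = 0" using n j by simp
  have "partitions 0 = {[]}"
    by (auto simp: partitions_def) (metis list.set_intros(1) neq_Nil_conv)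
  then show ?thesis using True r by (simp add: cycle_mult_def)
next
  case False
  let ?P = "\<lambda>\<mu>. \<exists>t\<le>r. tl \<mu> \<in> partitions (t * j)"
  have "(\<Sum>\<mu>\<in>partitions n. cycle_mult j r \<mu> * class_value M (schur \<mu>)) =
      (\<Sum>\<mu>\<in>{\<mu> \<in> partitions n. ?P \<mu>}. cycle_mult j r \<mu> * class_value M (schur \<mu>))"
    by (intro sum.mono_neutral_right) (auto simp: finite_partitions cycle_mult_def)
  also have "\<dots> = (\<Sum>(t, \<nu>)\<in>(SIGMA t:{..r}. partitions (t * j)).
      cycle_mult j r ((n - t * j) # \<nu>) * class_value M (schur ((n - t * j) # \<nu>)))"
  proof (rule sum.reindex_bij_witness[of _ "\<lambda>(t, \<nu>). (n - t * j) # \<nu>" "\<lambda>\<mu>. (sum_list (tl \<mu>) div j, tl \<mu>)"], goal_cases)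
    case (1 \<mu>)
    then show ?case using j False by (cases \<mu>) (auto simp: partitions_def)
  next
    case (2 \<mu>)
    then show ?case using j by (auto simp: partitions_def)
  next
    case (3 x)
    then obtain t \<nu> where "x = (t, \<nu>)" "sum_list \<nu> = t * j" by (auto simp: partitions_def)
    then show ?case using j by simp
  next
    case (4 x)
    then obtain t \<nu> where x: "x = (t, \<nu>)" "t \<le> r" "\<nu> \<in> partitions (t * j)" by auto
    have "t * j \<le> r * j" using x(2) by (rule mult_le_mono1)
    then have le: "2 * (t * j) \<le> n" using n unfolding mult.assoc by linarith
    have "y \<le> n - t * j" if "y \<in> set \<nu>" for y
      using member_le_sum_list[OF that] x(3) le by (auto simp: partitions_def)
    moreover have "n - t * j \<noteq> 0" using le False by auto
    moreover have "n - t * j + t * j = n" using le by simp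
    ultimately have "(n - t * j) # \<nu> \<in> partitions n" using x(3) by (auto simp: partitions_def)
    then show ?case using x by auto
  next
    case (5 \<mu>)
    then show ?case using j False by (cases \<mu>) (auto simp: partitions_def)
  qed
  also have "\<dots> = (\<Sum>t\<le>r. \<Sum>\<nu>\<in>partitions (t * j). cycle_mult j r ((n - t * j) # \<nu>) * class_value M (schur ((n - t * j) # \<nu>)))"
    by (intro sum.Sigma[symmetric]) (auto simp: finite_partitions)
  finally show ?thesis .
qed

theorem theorem1p1:
  fixes r n j :: nat
  assumes "j \<ge> 1" and "n \<ge> 2 * r * j"
  shows "(\<forall>\<mu>\<in>partitions n. cycle_mult j r \<mu> \<in> \<int>) \<and>
         (\<forall>\<sigma>. \<sigma> permutes {..<n} \<longrightarrow>
            (of_nat (num_cycles j n \<sigma>) ^ r :: complex) =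
              1 / of_nat j ^ r * (\<Sum>\<mu>\<in>partitions n. cycle_mult j r \<mu> * irr_char \<mu> \<sigma>))"
proof (intro conjI ballI allI impI)
  show "cycle_mult j r \<mu> \<in> \<int>" for \<mu> using assms(1) by (rule cycle_mult_Ints)
  fix \<sigma> assume \<sigma>: "\<sigma> permutes {..<n}"
  obtain i where i: "j = Suc i" using assms(1) by (cases j) auto
  define M where "M = cycle_type \<sigma> {..<n}"
  have M: "type_size M = n" unfolding M_def using type_size_cycle_type[OF \<sigma>] by simp
  define V :: "nat \<Rightarrow> complex" where "V s = of_nat (Suc i ^ s * (\<Prod>k<s. count M i - k))" for s
  define S :: "nat \<Rightarrow> nat \<Rightarrow> complex" where "S t a = of_nat (Stirling r a * (a choose t) * j ^ (r - a))" for t a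
  \<comment> \<open>\<open>W t\<close> is the value at \<sigma> of the image of (p_j - u^j)^t under
    Bernstein's substitution with first index n - tj.\<close>
  define W where "W t = (\<Sum>s\<le>t. of_nat (t choose s) * (-1) ^ (t - s) * V s)" for t
  have inner: "(\<Sum>\<nu>\<in>partitions (t * j). cycle_mult j r ((n - t * j) # \<nu>) * class_value M (schur ((n - t * j) # \<nu>))) =
      (\<Sum>a=t..r. S t a) * W t" if t: "t \<le> r" for t
  proof -
    let ?M = "replicate_mset t i" and ?N = "n - t * j"
    have wtM: "type_size ?M = t * j" unfolding i by (induction t) auto
    have "t * j \<le> r * j" using t by (rule mult_le_mono1)
    then have le: "t * Suc i \<le> n" using assms(2) unfolding i mult.assoc by linarith
    \<comment> \<open>The character value at (j^t) enters Bernstein's operator as a scalar. By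
      linearity the sum over \<nu> can then be formed inside, where it collapses to a power of
      p_j.\<close>
    have "(\<Sum>\<nu>\<in>partitions (t * j). cycle_mult j r (?N # \<nu>) * class_value M (schur (?N # \<nu>))) =
        (\<Sum>\<nu>\<in>partitions (t * j). (\<Sum>a=t..r. S t a) * class_value M (bernstein ?N (shift (-1) (const (class_value ?M (schur \<nu>)) * schur \<nu>))))"
    proof (rule sum.cong[OF refl])
      fix \<nu> assume "\<nu> \<in> partitions (t * j)"
      then have "cycle_mult j r (?N # \<nu>) = class_value ?M (schur \<nu>) * (\<Sum>a=t..r. S t a)"
        using cycle_mult_eq[of "?N # \<nu>" t j r] t assms(1) by (simp add: i S_def)
      then show "cycle_mult j r (?N # \<nu>) * class_value M (schur (?N # \<nu>)) =
          (\<Sum>a=t..r. S t a) * class_value M (bernstein ?N (shift (-1) (const (class_value ?M (schur \<nu>)) * schur \<nu>)))"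
        by (simp add: mult_ac)
    qed
    also have "\<dots> = (\<Sum>a=t..r. S t a) *
        class_value M (bernstein ?N (shift (-1) (\<Sum>\<nu>\<in>partitions (t * j). const (class_value ?M (schur \<nu>)) * schur \<nu>)))"
      by (simp only: shift_sum bernstein_sum class_value_sum sum_distrib_left)
    also have "(\<Sum>\<nu>\<in>partitions (t * j). const (class_value ?M (schur \<nu>)) * schur \<nu>) = power_sums ?M"
      by (rule sum_class_value_schur[OF wtM])
    also have "power_sums ?M = power_sum i ^ t" by (induction t) (simp_all add: power_sums_add_mset)
    also have "class_value M (bernstein ?N (shift (-1) (power_sum i ^ t))) = W t"
      unfolding W_def V_def i by (rule class_value_bernstein_power_sum_power[OF M le])
    finally show ?thesis .
  qed
  have "(\<Sum>\<mu>\<in>partitions n. cycle_mult j r \<mu> * irr_char \<mu> \<sigma>) =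
      (\<Sum>\<mu>\<in>partitions n. cycle_mult j r \<mu> * class_value M (schur \<mu>))"
    by (intro sum.cong refl) (simp add: irr_char_eq_class_value_schur[OF _ \<sigma>] M_def)
  also have "\<dots> = (\<Sum>t\<le>r. (\<Sum>a=t..r. S t a) * W t)"
    unfolding sum_cycle_mult_reindex[OF assms] by (intro sum.cong refl inner) auto
  also have "\<dots> = (\<Sum>t\<le>r. \<Sum>a=t..r. S t a * W t)"
    by (simp add: sum_distrib_right)
  \<comment> \<open>With \<open>a\<close> outermost, the binomial (a choose t) in the multiplicity
    meets the alternating sum \<open>W t\<close>, so binomial inversion applies for each
    \<open>a\<close> separately.\<close>
  also have "\<dots> = (\<Sum>a\<le>r. \<Sum>t\<le>a. S t a * W t)"
    by (rule sum_triangle_swap[symmetric])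
  also have "\<dots> = (\<Sum>a\<le>r. of_nat (Stirling r a * j ^ (r - a)) * (\<Sum>t\<le>a. of_nat (a choose t) * W t))"
    by (simp add: S_def sum_distrib_left mult_ac)
  also have "\<dots> = (\<Sum>a\<le>r. of_nat (Stirling r a * j ^ (r - a)) * V a)"
    unfolding W_def binomial_inversion ..
  also have "\<dots> = (\<Sum>a\<le>r. of_nat (j ^ r * (Stirling r a * (\<Prod>k<a. count M i - k))))"
  proof (intro sum.cong refl)
    fix a assume "a \<in> {..r}"
    then have "j ^ (r - a) * j ^ a = j ^ r" by (simp flip: power_add)
    then have "Stirling r a * j ^ (r - a) * (j ^ a * (\<Prod>k<a. count M i - k)) = j ^ r * (Stirling r a * (\<Prod>k<a. count M i - k))"
      by (metis mult.assoc mult.commute)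
    then show "of_nat (Stirling r a * j ^ (r - a)) * V a = of_nat (j ^ r * (Stirling r a * (\<Prod>k<a. count M i - k)))"
      unfolding V_def i[symmetric] of_nat_mult[symmetric] by (rule arg_cong)
  qed
  also have "\<dots> = of_nat (j ^ r * count M i ^ r)"
    unfolding power_eq_sum_Stirling[of "count M i" r] sum_distrib_left of_nat_sum ..
  also have "count M i = num_cycles j n \<sigma>"
    using num_cycles_conv_cycle_type[OF \<sigma>, of j] by (simp add: M_def i)
  finally show "(of_nat (num_cycles j n \<sigma>) ^ r :: complex) =
      1 / of_nat j ^ r * (\<Sum>\<mu>\<in>partitions n. cycle_mult j r \<mu> * irr_char \<mu> \<sigma>)"
    using assms(1) by simp
qed

end
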